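(* Let $s\ge 0$ be an integer, and let $x(z)(dz)^{-s}\in H^{-s}_{L^2}(\Delta)$, with representative $x(z)=\sum_{j=s+1}^{\infty}x_jz^{s+j}$. Let $B_{s+1}:H^{-s}_{L^2}(\Delta)\to\mathcal L_2\big(H^{1/2}_{L^2}(\Delta^* ),H^{1/2}_{L^2}(\Delta)\big)$ be the $SU(1,1)$-intertwining map (unique up to a scalar), normalized so that $$B_{s+1}(z^{2s+1})=l_s:=\sum_{i=0}^{s}(-1)^i\binom{s}{i}\,z^{s-i}(dz)^{1/2}\otimes z^i(dz)^{1/2}.$$ Then the higher-order Hankel operator of order $s+1$ with symbol $x(z)(dz)^{-s}$ is $$B_{s+1}(x)=\mathcal P_+L_s(x)\mathcal P_-,$$ where $L_s(x)$ is the differential operator $$L_s(x)=\sum_{j=0}^s\frac{1}{s!}\binom{s}{j}\binom{s+j}{j}\,x^{(s-j)}\left(\frac{\partial}{\partial z}\right)^j .$$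
   Context: $\Delta$ and $\Delta^*$ are the open unit disks around $0$ and $\infty$ in the Riemann sphere. $SU(1,1)$ is the group of matrices $g=\begin{pmatrix}a&b\\ \bar b&\bar a\end{pmatrix}$ with $|a|^2-|b|^2=1$. For a half-integer $m$, $H^m(\Delta)$ is the space of holomorphic differentials $f(z)(dz)^m$ on $\Delta$ ($f$ holomorphic on $\Delta$), and $g\in SU(1,1)$ acts by $$g:f(z)(dz)^m\mapsto f\left(\frac{-\bar b+az}{\bar a-bz}\right)(\bar a-bz)^{-2m}(dz)^m .$$ We write $(dz)^{-1}=\partial/\partial z$. For an integer $m\ge1$, $H^m_{L^2}(\Delta)\subset H^m(\Delta)$ is the Hilbert space of those $f(z)(dz)^m$ with $\int_\Delta|f|^2(1-|z|^2)^{2m-2}\,dA<\infty$. $\Omega^{1/2}_{L^2}(S^1)$ is the space of half-densities $f(z)(dz)^{1/2}$ with $f=\sum_{j\in\mathbb Z}f_jz^j\in L^2(S^1)$, with the $L^2(S^1)$ inner product and the $SU(1,1)$ action given by the same formula with $m=1/2$. It splits $SU(1,1)$-invariantly as $H^{1/2}_{L^2}(\Delta)\oplus H^{1/2}_{L^2}(\Delta^* )$, where the first summand consists of $f$ with only powers $z^j$, $j\ge0$, and the second of $f$ with only powers $z^{-j}$, $j\ge1$. $\mathcal P_+$ and $\mathcal P_-$ are the corresponding projections: $\mathcal P_+f=\sum_{j\ge0}f_jz^j$, $\mathcal P_-f=\sum_{j\ge1}f_{-j}z^{-j}$. $\mathcal L_2(H^{1/2}_{L^2}(\Delta^* ),H^{1/2}_{L^2}(\Delta))$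 is the space of Hilbert–Schmidt operators, on which $g\in SU(1,1)$ acts by $T\mapsto gTg^{-1}$. It is identified equivariantly with the Hilbert tensor product $H^{1/2}_{L^2}(\Delta)\otimes H^{1/2}_{L^2}(\Delta)$ (with the diagonal action) by letting $u(dz)^{1/2}\otimes v(dz)^{1/2}$ act by $f(dz)^{1/2}\mapsto\big(\frac1{2\pi i}\oint_{S^1}vf\,dz\big)u(dz)^{1/2}$; thus $z^a(dz)^{1/2}\otimes z^b(dz)^{1/2}$ sends $f(dz)^{1/2}$ to $f_{-(b+1)}z^a(dz)^{1/2}$. This tensor product decomposes as $\bigoplus_{m\ge1}H^m_{L^2}(\Delta)$ under $SU(1,1)$, and for each $m\geq 1$ the Hankel operator of order $m$ with symbol $\theta\in H^m_{L^2}(\Delta)$ is the image of $\theta$ under the (unique up to scalar) intertwining map $H^m_{L^2}(\Delta)\to\mathcal L_2(H^{1/2}_{L^2}(\Delta^* ),H^{1/2}_{L^2}(\Delta))$. For an integer $s\ge0$, the span $\mathbb C^{2s+1}$ of $z^p(dz)^{-s}$, $0\le p\le2s$, is an invariant subspace of $H^{-s}(\Delta)$, and there is an intertwining map $I_s:H^{-s}(\Delta)\to H^{s+1}(\Delta)$ (a multiple of $x(z)(dz)^{-s}\mapsto x^{(2s+1)}(z)(dz)^{s+1}$) that is surjective with kernel $\mathbb C^{2s+1}$. $H^{-s}_{L^2}(\Delta)$ denotes the Hilbert space of classes in $H^{-s}(\Delta)/\mathbb C^{2s+1}$ whose image under $I_s$ lies in $H^{s+1}_{L^2}(\Delta)$,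 with the Hilbert structure transported by $I_s$. Each class has a unique representative whose power series starts at $z^{2s+1}$. Via $I_s$, symbols of Hankel operators of order $s+1$ are regarded as elements of $H^{-s}_{L^2}(\Delta)$; $B_{s+1}(x)$ abbreviates $B_{s+1}(x(z)(dz)^{-s})$. Differential operators act on $f(z)(dz)^{1/2}$ through the coefficient $f$. The expression $\mathcal P_+L_s(x)\mathcal P_-$ is computed on $f=\sum_{n=1}^Nf_{-n}z^{-n}$ termwise as Laurent series (then $\mathcal P_+$ discards the negative powers), and on all of $H^{1/2}_{L^2}(\Delta^* )$ is understood as the continuous extension from this dense subspace. *)

theory Defs
  imports "HOL-Complex_Analysis.Complex_Analysis"
begin

section \<open>The group SU(1,1) and its action on differentials\<close>

definition SU11 :: "(complex^2^2) set" where
  "SU11 = {g. g $ 2 $ 1 = cnj (g $ 1 $ 2) \<and> g $ 2 $ 2 = cnj (g $ 1 $ 1)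
              \<and> (norm (g $ 1 $ 1))\<^sup>2 - (norm (g $ 1 $ 2))\<^sup>2 = 1}"

text \<open>The action on coefficients of \<open>m\<close>-differentials, indexed by the integer \<open>k = 2m\<close>
  because \<open>m\<close> may be a half-integer. The differential \<open>f(z)(dz)^m\<close> is represented by \<open>f\<close>.\<close>

definition act :: "int \<Rightarrow> complex^2^2 \<Rightarrow> (complex \<Rightarrow> complex) \<Rightarrow> complex \<Rightarrow> complex" where
  "act k g f = (let a = g $ 1 $ 1; b = g $ 1 $ 2 in
     (\<lambda>z. f ((- cnj b + a * z) / (cnj a - b * z)) * (cnj a - b * z) powi (- k)))"


section \<open>Holomorphic differentials on the unit disk\<close>

definition HL2 :: "nat \<Rightarrow> (complex \<Rightarrow> complex) set" where
  "HL2 m = {f. f holomorphic_on ball 0 1 \<and>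
     set_integrable lborel (ball 0 1) (\<lambda>z. (norm (f z))\<^sup>2 * (1 - (norm z)\<^sup>2) ^ (2 * m - 2))}"

definition HL2_norm :: "nat \<Rightarrow> (complex \<Rightarrow> complex) \<Rightarrow> real" where
  "HL2_norm m f =
     sqrt (LINT z:ball 0 1|lborel. (norm (f z))\<^sup>2 * (1 - (norm z)\<^sup>2) ^ (2 * m - 2))"

definition I_map :: "nat \<Rightarrow> (complex \<Rightarrow> complex) \<Rightarrow> complex \<Rightarrow> complex" where
  "I_map s x = (deriv ^^ (2 * s + 1)) x"

text \<open>Elements of \<open>Hneg s\<close> represent classes modulo polynomials of degree at most \<open>2s\<close>;
  \<open>Hneg_norm\<close> is the transported norm of the class, a seminorm on representatives.\<close>

definition Hneg :: "nat \<Rightarrow> (complex \<Rightarrow> complex) set" where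
  "Hneg s = {x. x holomorphic_on ball 0 1 \<and> I_map s x \<in> HL2 (s + 1)}"

definition Hneg_class_eq :: "nat \<Rightarrow> (complex \<Rightarrow> complex) \<Rightarrow> (complex \<Rightarrow> complex) \<Rightarrow> bool" where
  "Hneg_class_eq s x y \<longleftrightarrow>
     (\<exists>p. degree p \<le> 2 * s \<and> (\<forall>z\<in>ball 0 1. x z - y z = poly p z))"

definition Hneg_norm :: "nat \<Rightarrow> (complex \<Rightarrow> complex) \<Rightarrow> real" where
  "Hneg_norm s x = HL2_norm (s + 1) (I_map s x)"


section \<open>Half-densities on the unit circle\<close>

text \<open>Normalized arc length, as a measure on the Borel sets of the plane. Half-densities are
  represented by functions on the plane of which only the values on the circle matter, up to
  null sets.\<close>

definition S1 :: "complex measure" where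
  "S1 = distr (uniform_measure lborel {0..2 * pi}) borel cis"

definition hd_eq :: "(complex \<Rightarrow> complex) \<Rightarrow> (complex \<Rightarrow> complex) \<Rightarrow> bool" where
  "hd_eq f h \<longleftrightarrow> (AE z in S1. f z = h z)"

definition HD :: "(complex \<Rightarrow> complex) set" where
  "HD = {f. f \<in> borel_measurable S1 \<and> integrable S1 (\<lambda>z. (norm (f z))\<^sup>2)}"

definition hd_norm :: "(complex \<Rightarrow> complex) \<Rightarrow> real" where
  "hd_norm f = sqrt (LINT z|S1. (norm (f z))\<^sup>2)"

definition hd_coeff :: "(complex \<Rightarrow> complex) \<Rightarrow> int \<Rightarrow> complex" where
  "hd_coeff f j = (LINT z|S1. f z * z powi (- j))"

text \<open>The summands \<open>H^{1/2}_{L^2}(\<Delta>)\<close> and \<open>H^{1/2}_{L^2}(\<Delta>^*)\<close>.\<close>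

definition HD_plus :: "(complex \<Rightarrow> complex) set" where
  "HD_plus = {f \<in> HD. \<forall>j<0. hd_coeff f j = 0}"

definition HD_minus :: "(complex \<Rightarrow> complex) set" where
  "HD_minus = {f \<in> HD. \<forall>j\<ge>0. hd_coeff f j = 0}"


section \<open>Hilbert--Schmidt operators\<close>

type_synonym hd_op = "(complex \<Rightarrow> complex) \<Rightarrow> complex \<Rightarrow> complex"

definition op_eq :: "hd_op \<Rightarrow> hd_op \<Rightarrow> bool" where
  "op_eq T T' \<longleftrightarrow> (\<forall>f\<in>HD_minus. hd_eq (T f) (T' f))"

definition bounded_op :: "hd_op \<Rightarrow> bool" where
  "bounded_op T \<longleftrightarrow>
     (\<forall>f\<in>HD_minus. T f \<in> HD_plus) \<and>
     (\<forall>f\<in>HD_minus. \<forall>h\<in>HD_minus. hd_eq f h \<longrightarrow> hd_eq (T f) (T h)) \<and>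
     (\<forall>f\<in>HD_minus. \<forall>h\<in>HD_minus. hd_eq (T (\<lambda>z. f z + h z)) (\<lambda>z. T f z + T h z)) \<and>
     (\<forall>c. \<forall>f\<in>HD_minus. hd_eq (T (\<lambda>z. c * f z)) (\<lambda>z. c * T f z)) \<and>
     (\<exists>C. \<forall>f\<in>HD_minus. hd_norm (T f) \<le> C * hd_norm f)"

text \<open>The functions \<open>z^{-n}\<close>, \<open>n \<ge> 1\<close>, are an orthonormal basis of \<open>HD_minus\<close>; the
  Hilbert--Schmidt norm does not depend on the basis.\<close>

definition HS_op :: "hd_op \<Rightarrow> bool" where
  "HS_op T \<longleftrightarrow> bounded_op T \<and>
     summable (\<lambda>n. (hd_norm (T (\<lambda>z. z powi (- int (Suc n)))))\<^sup>2)"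

definition HS_norm :: "hd_op \<Rightarrow> real" where
  "HS_norm T = sqrt (\<Sum>n. (hd_norm (T (\<lambda>z. z powi (- int (Suc n)))))\<^sup>2)"

definition conj_act :: "complex^2^2 \<Rightarrow> hd_op \<Rightarrow> hd_op" where
  "conj_act g T = (\<lambda>f. act 1 g (T (act 1 (matrix_inv g) f)))"

text \<open>The operator \<open>f \<mapsto> (1/(2\<pi>i) \<integral> v f dz) u\<close> given by \<open>u (dz)^{1/2} \<otimes> v (dz)^{1/2}\<close>.\<close>

definition tensor_op :: "(complex \<Rightarrow> complex) \<Rightarrow> (complex \<Rightarrow> complex) \<Rightarrow> hd_op" where
  "tensor_op u v = (\<lambda>f z.
     (1 / (2 * of_real pi * \<i>) * contour_integral (circlepath 0 1) (\<lambda>w. v w * f w)) * u z)"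

definition l_op :: "nat \<Rightarrow> hd_op" where
  "l_op s = (\<lambda>f z. \<Sum>i\<le>s. (- 1) ^ i * of_nat (s choose i) *
     tensor_op (\<lambda>w. w ^ (s - i)) (\<lambda>w. w ^ i) f z)"


section \<open>The Hankel map of order \<open>s + 1\<close>\<close>

definition intertwining :: "nat \<Rightarrow> ((complex \<Rightarrow> complex) \<Rightarrow> hd_op) \<Rightarrow> bool" where
  "intertwining s B \<longleftrightarrow>
     (\<forall>x\<in>Hneg s. HS_op (B x)) \<and>
     (\<forall>x\<in>Hneg s. \<forall>y\<in>Hneg s. Hneg_class_eq s x y \<longrightarrow> op_eq (B x) (B y)) \<and>
     (\<forall>x\<in>Hneg s. \<forall>y\<in>Hneg s. op_eq (B (\<lambda>z. x z + y z)) (\<lambda>f z. B x f z + B y f z)) \<and>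
     (\<forall>c. \<forall>x\<in>Hneg s. op_eq (B (\<lambda>z. c * x z)) (\<lambda>f z. c * B x f z)) \<and>
     (\<exists>C. \<forall>x\<in>Hneg s. HS_norm (B x) \<le> C * Hneg_norm s x) \<and>
     (\<forall>g\<in>SU11. \<forall>x\<in>Hneg s. op_eq (B (act (- 2 * int s) g x)) (conj_act g (B x)))"

definition hankel_map :: "nat \<Rightarrow> ((complex \<Rightarrow> complex) \<Rightarrow> hd_op) \<Rightarrow> bool" where
  "hankel_map s B \<longleftrightarrow> intertwining s B \<and> op_eq (B (\<lambda>z. z ^ (2 * s + 1))) (l_op s)"


section \<open>The differential operator \<open>L_s(x)\<close>\<close>

text \<open>Acting on formal Laurent series; \<open>x\<close> enters through its Taylor series at 0.\<close>

definition L_diff :: "nat \<Rightarrow> (complex \<Rightarrow> complex) \<Rightarrow> complex fls \<Rightarrow> complex fls" where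
  "L_diff s x F = (\<Sum>j\<le>s.
     fls_const (1 / fact s * of_nat (s choose j) * of_nat ((s + j) choose j)) *
     (fls_deriv ^^ (s - j)) (fps_to_fls (fps_expansion x 0)) * (fls_deriv ^^ j) F)"

text \<open>\<open>T\<close> is \<open>P_+ L_s(x) P_-\<close>: a continuous operator which on \<open>f = c_1 z^{-1} + ... + c_N z^{-N}\<close>
  produces the element of \<open>HD_plus\<close> whose coefficients are those of the regular part of the
  Laurent series \<open>L_s(x) f\<close>. These \<open>f\<close> are dense in \<open>HD_minus\<close>, so \<open>T\<close> is determined up to
  \<open>op_eq\<close>.\<close>

definition is_Pplus_L_Pminus :: "nat \<Rightarrow> (complex \<Rightarrow> complex) \<Rightarrow> hd_op \<Rightarrow> bool" where
  "is_Pplus_L_Pminus s x T \<longleftrightarrow> bounded_op T \<and>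
     (\<forall>(N::nat) (c::nat \<Rightarrow> complex) (k::nat).
        hd_coeff (T (\<lambda>z. \<Sum>n=1..N. c n * z powi (- int n))) (int k) =
        fps_nth (fls_regpart (L_diff s x
          (\<Sum>n=1..N. fls_const (c n) * fls_X_intpow (- int n)))) k)"

end

theory Submission
  imports Defs
begin

text \<open>
  In the bases \<open>z^k\<close> and \<open>z^{-n-1}\<close> the operator \<open>P_+ L_s(x) P_-\<close> has the matrix
  \<open>x_{k+n+s+1} W(k, n)\<close>, where \<open>x_m\<close> are the Taylor coefficients of the symbol; Vandermonde
  convolution identifies \<open>W(k, n)\<close> with the coefficient of \<open>z^k w^n\<close> in
  \<open>(z - w)^s / ((1 - z) (1 - w))^{s+1}\<close>. Since \<open>W\<close> grows like \<open>(k + n)^s\<close>, the matrix is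
  Hilbert--Schmidt exactly with the weights of the symbol norm.

  Everything else is checked on the symbols \<open>y_\<beta> = z^{2s+1} / (1 - \<beta> z)\<close>, \<open>|\<beta>| < 1\<close>. Modulo
  polynomials of degree at most \<open>2 s\<close> they form, up to scalars, the \<open>SU(1,1)\<close>-orbit of
  \<open>y_0 = z^{2s+1}\<close>, and the operator of \<open>y_\<beta>\<close> has the integral kernel
  \<open>(z - w)^s / ((1 - \<beta> z) (1 - \<beta> w))^{s+1}\<close>, which transforms in the same way. A continuous
  functional of the symbol that vanishes on all \<open>y_\<beta>\<close> and on polynomials of degree at most \<open>2 s\<close>
  vanishes, because \<open>\<beta>\<close> generates the Taylor coefficients. Applied to matrix entries, this gives
  the equivariance of the operator above, and the uniqueness of an intertwining map with prescribed
  value at \<open>y_0\<close>.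
\<close>

section \<open>Fourier analysis on the circle\<close>

text \<open>Half-densities are functions modulo null sets, so operators agree only up to
  \<open>op_eq\<close> and their linearity holds only almost everywhere. Comparisons are therefore
  made on Fourier coefficients, where equality is exact, and bounded operators agree once their
  matrices do. The group acts by composition with a Moebius map, which makes sense on classes only
  because null sets pull back to null sets; this comes from a change of variables for arc length,
  obtained from moments and Cauchy's theorem instead of an angle parametrization.

  The delicate point of equivariance is the transformed symbol. An a priori estimate of its norm is
  avoided: its Taylor coefficients are expanded in those of the symbol by locally uniform
  convergence, its matrix is compared with that of the conjugated operator, and boundedness is
  inherited from the latter. The orbit symbols are convenient because their kernels separate into s
  + 1 products: their operators have finite rank, and covariance is an identity between rational
  functions.\<close>

lemma sets_S1 [measurable_cong, simp]: "sets S1 = sets borel"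
  by (simp add: S1_def)

lemma space_S1 [simp]: "space S1 = UNIV"
  by (simp add: S1_def)

lemma cis_borel_measurable [measurable]: "cis \<in> borel_measurable borel"
  by (intro borel_measurable_continuous_onI continuous_intros)

lemma borel_measurable_power_int [measurable (raw)]:
  fixes f :: "'a \<Rightarrow> complex"
  assumes [measurable]: "f \<in> borel_measurable M"
  shows "(\<lambda>z. f z powi k) \<in> borel_measurable M"
  unfolding power_int_def by (cases "k \<ge> 0") simp_all

lemma unit_circle_inverse: "norm z = 1 \<Longrightarrow> inverse z = cnj z"
  by (rule inverse_unique) (simp add: complex_norm_square[symmetric])

lemma prob_space_arc: "emeasure (uniform_measure lborel {0..2 * pi}) UNIV = 1"
  using emeasure_uniform_measure_1[of lborel "{0..2*pi}"] by simp

lemma emeasure_S1_UNIV: "emeasure S1 UNIV = 1"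
  unfolding S1_def by (subst emeasure_distr) (auto simp: prob_space_arc)

lemma finite_measure_S1: "finite_measure S1"
  by (rule finite_measureI) (simp add: emeasure_S1_UNIV)

interpretation S1: finite_measure S1
  by (rule finite_measure_S1)

lemma measure_S1_UNIV [simp]: "measure S1 UNIV = 1"
  by (simp add: measure_def emeasure_S1_UNIV)

lemma AE_S1_sphere: "AE z in S1. norm z = 1"
  unfolding S1_def by (subst AE_distr_iff) auto

lemma AE_S1_I: "(\<And>z. norm z = 1 \<Longrightarrow> P z) \<Longrightarrow> AE z in S1. P z"
  using AE_S1_sphere by (rule AE_mp) (auto intro: AE_I2)

lemma LINT_S1_cong:
  fixes f g :: "complex \<Rightarrow> 'b::{banach, second_countable_topology}"
  assumes "f \<in> borel_measurable borel" "g \<in> borel_measurable borel"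
    and "\<And>z. norm z = 1 \<Longrightarrow> f z = g z"
  shows "(LINT z|S1. f z) = (LINT z|S1. g z)"
  using assms by (intro integral_cong_AE AE_S1_I) auto

lemma integrable_S1_bounded:
  fixes f :: "complex \<Rightarrow> 'b::{banach, second_countable_topology}"
  assumes "f \<in> borel_measurable borel" "\<And>z. norm z = 1 \<Longrightarrow> norm (f z) \<le> C"
  shows "integrable S1 f"
  by (rule S1.integrable_const_bound[of f C]) (use assms in \<open>auto intro: AE_S1_I\<close>)

lemma integrable_S1_bounded_mult:
  fixes f h :: "complex \<Rightarrow> complex"
  assumes "f \<in> borel_measurable borel" "\<And>z. norm z = 1 \<Longrightarrow> norm (f z) \<le> C"
    and "integrable S1 h"
  shows "integrable S1 (\<lambda>z. f z * h z)"
proof (rule Bochner_Integration.integrable_bound)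
  show "integrable S1 (\<lambda>z. C * norm (h z))" using assms by auto
  show "(\<lambda>z. f z * h z) \<in> borel_measurable S1" using assms by auto
  show "AE z in S1. norm (f z * h z) \<le> norm (C * norm (h z))"
  proof (rule AE_S1_I)
    fix z :: complex assume z: "norm z = 1"
    have "0 \<le> C" using assms(2)[OF z] norm_ge_zero order_trans by blast
    then show "norm (f z * h z) \<le> norm (C * norm (h z))"
      using assms(2)[OF z] by (simp add: norm_mult mult_right_mono)
  qed
qed

text \<open>Contour integrals are gauge integrals over a parameter interval, while \<open>S1\<close>
  is a push-forward measure; the density 1/(2 pi) of the uniform measure is the factor between them.
  This makes Cauchy's theorem available for Lebesgue integrals over \<open>S1\<close>.\<close>

lemma integral_S1_circle:
  fixes f :: "complex \<Rightarrow> complex"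
  assumes [measurable]: "f \<in> borel_measurable borel" and int: "integrable S1 f"
  shows "((\<lambda>t. f (cis t)) has_integral (2 * pi * (LINT z|S1. f z))) {0..2*pi}"
proof -
  have dens: "uniform_measure lborel {0..2*pi} = density lborel (\<lambda>x. ennreal (indicator {0..2*pi} x / (2*pi)))"
    unfolding uniform_measure_def
    by (rule arg_cong[where f="density lborel"])
       (auto simp: fun_eq_iff indicator_def divide_ennreal simp flip: ennreal_1)
  have eq: "(LINT z|S1. f z) = (LINT x|lborel. (indicator {0..2*pi} x / (2*pi)) *\<^sub>R f (cis x))"
    unfolding S1_def by (subst integral_distr, simp, simp)
      (unfold dens, subst integral_density, auto)
  have "integrable lborel (\<lambda>x. (indicator {0..2*pi} x / (2*pi)) *\<^sub>R f (cis x))"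
    using int unfolding S1_def by (subst (asm) integrable_distr_eq, simp, simp)
      (unfold dens, subst (asm) integrable_density, auto)
  then have "integrable lborel (\<lambda>x. (2*pi) *\<^sub>R ((indicator {0..2*pi} x / (2*pi)) *\<^sub>R f (cis x)))"
    by (rule integrable_scaleR_right)
  then have si: "set_integrable lborel {0..2*pi} (\<lambda>x. f (cis x))"
    unfolding set_integrable_def by (simp add: divide_simps)
  have "(LINT x:{0..2*pi}|lborel. f (cis x)) = (2*pi) *\<^sub>R (LINT z|S1. f z)"
    unfolding eq set_lebesgue_integral_def
    by (subst integral_scaleR_right[symmetric]) (auto simp: divide_simps)
  with set_borel_integral_eq_integral[OF si] show ?thesis
    by (metis integrable_integral scaleR_conv_of_real of_real_mult of_real_numeral)
qed

text \<open>On the unit circle dz = i z dt, hence the extra factor \<open>z\<close> in every pairing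
  over \<open>S1\<close> below.\<close>

lemma has_contour_integral_S1:
  fixes f :: "complex \<Rightarrow> complex"
  assumes [measurable]: "f \<in> borel_measurable borel" and int: "integrable S1 f"
  shows "(f has_contour_integral (2 * of_real pi * \<i> * (LINT z|S1. f z * z))) (circlepath 0 1)"
proof -
  have "integrable S1 (\<lambda>z. z * f z)"
    by (rule integrable_S1_bounded_mult[OF _ _ int, where C=1]) auto
  then have "integrable S1 (\<lambda>z. f z * z)" by (simp add: mult.commute)
  from has_integral_mult_left[OF integral_S1_circle[OF _ this], of \<i>]
  show ?thesis
    unfolding circlepath_def
    by (subst has_contour_integral_part_circlepath_iff) (auto simp: algebra_simps)
qed

lemma holomorphic_pairing_zero:
  assumes holo: "G holomorphic_on cball 0 1"
    and [measurable]: "G \<in> borel_measurable borel"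
  shows "(LINT z|S1. G z * z) = 0"
proof -
  obtain C where C: "\<And>z. z \<in> cball 0 1 \<Longrightarrow> norm (G z) \<le> C"
    using compact_imp_bounded[OF compact_continuous_image[OF holomorphic_on_imp_continuous_on[OF holo] compact_cball]]
    by (metis bounded_iff imageI)
  have int: "integrable S1 G"
    by (rule integrable_S1_bounded[of G C]) (auto intro: C)
  have "(G has_contour_integral 0) (circlepath 0 1)"
    by (rule Cauchy_theorem_convex_simple[OF holo convex_cball]) auto
  from has_contour_integral_unique[OF this has_contour_integral_S1[OF assms(2) int]]
  show ?thesis by auto
qed

text \<open>On the circle real polynomials are Laurent polynomials in z, so equal moments give equal
  integrals of polynomials, by Stone-Weierstrass of continuous functions, by dominated convergence
  of indicators of closed sets, and by the Dynkin argument of indicators of Borel sets. With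
  \<open>p\<close> the identity this yields uniqueness of Fourier coefficients, with
  \<open>p\<close> a Moebius map the change of variables for arc length.\<close>

lemma S1_moments_determine:
  fixes h1 h2 p :: "complex \<Rightarrow> complex"
  assumes int1: "integrable S1 h1" and int2: "integrable S1 h2"
    and p [measurable]: "p \<in> borel_measurable borel"
    and p_circle: "\<And>z. norm z = 1 \<Longrightarrow> norm (p z) = 1"
    and moments: "\<And>k::int. (LINT z|S1. z powi k * h1 z) = (LINT z|S1. p z powi k * h2 z)"
    and A: "A \<in> sets borel"
  shows "(LINT z|S1. indicator A z * h1 z) = (LINT z|S1. indicator A (p z) * h2 z)"
proof -
  have [measurable]: "h1 \<in> borel_measurable borel" "h2 \<in> borel_measurable borel"
    using int1 int2 by (auto dest: borel_measurable_integrable)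
  define good where "good t \<longleftrightarrow> t \<in> borel_measurable borel \<and> (\<exists>C. \<forall>z. norm z = 1 \<longrightarrow> norm (t z) \<le> C)"
    for t :: "complex \<Rightarrow> complex"
  define E where "E t = (LINT z|S1. t z * h1 z) - (LINT z|S1. t (p z) * h2 z)" for t
  have good_meas [measurable_dest]: "good t \<Longrightarrow> t \<in> borel_measurable borel" for t
    by (simp add: good_def)
  have i1: "integrable S1 (\<lambda>z. t z * h1 z)" and i2: "integrable S1 (\<lambda>z. t (p z) * h2 z)" if "good t" for t
  proof -
    from that obtain C where C: "\<And>z. norm z = 1 \<Longrightarrow> norm (t z) \<le> C" and [measurable]: "t \<in> borel_measurable borel"
      by (auto simp: good_def)
    show "integrable S1 (\<lambda>z. t z * h1 z)"
      by (rule integrable_S1_bounded_mult[where C=C]) (use C int1 in auto)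
    show "integrable S1 (\<lambda>z. t (p z) * h2 z)"
      by (rule integrable_S1_bounded_mult[where C=C]) (use C int2 p_circle in auto)
  qed
  have E_cong: "E t = E u" if "good t" "good u" "\<And>z. norm z = 1 \<Longrightarrow> t z = u z" for t u
  proof -
    note that(1,2)[THEN good_meas, measurable]
    show ?thesis
      unfolding E_def by (intro arg_cong2[where f="(-)"] LINT_S1_cong) (use that p_circle in auto)
  qed
  have E_add: "E (\<lambda>z. t z + u z) = E t + E u" if "good t" "good u" for t u
    unfolding E_def using i1[OF that(1)] i1[OF that(2)] i2[OF that(1)] i2[OF that(2)]
    by (simp add: ring_distribs)
  have E_cmult: "E (\<lambda>z. c * t z) = c * E t" for c t
    unfolding E_def by (simp add: mult.assoc right_diff_distrib)
  have E_lim: "(\<lambda>n. E (t n)) \<longlonglongrightarrow> E u"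
    if t [measurable]: "\<And>n. t n \<in> borel_measurable borel" and u [measurable]: "u \<in> borel_measurable borel"
      and bd: "\<And>n z. norm z = 1 \<Longrightarrow> norm (t n z) \<le> C"
      and lim: "\<And>z. norm z = 1 \<Longrightarrow> (\<lambda>n. t n z) \<longlonglongrightarrow> u z" for t u C
  proof -
    have "0 \<le> C" using bd[of 1 0] norm_ge_zero[of "t 0 1"] by (simp del: norm_ge_zero)
    have "(\<lambda>n. LINT z|S1. t n z * h1 z) \<longlonglongrightarrow> (LINT z|S1. u z * h1 z)"
    proof (rule integral_dominated_convergence)
      show "integrable S1 (\<lambda>z. C * norm (h1 z))" using int1 by auto
      show "AE z in S1. (\<lambda>n. t n z * h1 z) \<longlonglongrightarrow> u z * h1 z"
        by (rule AE_S1_I) (auto intro!: tendsto_intros lim)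
      show "AE z in S1. norm (t n z * h1 z) \<le> C * norm (h1 z)" for n
        by (rule AE_S1_I) (auto simp: norm_mult intro!: mult_right_mono bd)
    qed measurable
    moreover have "(\<lambda>n. LINT z|S1. t n (p z) * h2 z) \<longlonglongrightarrow> (LINT z|S1. u (p z) * h2 z)"
    proof (rule integral_dominated_convergence)
      show "integrable S1 (\<lambda>z. C * norm (h2 z))" using int2 by auto
      show "AE z in S1. (\<lambda>n. t n (p z) * h2 z) \<longlonglongrightarrow> u (p z) * h2 z"
        by (rule AE_S1_I) (auto intro!: tendsto_intros lim p_circle)
      show "AE z in S1. norm (t n (p z) * h2 z) \<le> C * norm (h2 z)" for n
        by (rule AE_S1_I) (auto simp: norm_mult intro!: mult_right_mono bd p_circle)
    qed measurable
    ultimately show ?thesis unfolding E_def by (intro tendsto_diff)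
  qed
  have good_mult: "good (\<lambda>z. t z * u z)" if "good t" "good u" for t u
  proof -
    from that obtain C D where C: "\<And>z. norm z = 1 \<Longrightarrow> norm (t z) \<le> C"
      and D: "\<And>z. norm z = 1 \<Longrightarrow> norm (u z) \<le> D" by (auto simp: good_def)
    have "norm (t z * u z) \<le> C * D" if z: "norm z = 1" for z
      using C[OF z] D[OF z] by (simp add: norm_mult mult_mono')
    with that show ?thesis unfolding good_def by auto
  qed
  have good_add: "good (\<lambda>z. t z + u z)" if "good t" "good u" for t u
  proof -
    from that obtain C D where C: "\<And>z. norm z = 1 \<Longrightarrow> norm (t z) \<le> C"
      and D: "\<And>z. norm z = 1 \<Longrightarrow> norm (u z) \<le> D" by (auto simp: good_def)
    have "norm (t z + u z) \<le> C + D" if z: "norm z = 1" for z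
      using C[OF z] D[OF z] norm_triangle_mono by blast
    with that show ?thesis unfolding good_def by auto
  qed
  have good_const: "good (\<lambda>z. c)" for c by (auto simp: good_def)
  have good_powi: "good (\<lambda>z. z powi k)" for k :: int
    by (auto simp: good_def norm_power_int intro!: exI[of _ 1])
  have good_cont: "good t" if "continuous_on UNIV t" for t
  proof -
    have "compact (t ` sphere 0 1)"
      by (intro compact_continuous_image continuous_on_subset[OF that]) auto
    then obtain C where "\<And>z. z \<in> sphere 0 1 \<Longrightarrow> norm (t z) \<le> C"
      by (metis compact_imp_bounded bounded_iff imageI)
    then show ?thesis using that unfolding good_def
      by (auto intro!: exI[of _ C] borel_measurable_continuous_onI)
  qed
  \<comment> \<open>Membership demands vanishing against all powers \<open>z powi k\<close> at once:
    this is what multiplication by a linear function preserves, since it only shifts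
    \<open>k\<close>.\<close>
  define Z where "Z = {t. good t \<and> (\<forall>k::int. E (\<lambda>z. t z * z powi k) = 0)}"
  have good_poly: "good (\<lambda>z. of_real (g z))" if "real_polynomial_function g" for g
    by (rule good_cont) (intro continuous_intros continuous_real_polymonial_function that continuous_at_imp_continuous_on ballI)
  \<comment> \<open>The test function \<open>t\<close> stays arbitrary in the induction, so that a
    product f g is treated by applying the hypothesis for \<open>f\<close> to g t.\<close>
  have Z_poly: "(\<lambda>z. of_real (g z) * t z) \<in> Z" if "real_polynomial_function g" "t \<in> Z" for g t
    using that
  proof (induction arbitrary: t rule: real_polynomial_function.induct)
    case (linear g t)
    have gt: "good t" and tz: "\<And>k. E (\<lambda>z. t z * z powi k) = 0" using linear by (auto simp: Z_def)
    \<comment> \<open>With z = x + i y and conj z = 1/z on the circle, g(z) = x g(1) + y g(i)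
      becomes c z + conj(c)/z for this \<open>c\<close>.\<close>
    define c where "c = Complex (g 1) (- g \<i>) / 2"
    have gz: "of_real (g z) = c * z + cnj c * z powi (-1)" if "norm z = 1" for z
    proof -
      interpret g: bounded_linear g by (rule linear(1))
      have "z = Re z *\<^sub>R 1 + Im z *\<^sub>R \<i>" by (simp add: complex_eq_iff)
      then have "g z = g (Re z *\<^sub>R 1 + Im z *\<^sub>R \<i>)" by (rule arg_cong)
      then have gz: "g z = Re z * g 1 + Im z * g \<i>"
        unfolding g.add g.scaleR by simp
      have zi: "z powi (-1) = cnj z"
        using unit_circle_inverse[OF that] by (simp add: power_int_minus)
      show ?thesis unfolding zi gz c_def complex_eq_iff by (simp; argo)
    qed
    have "E (\<lambda>z. of_real (g z) * t z * z powi k) = 0" for k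
    proof -
      have "E (\<lambda>z. of_real (g z) * t z * z powi k)
         = E (\<lambda>z. c * (t z * z powi (k+1)) + cnj c * (t z * z powi (k-1)))"
      proof (rule E_cong)
        show "good (\<lambda>z. of_real (g z) * t z * z powi k)"
          using good_poly[OF real_polynomial_function.intros(1)[OF linear(1)]] gt good_powi good_mult by metis
        show "good (\<lambda>z. c * (t z * z powi (k+1)) + cnj c * (t z * z powi (k-1)))"
          by (intro good_add good_mult good_const gt good_powi)
        fix z :: complex assume z: "norm z = 1"
        then have "z \<noteq> 0" by auto
        then show "of_real (g z) * t z * z powi k = c * (t z * z powi (k+1)) + cnj c * (t z * z powi (k-1))"
          unfolding gz[OF z] by (simp add: power_int_add power_int_diff field_simps power_int_minus)
      qed
      also have "\<dots> = 0"
        by (subst E_add) (auto intro!: good_mult gt good_powi good_const simp: E_cmult tz)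
      finally show ?thesis .
    qed
    then show ?case
      using good_mult[OF good_poly[OF real_polynomial_function.intros(1)[OF linear(1)]] gt] by (auto simp: Z_def)
  next
    case (const c t)
    then have "good t" "\<And>k. E (\<lambda>z. t z * z powi k) = 0" by (auto simp: Z_def)
    then show ?case
      using E_cmult[of "of_real c"] by (auto simp: Z_def mult.assoc intro!: good_mult[OF good_const])
  next
    case (add f g t)
    from add.IH(1)[OF add.prems] add.IH(2)[OF add.prems]
    have f: "good (\<lambda>z. of_real (f z) * t z)" "\<And>k. E (\<lambda>z. of_real (f z) * t z * z powi k) = 0"
     and g: "good (\<lambda>z. of_real (g z) * t z)" "\<And>k. E (\<lambda>z. of_real (g z) * t z * z powi k) = 0" by (auto simp: Z_def)
    show ?case
      using good_add[OF f(1) g(1)] E_add[OF good_mult[OF f(1) good_powi] good_mult[OF g(1) good_powi]] f(2) g(2)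
      by (simp add: Z_def ring_distribs)
  next
    case (mult f g t)
    from mult.IH(1)[OF mult.IH(2)[OF mult.prems]] show ?case by (simp add: mult.assoc)
  qed
  have Z1: "(\<lambda>z. 1) \<in> Z"
    using moments by (simp add: Z_def good_const E_def)
  have E_poly: "E (\<lambda>z. of_real (g z)) = 0" if "real_polynomial_function g" for g
    using Z_poly[OF that Z1] by (auto simp: Z_def dest!: spec[of _ 0])
  have E_cont: "E (\<lambda>z. of_real (c z)) = 0" if "continuous_on UNIV c" for c :: "complex \<Rightarrow> real"
  proof -
    have "\<exists>g. real_polynomial_function g \<and> (\<forall>z\<in>sphere 0 1. \<bar>c z - g z\<bar> < 1 / real (Suc n))" for n
      by (rule Stone_Weierstrass_real_polynomial_function[of "sphere 0 1" c "1 / real (Suc n)"])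
         (use that in \<open>auto intro: continuous_on_subset\<close>)
    then obtain g where g': "\<forall>n. real_polynomial_function (g n) \<and> (\<forall>z\<in>sphere 0 1. \<bar>c z - g n z\<bar> < 1 / real (Suc n))"
      by metis
    then have g: "\<And>n. real_polynomial_function (g n)"
      and gc: "\<And>n z. norm z = 1 \<Longrightarrow> \<bar>c z - g n z\<bar> < 1 / real (Suc n)"
      by (simp_all del: of_nat_Suc)
    have "good (\<lambda>z. of_real (c z))" by (rule good_cont) (intro continuous_intros that)
    then obtain C where C: "\<And>z. norm z = 1 \<Longrightarrow> \<bar>c z\<bar> \<le> C" by (auto simp: good_def)
    have "(\<lambda>n. E (\<lambda>z. of_real (g n z))) \<longlonglongrightarrow> E (\<lambda>z. of_real (c z))"
    proof (rule E_lim)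
      show "(\<lambda>z. complex_of_real (g n z)) \<in> borel_measurable borel" for n
        using good_poly[OF g] by (simp add: good_def)
      show "(\<lambda>z. complex_of_real (c z)) \<in> borel_measurable borel"
        using that by (auto intro!: borel_measurable_continuous_onI continuous_intros)
      fix z :: complex assume z: "norm z = 1"
      show "cmod (complex_of_real (g n z)) \<le> C + 1" for n
      proof -
        have "1 / real (Suc n) \<le> 1" by simp
        then show ?thesis using C[OF z] gc[OF z, of n] unfolding norm_of_real by linarith
      qed
      have "(\<lambda>n. g n z - c z) \<longlonglongrightarrow> 0"
        by (rule Lim_null_comparison[OF always_eventually LIMSEQ_inverse_real_of_nat])
           (use gc[OF z] in \<open>auto simp: abs_minus_commute inverse_eq_divide intro!: less_imp_le\<close>)
      then have "(\<lambda>n. g n z) \<longlonglongrightarrow> c z" by (simp add: LIM_zero_iff)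
      then show "(\<lambda>n. complex_of_real (g n z)) \<longlonglongrightarrow> complex_of_real (c z)"
        by (rule tendsto_of_real)
    qed
    then show ?thesis by (simp add: E_poly[OF g] LIMSEQ_const_iff)
  qed
  have good_ind: "good (indicator B)" if "B \<in> sets borel" for B
    using that by (auto simp: good_def indicator_def intro!: exI[of _ 1])
  have "E (indicator A) = 0"
  proof -
    have "A \<in> sigma_sets UNIV (Collect closed)" using A by (simp add: borel_eq_closed)
    then show ?thesis
    proof (rule sigma_sets_induct_disjoint[rotated 2])
      show "Int_stable (Collect (closed :: complex set \<Rightarrow> bool))" by (auto simp: Int_stable_def)
      show "Collect (closed :: complex set \<Rightarrow> bool) \<subseteq> Pow UNIV" by simp
    next
      fix C :: "complex set" assume "C \<in> Collect closed"
      then have C: "closed C" by simp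
      show "E (indicator C) = 0"
      \<comment> \<open>The distance to the empty set is 0 by convention, so the approximating
        functions used below would be 1 instead of 0; hence the separate case.\<close>
      proof (cases "C = {}")
        case True then show ?thesis by (simp add: E_def)
      next
        case False
        \<comment> \<open>These continuous functions equal 1 on the closed set \<open>C\<close> and
          decrease to 0 off it as \<open>n\<close> grows.\<close>
        define c where "c n z = max 0 (1 - real n * infdist z C)" for n z
        have cont: "continuous_on UNIV (c n)" for n
          unfolding c_def by (intro continuous_intros)
        have "(\<lambda>n. E (\<lambda>z. of_real (c n z))) \<longlonglongrightarrow> E (indicator C)"
        proof (rule E_lim)
          show "(\<lambda>z. complex_of_real (c n z)) \<in> borel_measurable borel" for n
            using cont by (auto intro!: borel_measurable_continuous_onI continuous_intros)
          show "(indicator C :: complex \<Rightarrow> complex) \<in> borel_measurable borel" using C by auto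
          show "cmod (complex_of_real (c n z)) \<le> 1" for n z
            by (auto simp: c_def infdist_nonneg max_def)
          fix z
          show "(\<lambda>n. complex_of_real (c n z)) \<longlonglongrightarrow> indicator C z"
          proof (cases "z \<in> C")
            case True then show ?thesis by (simp add: c_def)
          next
            case notin: False
            then have pos: "infdist z C > 0"
              using C False in_closed_iff_infdist_zero infdist_nonneg by (metis less_eq_real_def)
            obtain N where N: "real N * infdist z C > 1" using pos reals_Archimedean3 by metis
            have "eventually (\<lambda>n. complex_of_real (c n z) = 0) sequentially"
            proof (rule eventually_sequentiallyI[of N])
              fix n assume "N \<le> n"
              then have "real N * infdist z C \<le> real n * infdist z C" using pos by (intro mult_right_mono) auto
              with N show "complex_of_real (c n z) = 0" by (simp add: c_def)
            qed
            with notin show ?thesis by (simp add: tendsto_eventually)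
          qed
        qed
        then show ?thesis by (simp add: E_cont[OF cont] LIMSEQ_const_iff)
      qed
    next
      show "E (indicator {}) = 0" by (simp add: E_def)
    next
      fix B :: "complex set" assume B: "B \<in> sigma_sets UNIV (Collect closed)" and EB: "E (indicator B) = 0"
      then have [measurable]: "B \<in> sets borel" by (simp add: borel_eq_closed)
      have "E (indicator (UNIV - B)) = E (\<lambda>z. 1 + (-1) * indicator B z)"
        by (rule arg_cong[where f=E]) (auto simp: indicator_def fun_eq_iff)
      also have "\<dots> = 0"
        using E_add[OF good_const good_mult[OF good_const good_ind], of B 1 "-1"] EB E_cont[of "\<lambda>_. 1"]
        by (simp only: E_cmult) simp
      finally show "E (indicator (UNIV - B)) = 0" .
    next
      fix B :: "nat \<Rightarrow> complex set"
      assume disj: "disjoint_family B" and "range B \<subseteq> sigma_sets UNIV (Collect closed)"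
        and EB: "\<And>i. E (indicator (B i)) = 0"
      then have [measurable]: "\<And>i. B i \<in> sets borel" by (auto simp: borel_eq_closed)
      have sum: "(\<Sum>i<n. indicator (B i) z :: complex) = indicator (\<Union>i<n. B i) z" for n z
        by (rule indicator_UN_disjoint[symmetric]) (auto intro: disjoint_family_on_mono[OF _ disj])
      have Es: "E (\<lambda>z. \<Sum>i<n. indicator (B i) z) = 0" for n
      proof (induction n)
        case (Suc n)
        have "good (\<lambda>z. \<Sum>i<n. indicator (B i) z)" unfolding sum by (rule good_ind) auto
        then show ?case using Suc EB by (simp add: E_add good_ind)
      qed (simp add: E_def)
      have "(\<lambda>n. E (\<lambda>z. \<Sum>i<n. indicator (B i) z)) \<longlonglongrightarrow> E (indicator (\<Union>i. B i))"
      proof (rule E_lim)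
        show "cmod (\<Sum>i<n. indicator (B i) z) \<le> 1" for n z
          unfolding sum by (simp add: indicator_def)
        show "(\<lambda>n. \<Sum>i<n. indicator (B i) z :: complex) \<longlonglongrightarrow> indicator (\<Union>i. B i) z" for z
          unfolding sum by (rule LIMSEQ_indicator_UN)
      qed measurable
      then show "E (indicator (\<Union>i. B i)) = 0" by (simp add: Es LIMSEQ_const_iff)
    qed
  qed
  then show ?thesis by (simp add: E_def)
qed

section \<open>Square-integrable functions on the circle and their Fourier coefficients\<close>

lemma HD_measurable [measurable_dest]: "f \<in> HD \<Longrightarrow> f \<in> borel_measurable borel"
  by (simp add: HD_def measurable_cong_sets[OF sets_S1 refl])

lemma borel_measurable_cnj [measurable (raw)]:
  "f \<in> borel_measurable M \<Longrightarrow> (\<lambda>x. cnj (f x)) \<in> borel_measurable M"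
  by (rule measurable_compose[where g=cnj]) (auto intro!: borel_measurable_continuous_onI continuous_intros)

lemma HD_square_integrable: "f \<in> HD \<Longrightarrow> integrable S1 (\<lambda>z. (norm (f z))\<^sup>2)"
  by (simp add: HD_def)

lemma HD_bounded:
  assumes "f \<in> borel_measurable borel" "\<And>z. norm z = 1 \<Longrightarrow> norm (f z) \<le> C"
  shows "f \<in> HD"
proof -
  have "norm (norm (f z) ^ 2) \<le> C^2" if "norm z = 1" for z
    using assms(2)[OF that] by (simp add: power_mono)
  then show ?thesis using assms by (auto simp: HD_def intro!: integrable_S1_bounded)
qed

lemma HD_continuous_circle:
  assumes [measurable]: "f \<in> borel_measurable borel" and "continuous_on (sphere 0 1) f"
  shows "f \<in> HD"
proof -
  have "compact (f ` sphere 0 1)" by (intro compact_continuous_image assms) auto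
  then obtain C where "\<And>z. z \<in> sphere 0 1 \<Longrightarrow> norm (f z) \<le> C"
    by (metis compact_imp_bounded bounded_iff imageI)
  then show ?thesis by (intro HD_bounded[of f C]) auto
qed

lemma HD_powi [simp]: "(\<lambda>z. z powi k) \<in> HD"
  by (rule HD_bounded[of _ 1]) (auto simp: norm_power_int)

lemma HD_zero [simp]: "(\<lambda>z. 0) \<in> HD"
  by (rule HD_bounded[of _ 0]) auto

lemma HD_cmult: "f \<in> HD \<Longrightarrow> (\<lambda>z. c * f z) \<in> HD"
  by (auto simp: HD_def norm_mult power_mult_distrib)

lemma HD_add:
  assumes f: "f \<in> HD" and g: "g \<in> HD"
  shows "(\<lambda>z. f z + g z) \<in> HD"
proof -
  note [measurable] = HD_measurable[OF f] HD_measurable[OF g]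
  have "integrable S1 (\<lambda>z. (norm (f z + g z))\<^sup>2)"
  proof (rule Bochner_Integration.integrable_bound)
    show "integrable S1 (\<lambda>z. 2 * (norm (f z))\<^sup>2 + 2 * (norm (g z))\<^sup>2)"
      using HD_square_integrable[OF f] HD_square_integrable[OF g] by auto
    show "AE z in S1. norm ((norm (f z + g z))\<^sup>2) \<le> norm (2 * (norm (f z))\<^sup>2 + 2 * (norm (g z))\<^sup>2)"
    proof (rule AE_I2)
      fix z
      have "(norm (f z + g z))\<^sup>2 \<le> (norm (f z) + norm (g z))\<^sup>2"
        by (intro power_mono norm_triangle_ineq) auto
      also have "\<dots> \<le> 2 * (norm (f z))\<^sup>2 + 2 * (norm (g z))\<^sup>2"
        using zero_le_power2[of "norm (f z) - norm (g z)"] by (simp add: power2_eq_square algebra_simps)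
      finally show "norm ((norm (f z + g z))\<^sup>2) \<le> norm (2 * (norm (f z))\<^sup>2 + 2 * (norm (g z))\<^sup>2)"
        by simp
    qed
  qed measurable
  then show ?thesis by (simp add: HD_def)
qed

lemma HD_diff: "f \<in> HD \<Longrightarrow> g \<in> HD \<Longrightarrow> (\<lambda>z. f z - g z) \<in> HD"
  using HD_add[of f "\<lambda>z. (-1) * g z"] HD_cmult[of g "-1"] by simp

lemma HD_sum: "(\<And>i. i \<in> I \<Longrightarrow> f i \<in> HD) \<Longrightarrow> (\<lambda>z. \<Sum>i\<in>I. f i z) \<in> HD"
  by (induction I rule: infinite_finite_induct) (auto intro: HD_add)

lemma integrable_HD_mult:
  assumes f: "f \<in> HD" and g: "g \<in> HD"
  shows "integrable S1 (\<lambda>z. f z * g z)"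
proof -
  note [measurable] = HD_measurable[OF f] HD_measurable[OF g]
  show ?thesis
  proof (rule Bochner_Integration.integrable_bound)
    show "integrable S1 (\<lambda>z. (norm (f z))\<^sup>2 + (norm (g z))\<^sup>2)"
      using HD_square_integrable[OF f] HD_square_integrable[OF g] by auto
    show "AE z in S1. norm (f z * g z) \<le> norm ((norm (f z))\<^sup>2 + (norm (g z))\<^sup>2)"
    proof (rule AE_I2)
      fix z
      have "0 \<le> norm (f z) * norm (g z)" by simp
      then show "norm (f z * g z) \<le> norm ((norm (f z))\<^sup>2 + (norm (g z))\<^sup>2)"
        using zero_le_power2[of "norm (f z) - norm (g z)"]
        unfolding norm_mult power2_eq_square by (simp add: algebra_simps del: zero_le_mult_iff; linarith)
    qed
  qed measurable
qed

lemma HD_cnj: "f \<in> HD \<Longrightarrow> (\<lambda>z. cnj (f z)) \<in> HD"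
  by (auto simp: HD_def)

lemma HD_integrable: "f \<in> HD \<Longrightarrow> integrable S1 f"
  using integrable_HD_mult[OF _ HD_powi[of 0]] by simp

lemma hd_norm_nonneg [simp]: "0 \<le> hd_norm f"
  by (simp add: hd_norm_def)

lemma hd_norm_sq: "(hd_norm f)\<^sup>2 = (LINT z|S1. (norm (f z))\<^sup>2)"
  by (simp add: hd_norm_def)

lemma hd_eq_sym: "hd_eq f g \<Longrightarrow> hd_eq g f"
  by (auto simp: hd_eq_def elim: AE_mp)

lemma hd_eq_refl [simp]: "hd_eq f f"
  by (simp add: hd_eq_def)

lemma hd_eq_trans: "hd_eq f g \<Longrightarrow> hd_eq g h \<Longrightarrow> hd_eq f h"
  unfolding hd_eq_def by (elim AE_mp) (auto intro: AE_I2)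

lemma hd_eq_circle: "(\<And>z. norm z = 1 \<Longrightarrow> f z = g z) \<Longrightarrow> hd_eq f g"
  unfolding hd_eq_def by (rule AE_S1_I)

lemma hd_norm_cong:
  assumes "f \<in> HD" "g \<in> HD" "hd_eq f g"
  shows "hd_norm f = hd_norm g"
proof -
  note [measurable] = HD_measurable[OF assms(1)] HD_measurable[OF assms(2)]
  show ?thesis unfolding hd_norm_def
    by (intro arg_cong[where f=sqrt] integral_cong_AE) (use assms(3) in \<open>auto simp: hd_eq_def\<close>)
qed

lemma hd_coeff_cong:
  assumes "f \<in> HD" "g \<in> HD" "hd_eq f g"
  shows "hd_coeff f j = hd_coeff g j"
proof -
  note [measurable] = HD_measurable[OF assms(1)] HD_measurable[OF assms(2)]
  show ?thesis unfolding hd_coeff_def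
    by (intro integral_cong_AE) (use assms(3) in \<open>auto simp: hd_eq_def\<close>)
qed

lemma hd_coeff_add:
  "f \<in> HD \<Longrightarrow> g \<in> HD \<Longrightarrow> hd_coeff (\<lambda>z. f z + g z) j = hd_coeff f j + hd_coeff g j"
  unfolding hd_coeff_def using integrable_HD_mult[OF _ HD_powi] by (simp add: ring_distribs)

lemma hd_coeff_diff:
  "f \<in> HD \<Longrightarrow> g \<in> HD \<Longrightarrow> hd_coeff (\<lambda>z. f z - g z) j = hd_coeff f j - hd_coeff g j"
  unfolding hd_coeff_def using integrable_HD_mult[OF _ HD_powi] by (simp add: left_diff_distrib)

lemma hd_coeff_cmult: "hd_coeff (\<lambda>z. c * f z) j = c * hd_coeff f j"
  unfolding hd_coeff_def by (simp add: mult.assoc)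

lemma hd_coeff_zero [simp]: "hd_coeff (\<lambda>z. 0) j = 0"
  by (simp add: hd_coeff_def)

lemma hd_coeff_sum:
  "(\<And>i. i \<in> I \<Longrightarrow> f i \<in> HD) \<Longrightarrow> hd_coeff (\<lambda>z. \<Sum>i\<in>I. f i z) j = (\<Sum>i\<in>I. hd_coeff (f i) j)"
  by (induction I rule: infinite_finite_induct) (auto simp: hd_coeff_add HD_sum)

text \<open>\<open>S1\<close> is a probability measure, so this is the nonnegativity of the variance
  of |f|.\<close>

lemma norm_integral_le_hd_norm:
  assumes "f \<in> HD"
  shows "(LINT z|S1. norm (f z)) \<le> hd_norm f"
proof -
  define m where "m = (LINT z|S1. norm (f z))"
  have i: "integrable S1 (\<lambda>z. norm (f z))" using HD_integrable[OF assms] by auto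
  have "0 \<le> (LINT z|S1. (norm (f z) - m)\<^sup>2)" by (rule integral_nonneg_AE) auto
  also have "\<dots> = (LINT z|S1. (norm (f z))\<^sup>2 - 2 * m * norm (f z) + m\<^sup>2)"
    by (simp add: power2_eq_square algebra_simps)
  also have "\<dots> = (LINT z|S1. (norm (f z))\<^sup>2) - 2 * m * m + m\<^sup>2"
    using HD_square_integrable[OF assms] i by (simp add: m_def)
  finally have "m\<^sup>2 \<le> (LINT z|S1. (norm (f z))\<^sup>2)" by (simp add: power2_eq_square)
  then show ?thesis unfolding hd_norm_def m_def[symmetric] by (rule real_le_rsqrt)
qed

lemma hd_coeff_le_norm:
  assumes "f \<in> HD"
  shows "norm (hd_coeff f j) \<le> hd_norm f"
proof -
  note [measurable] = HD_measurable[OF assms]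
  have "norm (hd_coeff f j) \<le> (LINT z|S1. norm (f z * z powi (- j)))"
    unfolding hd_coeff_def by (rule integral_norm_bound)
  also have "\<dots> = (LINT z|S1. norm (f z))"
    by (rule LINT_S1_cong) (measurable, auto simp: norm_mult norm_power_int)
  also have "\<dots> \<le> hd_norm f" by (rule norm_integral_le_hd_norm[OF assms])
  finally show ?thesis .
qed

lemma hd_coeff_tendsto:
  assumes "\<And>n. f n \<in> HD" "g \<in> HD" "(\<lambda>n. hd_norm (\<lambda>z. g z - f n z)) \<longlonglongrightarrow> 0"
  shows "(\<lambda>n. hd_coeff (f n) j) \<longlonglongrightarrow> hd_coeff g j"
proof -
  have "norm (hd_coeff g j - hd_coeff (f n) j) \<le> hd_norm (\<lambda>z. g z - f n z)" for n
    using hd_coeff_le_norm[OF HD_diff[OF assms(2,1)], of n j] assms by (simp add: hd_coeff_diff)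
  then have "(\<lambda>n. hd_coeff g j - hd_coeff (f n) j) \<longlonglongrightarrow> 0"
    by (intro Lim_null_comparison[OF _ assms(3)] always_eventually) auto
  from tendsto_diff[OF tendsto_const[of "hd_coeff g j"] this] show ?thesis by simp
qed

lemma integral_S1_powi: "(LINT z|S1. z powi k) = (if k = 0 then 1 else 0)"
proof -
  have pos: "(LINT z|S1. z ^ Suc n) = 0" for n
    using holomorphic_pairing_zero[of "\<lambda>z. z ^ n"] by (simp add: mult.commute holomorphic_on_power)
  have "(LINT z|S1. z powi - int (Suc n)) = (LINT z|S1. cnj (z ^ Suc n))" for n
    by (rule LINT_S1_cong)
       (auto simp: power_int_minus unit_circle_inverse[symmetric] power_inverse simp del: of_nat_Suc)
  then have neg: "(LINT z|S1. z powi - int (Suc n)) = 0" for n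
    using pos by (simp only: Bochner_Integration.integral_cnj) simp
  show ?thesis
  proof (cases k)
    case (nonneg n)
    have "(LINT z|S1. z powi int n) = (if n = 0 then 1 else 0)"
      unfolding power_int_of_nat using pos[of "n - 1"] by (cases n) auto
    then show ?thesis using nonneg by simp
  next
    case (neg n)
    then show ?thesis using \<open>(LINT z|S1. z powi - int (Suc n)) = 0\<close> by simp
  qed
qed

lemma hd_coeff_powi: "hd_coeff (\<lambda>z. z powi m) j = (if m = j then 1 else 0)"
proof -
  have "hd_coeff (\<lambda>z. z powi m) j = (LINT z|S1. z powi (m - j))"
    unfolding hd_coeff_def
    by (rule LINT_S1_cong) (measurable, subst power_int_diff, auto simp: power_int_minus divide_inverse)
  then show ?thesis by (simp add: integral_S1_powi)
qed

lemma integral_indicator_zero_imp_AE_zero: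
  fixes f :: "complex \<Rightarrow> complex"
  assumes f: "integrable S1 f" and z: "\<And>A. A \<in> sets borel \<Longrightarrow> (LINT z|S1. indicator A z * f z) = 0"
  shows "AE z in S1. f z = 0"
proof -
  have eq: "(LINT z:A|S1. Re (f z)) = 0" "(LINT z:A|S1. Im (f z)) = 0" if "A \<in> sets borel" for A
  proof -
    have i: "integrable S1 (\<lambda>z. indicator A z * f z)"
      by (rule integrable_S1_bounded_mult[OF _ _ f, where C=1]) (use that in \<open>auto simp: indicator_def\<close>)
    have "(LINT z:A|S1. Re (f z)) = (LINT z|S1. Re (indicator A z * f z))"
      unfolding set_lebesgue_integral_def
      by (intro Bochner_Integration.integral_cong) (auto simp: indicator_def)
    also have "\<dots> = Re (LINT z|S1. indicator A z * f z)" using i by (rule integral_Re)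
    finally show "(LINT z:A|S1. Re (f z)) = 0" using z[OF that] by simp
    have "(LINT z:A|S1. Im (f z)) = (LINT z|S1. Im (indicator A z * f z))"
      unfolding set_lebesgue_integral_def
      by (intro Bochner_Integration.integral_cong) (auto simp: indicator_def)
    also have "\<dots> = Im (LINT z|S1. indicator A z * f z)" using i by (rule integral_Im)
    finally show "(LINT z:A|S1. Im (f z)) = 0" using z[OF that] by simp
  qed
  have "AE z in S1. Re (f z) = 0"
    by (rule density_unique_real) (use f eq in \<open>auto simp: set_lebesgue_integral_def\<close>)
  moreover have "AE z in S1. Im (f z) = 0"
    by (rule density_unique_real) (use f eq in \<open>auto simp: set_lebesgue_integral_def\<close>)
  ultimately show ?thesis by eventually_elim (simp add: complex_eq_iff)
qed

text \<open>The moment lemma with \<open>p\<close> the identity and second density 0 shows that f -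
  g integrates to 0 over every Borel set.\<close>

lemma hd_eq_if_coeffs_eq:
  assumes "f \<in> HD" "g \<in> HD" "\<And>j. hd_coeff f j = hd_coeff g j"
  shows "hd_eq f g"
proof -
  have d: "(\<lambda>z. f z - g z) \<in> HD" using assms by (auto intro: HD_diff)
  have "(LINT z|S1. indicator A z * (f z - g z)) = (LINT z|S1. indicator A z * 0)"
    if "A \<in> sets borel" for A
  proof (rule S1_moments_determine[where p="\<lambda>z. z"])
    show "integrable S1 (\<lambda>z. f z - g z)" using d by (rule HD_integrable)
    show "(LINT z|S1. z powi k * (f z - g z)) = (LINT z|S1. z powi k * 0)" for k
      using assms(3)[of "-k"] hd_coeff_diff[OF assms(1,2), of "-k"]
      by (simp add: hd_coeff_def mult.commute)
  qed (use that in auto)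
  then have "AE z in S1. f z - g z = 0"
    by (intro integral_indicator_zero_imp_AE_zero HD_integrable d) auto
  then show ?thesis by (simp add: hd_eq_def)
qed

section \<open>Orthonormal expansions: Bessel, Riesz-Fischer, Parseval\<close>

definition hd_inner :: "(complex \<Rightarrow> complex) \<Rightarrow> (complex \<Rightarrow> complex) \<Rightarrow> complex" where
  "hd_inner f g = (LINT z|S1. f z * cnj (g z))"

lemma hd_inner_powi:
  assumes "f \<in> HD"
  shows "hd_inner f (\<lambda>z. z powi j) = hd_coeff f j"
proof -
  note [measurable] = HD_measurable[OF assms]
  show ?thesis unfolding hd_inner_def hd_coeff_def
    by (rule LINT_S1_cong)
       (auto simp: complex_cnj_power_int power_int_minus unit_circle_inverse[symmetric] power_int_inverse)
qed

lemma hd_inner_self: "hd_inner f f = of_real ((hd_norm f)\<^sup>2)"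
  unfolding hd_inner_def hd_norm_sq complex_norm_square[symmetric] by (rule integral_complex_of_real)

lemma hd_inner_diff_left:
  "f \<in> HD \<Longrightarrow> g \<in> HD \<Longrightarrow> h \<in> HD \<Longrightarrow> hd_inner (\<lambda>z. f z - g z) h = hd_inner f h - hd_inner g h"
  unfolding hd_inner_def using integrable_HD_mult[OF _ HD_cnj] by (simp add: left_diff_distrib)

lemma hd_inner_sum_left:
  "(\<And>i. i \<in> I \<Longrightarrow> f i \<in> HD) \<Longrightarrow> h \<in> HD \<Longrightarrow>
    hd_inner (\<lambda>z. \<Sum>i\<in>I. f i z) h = (\<Sum>i\<in>I. hd_inner (f i) h)"
  unfolding hd_inner_def using integrable_HD_mult[OF _ HD_cnj] by (simp add: sum_distrib_right)

lemma hd_inner_cmult_left: "hd_inner (\<lambda>z. c * f z) h = c * hd_inner f h"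
  unfolding hd_inner_def by (simp add: mult.assoc)

lemma hd_inner_commute: "hd_inner f g = cnj (hd_inner g f)"
  unfolding hd_inner_def Bochner_Integration.integral_cnj[symmetric] by (simp add: mult.commute)

text \<open>A general enumeration \<open>e\<close> of exponents lets the same expansions serve both
  summands of the half-densities, with \<open>int\<close> and with \<open>neg_index\<close>.\<close>

definition trig_sum :: "(nat \<Rightarrow> int) \<Rightarrow> (nat \<Rightarrow> complex) \<Rightarrow> nat set \<Rightarrow> complex \<Rightarrow> complex" where
  "trig_sum e c I z = (\<Sum>i\<in>I. c i * z powi e i)"

lemma trig_sum_HD [simp]: "trig_sum e c I \<in> HD"
  unfolding trig_sum_def [abs_def] by (intro HD_sum HD_cmult HD_powi)

lemma hd_coeff_trig_sum: "hd_coeff (trig_sum e c I) j = (\<Sum>i\<in>I. if e i = j then c i else 0)"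
  unfolding trig_sum_def [abs_def]
  by (auto simp: hd_coeff_sum HD_cmult hd_coeff_cmult hd_coeff_powi intro!: sum.cong)

lemma hd_coeff_trig_sum_inj:
  "inj e \<Longrightarrow> finite I \<Longrightarrow> hd_coeff (trig_sum e c I) (e k) = (if k \<in> I then c k else 0)"
  by (simp add: hd_coeff_trig_sum inj_eq sum.delta)

lemma hd_inner_trig_sum:
  assumes "f \<in> HD"
  shows "hd_inner (trig_sum e c I) f = (\<Sum>i\<in>I. c i * cnj (hd_coeff f (e i)))"
  unfolding trig_sum_def [abs_def] hd_inner_powi[OF assms, symmetric] hd_inner_commute[of _ f, symmetric]
  by (subst hd_inner_sum_left) (auto simp: HD_cmult assms hd_inner_cmult_left)

lemma hd_norm_trig_sum:
  assumes "inj e" "finite I"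
  shows "(hd_norm (trig_sum e c I))\<^sup>2 = (\<Sum>i\<in>I. (norm (c i))\<^sup>2)"
proof -
  have "of_real ((hd_norm (trig_sum e c I))\<^sup>2) = (\<Sum>i\<in>I. c i * cnj (c i))"
    using assms unfolding hd_inner_self[symmetric]
    by (auto simp: hd_inner_trig_sum hd_coeff_trig_sum_inj intro!: sum.cong)
  also have "\<dots> = of_real (\<Sum>i\<in>I. (norm (c i))\<^sup>2)"
    by (simp only: complex_norm_square of_real_sum)
  finally show ?thesis by (simp only: of_real_eq_iff)
qed

lemma hd_norm_diff_trig_sum:
  assumes "inj e" "finite I" "f \<in> HD"
  shows "(hd_norm (\<lambda>z. f z - trig_sum e (\<lambda>i. hd_coeff f (e i)) I z))\<^sup>2
    = (hd_norm f)\<^sup>2 - (\<Sum>i\<in>I. (norm (hd_coeff f (e i)))\<^sup>2)"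
proof -
  let ?U = "trig_sum e (\<lambda>i. hd_coeff f (e i)) I"
  let ?S = "\<Sum>i\<in>I. (norm (hd_coeff f (e i)))\<^sup>2"
  have S: "(\<Sum>i\<in>I. hd_coeff f (e i) * cnj (hd_coeff f (e i))) = of_real ?S"
    by (simp only: complex_norm_square of_real_sum)
  have UU: "hd_inner ?U ?U = of_real ?S"
    unfolding hd_inner_self hd_norm_trig_sum[OF assms(1,2)] ..
  have Uf: "hd_inner ?U f = of_real ?S" unfolding hd_inner_trig_sum[OF assms(3)] by (rule S)
  have d: "(\<lambda>z. f z - ?U z) \<in> HD" by (intro HD_diff assms trig_sum_HD)
  have fU: "hd_inner f ?U = of_real ?S" by (subst hd_inner_commute) (simp add: Uf)
  have "of_real ((hd_norm (\<lambda>z. f z - ?U z))\<^sup>2) = hd_inner f (\<lambda>z. f z - ?U z) - hd_inner ?U (\<lambda>z. f z - ?U z)"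
    unfolding hd_inner_self[symmetric] by (intro hd_inner_diff_left assms trig_sum_HD d)
  also have "hd_inner f (\<lambda>z. f z - ?U z) = cnj (hd_inner f f - hd_inner ?U f)"
    by (subst hd_inner_commute) (simp add: hd_inner_diff_left assms)
  also have "hd_inner ?U (\<lambda>z. f z - ?U z) = cnj (hd_inner f ?U - hd_inner ?U ?U)"
    by (subst hd_inner_commute) (simp add: hd_inner_diff_left assms)
  also have "cnj (hd_inner f f - hd_inner ?U f) - cnj (hd_inner f ?U - hd_inner ?U ?U)
      = of_real ((hd_norm f)\<^sup>2 - ?S)"
    unfolding Uf UU fU unfolding hd_inner_self by simp
  finally show ?thesis by (simp only: of_real_eq_iff)
qed

lemma hd_bessel:
  fixes e :: "nat \<Rightarrow> int"
  assumes "inj e" "finite I" "f \<in> HD"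
  shows "(\<Sum>i\<in>I. (norm (hd_coeff f (e i)))\<^sup>2) \<le> (hd_norm f)\<^sup>2"
  using hd_norm_diff_trig_sum[where e=e, OF assms]
    zero_le_power2[of "hd_norm (\<lambda>z. f z - trig_sum e (\<lambda>i. hd_coeff f (e i)) I z)"] by linarith

text \<open>Partial sums are Cauchy in L2, hence in L1 on a probability space, so a subsequence
  converges almost everywhere; Fatou's lemma then bounds the squared distance from the limit to the
  N-th partial sum by the tail of the series.\<close>

lemma hd_riesz_fischer_limit:
  fixes e :: "nat \<Rightarrow> int" and c :: "nat \<Rightarrow> complex"
  assumes e: "inj e" and c: "summable (\<lambda>i. (norm (c i))\<^sup>2)"
  obtains u where "u \<in> HD" "(\<lambda>N. hd_norm (\<lambda>z. u z - trig_sum e c {..<N} z)) \<longlonglongrightarrow> 0"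
proof -
  define U where "U n = trig_sum e c {..<n}" for n
  have U_HD [simp]: "U n \<in> HD" for n by (simp add: U_def)
  have [measurable]: "U n \<in> borel_measurable borel" for n by (rule HD_measurable) simp
  define tail where "tail N = (\<Sum>i. (norm (c (i + N)))\<^sup>2)" for N
  have U_diff: "U m z - U n z = trig_sum e c {n..<m} z" if "n \<le> m" for m n z
  proof -
    have "{..<m} = {..<n} \<union> {n..<m}" using that by auto
    then have "U m z = U n z + trig_sum e c {n..<m} z"
      unfolding U_def trig_sum_def by (simp add: sum.union_disjoint ivl_disj_int)
    then show ?thesis by simp
  qed
  have diff_le: "(hd_norm (\<lambda>z. U m z - U n z))\<^sup>2 \<le> tail n" if "n \<le> m" for m n
  proof -
    have "(hd_norm (\<lambda>z. U m z - U n z))\<^sup>2 = (\<Sum>i\<in>{n..<m}. (norm (c i))\<^sup>2)"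
      unfolding U_diff[OF that] by (rule hd_norm_trig_sum[OF e]) simp
    also have "\<dots> = (\<Sum>i<m-n. (norm (c (i + n)))\<^sup>2)"
      by (rule sum.reindex_bij_witness[of _ "\<lambda>i. i + n" "\<lambda>i. i - n"]) auto
    also have "\<dots> \<le> tail n"
      unfolding tail_def by (rule sum_le_suminf) (use c in \<open>auto intro: summable_ignore_initial_segment\<close>)
    finally show ?thesis .
  qed
  have tail0: "tail \<longlonglongrightarrow> 0" unfolding tail_def by (rule suminf_exist_split2[OF c])
  have "\<exists>N. \<forall>i\<ge>N. \<forall>j\<ge>N. (LINT z|S1. norm (U i z - U j z)) < \<epsilon>" if "\<epsilon> > 0" for \<epsilon>
  proof -
    have "0 < \<epsilon>\<^sup>2" using that by simp
    then obtain N where N: "\<And>n. n \<ge> N \<Longrightarrow> norm (tail n - 0) < \<epsilon>\<^sup>2" using LIMSEQ_D[OF tail0] by blast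
    have small: "(LINT z|S1. norm (U i z - U j z)) < \<epsilon>" if "N \<le> j" "j \<le> i" for i j
    proof -
      have "(hd_norm (\<lambda>z. U i z - U j z))\<^sup>2 < \<epsilon>\<^sup>2"
        using diff_le[OF that(2)] N[OF that(1)] by simp
      then have "hd_norm (\<lambda>z. U i z - U j z) < \<epsilon>" using \<open>\<epsilon> > 0\<close> by (simp add: power2_less_imp_less)
      then show ?thesis using norm_integral_le_hd_norm[OF HD_diff[OF U_HD U_HD], of i j] by simp
    qed
    show ?thesis
    proof (intro exI[of _ N] allI impI)
      fix i j assume "N \<le> i" "N \<le> j"
      then show "(LINT z|S1. norm (U i z - U j z)) < \<epsilon>"
        using small[of j i] small[of i j] by (cases "j \<le> i") (auto simp: norm_minus_commute)
    qed
  qed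
  from cauchy_L1_AE_cauchy_subseq[of S1 U, OF HD_integrable[OF U_HD] this]
  obtain r where r: "strict_mono r" and cauchy: "AE z in S1. Cauchy (\<lambda>i. U (r i) z)" by blast
  define u where "u z = lim (\<lambda>i. U (r i) z)" for z
  have [measurable]: "u \<in> borel_measurable borel" unfolding u_def by measurable
  have conv: "AE z in S1. (\<lambda>i. U (r i) z) \<longlonglongrightarrow> u z"
    using cauchy by (rule AE_mp) (auto intro!: AE_I2 simp: u_def Cauchy_convergent_iff convergent_LIMSEQ_iff)
  have tail_nonneg: "0 \<le> tail N" for N
    unfolding tail_def by (intro suminf_nonneg summable_ignore_initial_segment c) auto
  have nn: "(\<integral>\<^sup>+ z. ennreal ((norm (u z - U N z))\<^sup>2) \<partial>S1) \<le> ennreal (tail N)" for N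
  proof -
    have "AE z in S1. ennreal ((norm (u z - U N z))\<^sup>2) = liminf (\<lambda>i. ennreal ((norm (U (r i) z - U N z))\<^sup>2))"
      using conv
    proof (rule AE_mp, intro AE_I2 impI)
      fix z assume "(\<lambda>i. U (r i) z) \<longlonglongrightarrow> u z"
      then have "(\<lambda>i. ennreal ((norm (U (r i) z - U N z))\<^sup>2)) \<longlonglongrightarrow> ennreal ((norm (u z - U N z))\<^sup>2)"
        by (intro tendsto_intros)
      then show "ennreal ((norm (u z - U N z))\<^sup>2) = liminf (\<lambda>i. ennreal ((norm (U (r i) z - U N z))\<^sup>2))"
        using lim_imp_Liminf[OF sequentially_bot] by (metis (no_types, lifting))
    qed
    then have "(\<integral>\<^sup>+ z. ennreal ((norm (u z - U N z))\<^sup>2) \<partial>S1)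
        = (\<integral>\<^sup>+ z. liminf (\<lambda>i. ennreal ((norm (U (r i) z - U N z))\<^sup>2)) \<partial>S1)"
      by (rule nn_integral_cong_AE)
    also have "\<dots> \<le> liminf (\<lambda>i. \<integral>\<^sup>+ z. ennreal ((norm (U (r i) z - U N z))\<^sup>2) \<partial>S1)"
      by (rule nn_integral_liminf) measurable
    also have "\<dots> \<le> ennreal (tail N)"
    proof (rule Liminf_le[THEN order_trans])
      have "eventually (\<lambda>i. N \<le> r i) sequentially"
        using filterlim_subseq[OF r] by (simp add: filterlim_at_top)
      then show "\<forall>\<^sub>F i in sequentially. (\<integral>\<^sup>+ z. ennreal ((norm (U (r i) z - U N z))\<^sup>2) \<partial>S1) \<le> ennreal (tail N)"
      proof eventually_elim
        case (elim i)
        have "(\<integral>\<^sup>+ z. ennreal ((norm (U (r i) z - U N z))\<^sup>2) \<partial>S1) = ennreal ((hd_norm (\<lambda>z. U (r i) z - U N z))\<^sup>2)"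
          unfolding hd_norm_sq
          by (rule nn_integral_eq_integral) (auto intro!: HD_square_integrable HD_diff)
        with diff_le[OF elim] show ?case by (simp add: ennreal_leI)
      qed
    qed auto
    finally show ?thesis .
  qed
  have d: "(\<lambda>z. u z - U N z) \<in> HD" for N
    unfolding HD_def using nn[of N]
    by (auto simp: integrable_iff_bounded intro: le_less_trans)
  have norm_le: "(hd_norm (\<lambda>z. u z - U N z))\<^sup>2 \<le> tail N" for N
  proof -
    have "ennreal ((hd_norm (\<lambda>z. u z - U N z))\<^sup>2) \<le> ennreal (tail N)"
      using nn[of N] nn_integral_eq_integral[OF HD_square_integrable[OF d[of N]]]
      by (simp add: hd_norm_sq)
    then show ?thesis using tail_nonneg by (simp add: ennreal_le_iff)
  qed
  show ?thesis
  proof (rule that)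
    show "u \<in> HD" using d[of 0] by (simp add: U_def trig_sum_def)
    have "(\<lambda>N. sqrt (tail N)) \<longlonglongrightarrow> 0" using tendsto_real_sqrt[OF tail0] by simp
    then show "(\<lambda>N. hd_norm (\<lambda>z. u z - trig_sum e c {..<N} z)) \<longlonglongrightarrow> 0"
      unfolding U_def[symmetric]
      by (rule Lim_null_comparison[rotated]) (auto intro!: always_eventually real_le_rsqrt norm_le)
  qed
qed

lemma hd_riesz_fischer:
  fixes e :: "nat \<Rightarrow> int" and c :: "nat \<Rightarrow> complex"
  assumes e: "inj e" and c: "summable (\<lambda>i. (norm (c i))\<^sup>2)"
  obtains u where "u \<in> HD" "\<And>i. hd_coeff u (e i) = c i" "\<And>j. j \<notin> range e \<Longrightarrow> hd_coeff u j = 0"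
    "(\<lambda>N. hd_norm (\<lambda>z. u z - trig_sum e c {..<N} z)) \<longlonglongrightarrow> 0"
proof -
  obtain u where u: "u \<in> HD" and lim: "(\<lambda>N. hd_norm (\<lambda>z. u z - trig_sum e c {..<N} z)) \<longlonglongrightarrow> 0"
    by (rule hd_riesz_fischer_limit[OF e c])
  have coeffs: "(\<lambda>N. hd_coeff (trig_sum e c {..<N}) j) \<longlonglongrightarrow> hd_coeff u j" for j
    by (rule hd_coeff_tendsto[OF trig_sum_HD u lim])
  show ?thesis
  proof (rule that[OF u _ _ lim])
    fix i
    have "\<forall>\<^sub>F N in sequentially. hd_coeff (trig_sum e c {..<N}) (e i) = c i"
      using eventually_gt_at_top[of i] by eventually_elim (simp add: hd_coeff_trig_sum_inj e)
    then show "hd_coeff u (e i) = c i"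
      using LIMSEQ_unique[OF coeffs tendsto_eventually] by simp
  next
    fix j assume "j \<notin> range e"
    then have "hd_coeff (trig_sum e c {..<N}) j = 0" for N
      by (auto simp: hd_coeff_trig_sum intro!: sum.neutral)
    with coeffs[of j] show "hd_coeff u j = 0" by (simp add: LIMSEQ_const_iff)
  qed
qed

lemma hd_bessel_summable:
  fixes e :: "nat \<Rightarrow> int"
  assumes "inj e" "f \<in> HD"
  shows "summable (\<lambda>i. (norm (hd_coeff f (e i)))\<^sup>2)"
  by (rule summableI_nonneg_bounded[where x="(hd_norm f)\<^sup>2"]) (use hd_bessel[OF assms(1) _ assms(2)] in auto)

text \<open>Riesz-Fischer applied to the coefficients of \<open>f\<close> itself produces a function
  with the same coefficients, which is \<open>f\<close> up to a null set. The support condition says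
  that \<open>e\<close> misses no nonzero coefficient of \<open>f\<close>.\<close>

lemma hd_expansion:
  fixes e :: "nat \<Rightarrow> int"
  assumes e: "inj e" and f: "f \<in> HD" and supp: "\<And>j. j \<notin> range e \<Longrightarrow> hd_coeff f j = 0"
  shows "(\<lambda>N. hd_norm (\<lambda>z. f z - trig_sum e (\<lambda>i. hd_coeff f (e i)) {..<N} z)) \<longlonglongrightarrow> 0"
proof -
  obtain u where u: "u \<in> HD" "\<And>i. hd_coeff u (e i) = hd_coeff f (e i)"
      "\<And>j. j \<notin> range e \<Longrightarrow> hd_coeff u j = 0"
    and lim: "(\<lambda>N. hd_norm (\<lambda>z. u z - trig_sum e (\<lambda>i. hd_coeff f (e i)) {..<N} z)) \<longlonglongrightarrow> 0"
    by (rule hd_riesz_fischer[OF e hd_bessel_summable[OF e f]]) blast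
  have "hd_coeff f j = hd_coeff u j" for j
    using u supp by (cases "j \<in> range e") auto
  then have eq: "hd_eq f u" by (rule hd_eq_if_coeffs_eq[OF f u(1)])
  have "hd_norm (\<lambda>z. f z - trig_sum e (\<lambda>i. hd_coeff f (e i)) {..<N} z)
      = hd_norm (\<lambda>z. u z - trig_sum e (\<lambda>i. hd_coeff f (e i)) {..<N} z)" for N
    by (rule hd_norm_cong) (use eq in \<open>auto intro!: HD_diff f u simp: hd_eq_def\<close>)
  with lim show ?thesis by simp
qed

lemma hd_parseval:
  fixes e :: "nat \<Rightarrow> int"
  assumes e: "inj e" and f: "f \<in> HD" and supp: "\<And>j. j \<notin> range e \<Longrightarrow> hd_coeff f j = 0"
  shows "(\<lambda>i. (norm (hd_coeff f (e i)))\<^sup>2) sums (hd_norm f)\<^sup>2"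
proof -
  have "(\<lambda>N. (hd_norm f)\<^sup>2 - (\<Sum>i<N. (norm (hd_coeff f (e i)))\<^sup>2)) \<longlonglongrightarrow> 0"
    using tendsto_power[OF hd_expansion[OF assms], of 2]
    by (simp add: hd_norm_diff_trig_sum[OF e _ f])
  from tendsto_diff[OF tendsto_const[of "(hd_norm f)\<^sup>2"] this] show ?thesis by (simp add: sums_def)
qed

section \<open>The two summands of the half-densities\<close>

lemma HD_plus_subset: "f \<in> HD_plus \<Longrightarrow> f \<in> HD"
  and HD_minus_subset: "f \<in> HD_minus \<Longrightarrow> f \<in> HD"
  by (auto simp: HD_plus_def HD_minus_def)

text \<open>Numbering starts with z^(-1) at n = 0, so that integrating against z^n dz / (2 pi i)
  reads off the coefficient at \<open>neg_index n\<close>.\<close>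

abbreviation neg_index :: "nat \<Rightarrow> int" where
  "neg_index n \<equiv> - int (Suc n)"

lemma inj_neg_index: "inj neg_index"
  by (auto simp: inj_def)

lemma notin_range_neg_index: "j \<notin> range neg_index \<longleftrightarrow> j \<ge> 0"
proof
  show "j \<notin> range neg_index \<Longrightarrow> j \<ge> 0"
    by (rule ccontr) (auto dest!: spec[of _ "nat (- j - 1)"] simp: image_def)
qed auto

lemma notin_range_int: "j \<notin> range int \<longleftrightarrow> j < 0"
  by (metis (no_types, opaque_lifting) nonneg_int_cases not_less of_nat_0_le_iff rangeE rangeI)

lemma HD_plus_iff: "f \<in> HD_plus \<longleftrightarrow> f \<in> HD \<and> (\<forall>j. j \<notin> range int \<longrightarrow> hd_coeff f j = 0)"
  by (simp add: HD_plus_def notin_range_int)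

lemma HD_minus_iff: "f \<in> HD_minus \<longleftrightarrow> f \<in> HD \<and> (\<forall>j. j \<notin> range neg_index \<longrightarrow> hd_coeff f j = 0)"
  by (simp only: HD_minus_def notin_range_neg_index) auto

lemma HD_plus_parseval:
  "f \<in> HD_plus \<Longrightarrow> (\<lambda>k. (norm (hd_coeff f (int k)))\<^sup>2) sums (hd_norm f)\<^sup>2"
  by (rule hd_parseval) (auto simp: HD_plus_iff)

lemma HD_minus_parseval:
  "f \<in> HD_minus \<Longrightarrow> (\<lambda>n. (norm (hd_coeff f (neg_index n)))\<^sup>2) sums (hd_norm f)\<^sup>2"
  by (rule hd_parseval[OF inj_neg_index]) (auto simp: HD_minus_iff)

lemma HD_plus_eqI:
  assumes "f \<in> HD_plus" "g \<in> HD_plus" "\<And>k. hd_coeff f (int k) = hd_coeff g (int k)"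
  shows "hd_eq f g"
proof (rule hd_eq_if_coeffs_eq)
  show "hd_coeff f j = hd_coeff g j" for j
    using assms by (cases j) (auto simp: HD_plus_def)
qed (use assms HD_plus_subset in auto)

lemma HD_minus_powi: "(\<lambda>z. z powi neg_index n) \<in> HD_minus"
  by (auto simp: HD_minus_def hd_coeff_powi)

lemma HD_minus_add: "f \<in> HD_minus \<Longrightarrow> g \<in> HD_minus \<Longrightarrow> (\<lambda>z. f z + g z) \<in> HD_minus"
  by (auto simp: HD_minus_def HD_add hd_coeff_add)

lemma HD_minus_cmult: "f \<in> HD_minus \<Longrightarrow> (\<lambda>z. c * f z) \<in> HD_minus"
  by (auto simp: HD_minus_def HD_cmult hd_coeff_cmult)

lemma HD_plus_add: "f \<in> HD_plus \<Longrightarrow> g \<in> HD_plus \<Longrightarrow> (\<lambda>z. f z + g z) \<in> HD_plus"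
  by (auto simp: HD_plus_def HD_add hd_coeff_add)

lemma HD_plus_cmult: "f \<in> HD_plus \<Longrightarrow> (\<lambda>z. c * f z) \<in> HD_plus"
  by (auto simp: HD_plus_def HD_cmult hd_coeff_cmult)

lemma HD_minus_trig_sum: "finite I \<Longrightarrow> trig_sum neg_index c I \<in> HD_minus"
  unfolding HD_minus_iff by (auto simp: hd_coeff_trig_sum intro!: sum.neutral)

text \<open>Absolute summability of the coefficients makes the integrals of the norms summable,
  which justifies termwise integration.\<close>

lemma integral_S1_power_series:
  fixes g :: "nat \<Rightarrow> complex"
  assumes g: "summable (\<lambda>b. norm (g b))" and h: "integrable S1 h"
    and [measurable]: "G \<in> borel_measurable borel"
    and G: "\<And>z. norm z = 1 \<Longrightarrow> (\<lambda>b. g b * z ^ b) sums G z"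
  shows "(\<lambda>b. g b * (LINT z|S1. z ^ b * h z)) sums (LINT z|S1. G z * h z)"
proof -
  have [measurable]: "h \<in> borel_measurable borel"
    using h by (auto dest: borel_measurable_integrable simp: measurable_cong_sets[OF sets_S1 refl])
  have i: "integrable S1 (\<lambda>z. z ^ b * h z)" for b
    by (rule integrable_S1_bounded_mult[OF _ _ h, where C=1]) (auto simp: norm_power)
  have "(\<lambda>b. LINT z|S1. g b * (z ^ b * h z)) sums (LINT z|S1. (\<Sum>b. g b * (z ^ b * h z)))"
  proof (rule sums_integral)
    show "integrable S1 (\<lambda>z. g b * (z ^ b * h z))" for b using i by auto
    show "AE z in S1. summable (\<lambda>b. norm (g b * (z ^ b * h z)))"
      by (rule AE_S1_I) (auto simp: norm_mult norm_power intro: summable_mult2 g)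
    have "(LINT z|S1. norm (g b * (z ^ b * h z))) = norm (g b) * (LINT z|S1. norm (h z))" for b
      unfolding integral_mult_right_zero[symmetric]
      by (rule LINT_S1_cong) (measurable, auto simp: norm_mult norm_power)
    then show "summable (\<lambda>b. LINT z|S1. norm (g b * (z ^ b * h z)))"
      by (simp add: summable_mult2 g)
  qed
  also have "(LINT z|S1. (\<Sum>b. g b * (z ^ b * h z))) = (LINT z|S1. G z * h z)"
  proof (rule LINT_S1_cong)
    fix z :: complex assume z: "norm z = 1"
    show "(\<Sum>b. g b * (z ^ b * h z)) = G z * h z"
      using sums_mult2[OF G[OF z], of "h z"] by (simp add: sums_iff mult.assoc)
  qed measurable
  finally show ?thesis by simp
qed

section \<open>The action on half-densities\<close>

locale su11 =
  fixes a b :: complex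
  assumes det: "(norm a)\<^sup>2 - (norm b)\<^sup>2 = 1"
begin

definition jac :: "complex \<Rightarrow> complex" where "jac z = cnj a - b * z"
definition mob :: "complex \<Rightarrow> complex" where "mob z = (a * z - cnj b) / jac z"
text \<open>Since mob' = jac^(-2), this is |mob'|, the factor by which \<open>mob\<close> changes
  arc length. The operator \<open>tr\<close> carries its square root up to a phase, as befits
  half-densities.\<close>

definition wt :: "complex \<Rightarrow> real" where "wt z = inverse ((norm (jac z))\<^sup>2)"
definition tr :: "(complex \<Rightarrow> complex) \<Rightarrow> complex \<Rightarrow> complex" where
  "tr f z = f (mob z) * inverse (jac z)"

lemma det_complex: "a * cnj a - b * cnj b = 1"
  using det unfolding complex_norm_square[symmetric] of_real_diff[symmetric] by simp

lemma norm_b_less: "norm b < norm a"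
proof (rule power_less_imp_less_base[of _ 2])
  show "(norm b)\<^sup>2 < (norm a)\<^sup>2" using det by linarith
qed simp

lemma jac_nz: assumes "norm z \<le> 1" shows "jac z \<noteq> 0"
proof
  assume "jac z = 0"
  then have "norm a = norm b * norm z" by (metis complex_mod_cnj eq_iff_diff_eq_0 jac_def norm_mult)
  also have "\<dots> \<le> norm b" using assms by (simp add: mult_left_le)
  finally show False using norm_b_less by simp
qed

text \<open>The determinant condition in divided-difference form; it makes the factor (z - w)^s of
  the kernels covariant.\<close>

lemma mob_diff:
  "jac z \<noteq> 0 \<Longrightarrow> jac w \<noteq> 0 \<Longrightarrow> mob z - mob w = (z - w) / (jac z * jac w)"
proof -
  have *: "(a * z - cnj b) * jac w - (a * w - cnj b) * jac z = (a * cnj a - b * cnj b) * (z - w)"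
    unfolding jac_def by (simp add: algebra_simps)
  assume "jac z \<noteq> 0" "jac w \<noteq> 0"
  then show ?thesis using * unfolding mob_def det_complex by (simp add: field_simps)
qed

text \<open>The Schwarz-Pick identity for \<open>mob\<close>; preservation of the circle and of the
  open disc are its two consequences.\<close>

lemma norm_mob: "jac z \<noteq> 0 \<Longrightarrow> (norm (jac z))\<^sup>2 * (1 - (norm (mob z))\<^sup>2) = 1 - (norm z)\<^sup>2"
proof -
  assume nz: "jac z \<noteq> 0"
  have "jac z * cnj (jac z) - (a * z - cnj b) * cnj (a * z - cnj b)
      = (a * cnj a - b * cnj b) * (1 - z * cnj z)"
    unfolding jac_def by (simp add: algebra_simps)
  then have "complex_of_real ((norm (jac z))\<^sup>2 - (norm (a * z - cnj b))\<^sup>2) = complex_of_real (1 - (norm z)\<^sup>2)"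
    unfolding det_complex of_real_diff of_real_1 complex_norm_square mult_1 .
  then have "(norm (jac z))\<^sup>2 - (norm (a * z - cnj b))\<^sup>2 = 1 - (norm z)\<^sup>2"
    unfolding of_real_eq_iff .
  then show ?thesis using nz by (simp add: mob_def norm_divide power_divide right_diff_distrib)
qed

lemma norm_mob_eq_1: "norm z = 1 \<Longrightarrow> norm (mob z) = 1"
  using norm_mob[OF jac_nz, of z] jac_nz[of z] power2_eq_iff_nonneg[of "norm (mob z)" 1] by simp

lemma norm_mob_less_1: "norm z < 1 \<Longrightarrow> norm (mob z) < 1"
proof -
  assume z: "norm z < 1"
  then have "0 < (norm (jac z))\<^sup>2 * (1 - (norm (mob z))\<^sup>2)"
    using norm_mob[OF jac_nz, of z] by (simp add: power_less_one_iff)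
  then have "(norm (mob z))\<^sup>2 < 1" by (simp add: zero_less_mult_iff)
  then show ?thesis by (simp add: power_less_one_iff)
qed

text \<open>The relation conj z = 1/z turns the conjugate of \<open>jac\<close> into the numerator
  of \<open>mob\<close>; this is how \<open>wt\<close> becomes a rational function on the
  circle.\<close>

lemma cnj_jac: "norm z = 1 \<Longrightarrow> cnj (jac z) * z = a * z - cnj b"
  using complex_norm_square[of z] by (simp add: jac_def algebra_simps)

lemma jac_measurable [measurable]: "jac \<in> borel_measurable borel"
  unfolding jac_def [abs_def] by measurable

lemma mob_measurable [measurable]: "mob \<in> borel_measurable borel"
  unfolding mob_def [abs_def] by measurable

lemma wt_measurable [measurable]: "wt \<in> borel_measurable borel"
  unfolding wt_def [abs_def] by measurable

lemma wt_nonneg [simp]: "0 \<le> wt z"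
  by (simp add: wt_def)

lemma holomorphic_jac [holomorphic_intros]: "jac holomorphic_on S"
  unfolding jac_def [abs_def] by (intro holomorphic_intros)

section \<open>Change of variables for arc length\<close>

lemma weight_bounded: "\<exists>C. \<forall>z. norm z = 1 \<longrightarrow> norm (wt z) \<le> C"
proof -
  have "continuous_on (sphere 0 1) (\<lambda>z. wt z)"
    unfolding wt_def jac_def using jac_nz by (intro continuous_intros) (auto simp: jac_def)
  then have "compact ((\<lambda>z. wt z) ` sphere 0 1)"
    by (rule compact_continuous_image) auto
  then have "bounded ((\<lambda>z. wt z) ` sphere 0 1)" by (rule compact_imp_bounded)
  then obtain C where "\<forall>x\<in>(\<lambda>z. wt z) ` sphere 0 1. norm x \<le> C"
    unfolding bounded_iff by blast
  then show ?thesis by (intro exI[of _ C]) auto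
qed

lemma weight_integrable: "integrable S1 (\<lambda>z. complex_of_real (wt z))"
proof -
  obtain C where "\<forall>z. norm z = 1 \<longrightarrow> norm (wt z) \<le> C" using weight_bounded by blast
  then show ?thesis by (intro integrable_S1_bounded[where C=C]) auto
qed

lemma weight_circle:
  "norm z = 1 \<Longrightarrow> complex_of_real (wt z) * (a * z - cnj b) = z * inverse (jac z)"
proof -
  assume z: "norm z = 1"
  have "complex_of_real ((norm (jac z))\<^sup>2) = jac z * cnj (jac z)" by (rule complex_norm_square)
  then have "complex_of_real (wt z) = inverse (jac z) * inverse (cnj (jac z))"
    unfolding wt_def by (simp only: of_real_inverse inverse_mult_distrib)
  then show ?thesis using jac_nz[of z] z unfolding cnj_jac[OF z, symmetric] by simp
qed

lemma mob_weight: "norm z = 1 \<Longrightarrow> mob z * complex_of_real (wt z) = z * inverse (jac z) * inverse (jac z)"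
  using weight_circle[of z] by (simp add: mob_def divide_inverse mult_ac)

lemma mob_power: "mob z ^ n = (a * z - cnj b) ^ n * inverse (jac z) ^ n"
  by (simp add: mob_def divide_inverse power_mult_distrib)

text \<open>Any pole of the integrand lies outside the closed disc, so Cauchy's theorem applies. The
  moments and Fourier coefficients that have to vanish below are all brought to this form.\<close>

lemma pairing_aux:
  "(LINT z|S1. (a * z - cnj b) ^ n * inverse (jac z) ^ m * z ^ k * z) = 0"
proof (rule holomorphic_pairing_zero)
  show "(\<lambda>z. (a * z - cnj b) ^ n * inverse (jac z) ^ m * z ^ k) holomorphic_on cball 0 1"
    using jac_nz by (intro holomorphic_intros) auto
qed measurable

text \<open>On the circle mob^(n+1) wt is z times a holomorphic function, so positive moments vanish
  by Cauchy's theorem; negative ones are their conjugates; the total mass is the mean of a Poisson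
  kernel.\<close>

lemma weight_moments:
  "(LINT z|S1. mob z powi k * complex_of_real (wt z)) = (LINT z|S1. z powi k * 1)"
proof -
  have pos: "(LINT z|S1. mob z ^ Suc n * complex_of_real (wt z)) = 0" for n
  proof -
    have "(LINT z|S1. mob z ^ Suc n * complex_of_real (wt z))
        = (LINT z|S1. (a * z - cnj b) ^ n * inverse (jac z) ^ (n + 2) * z ^ 0 * z)"
    proof (rule LINT_S1_cong)
      fix z :: complex assume z: "norm z = 1"
      show "mob z ^ Suc n * complex_of_real (wt z) =
        (a * z - cnj b) ^ n * inverse (jac z) ^ (n + 2) * z ^ 0 * z"
        unfolding power_Suc2 mult.assoc mob_weight[OF z] unfolding mob_power by (simp add: mult_ac power2_eq_square)
    qed measurable
    then show ?thesis by (simp only: pairing_aux)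
  qed
  have zero: "(LINT z|S1. complex_of_real (wt z)) = 1"
  proof -
    obtain C where C: "\<And>z. norm z = 1 \<Longrightarrow> norm (inverse (jac z)) \<le> C"
    proof -
      have "compact ((\<lambda>z. inverse (jac z)) ` sphere 0 1)"
        using jac_nz by (intro compact_continuous_image continuous_intros holomorphic_on_imp_continuous_on holomorphic_intros) auto
      then have "bounded ((\<lambda>z. inverse (jac z)) ` sphere 0 1)" by (rule compact_imp_bounded)
      then obtain C where "\<forall>x\<in>(\<lambda>z. inverse (jac z)) ` sphere 0 1. norm x \<le> C"
        unfolding bounded_iff by blast
      then show ?thesis by (intro that[of C]) auto
    qed
    have i: "integrable S1 (\<lambda>z. inverse (jac z) * z)"
      by (rule integrable_S1_bounded[where C=C]) (auto simp: norm_mult C)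
    have j0: "(LINT z|S1. inverse (jac z) * z) = 0"
      using pairing_aux[of 0 1 0] by simp
    \<comment> \<open>The weight is a Poisson kernel: it equals 1 plus twice the real part of b z /
      jac z, and z / jac z has mean 0.\<close>
    have "(LINT z|S1. complex_of_real (wt z))
       = (LINT z|S1. 1 + cnj b * cnj (inverse (jac z) * z) + b * (inverse (jac z) * z))"
    proof (rule LINT_S1_cong)
      fix z :: complex assume z: "norm z = 1"
      then have nz: "jac z \<noteq> 0" "z \<noteq> 0" "a * z - cnj b \<noteq> 0" using jac_nz[of z] cnj_jac[OF z, symmetric] by auto
      have w: "complex_of_real (wt z) = z * inverse (jac z) / (a * z - cnj b)"
        using weight_circle[OF z] nz by (simp add: field_simps)
      have c: "cnj (inverse (jac z) * z) = inverse (a * z - cnj b)"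
        unfolding cnj_jac[OF z, symmetric] complex_cnj_mult complex_cnj_inverse
          unit_circle_inverse[OF z, symmetric] by simp
      have "(a * z - cnj b) * jac z + cnj b * jac z + b * z * (a * z - cnj b) = z * (a * cnj a - b * cnj b)"
        by (simp add: jac_def algebra_simps)
      then show "complex_of_real (wt z) =
          1 + cnj b * cnj (inverse (jac z) * z) + b * (inverse (jac z) * z)"
        unfolding w c det_complex using nz by (simp add: field_simps)
    qed measurable
    also have "\<dots> = 1"
    proof -
      define f where "f z = inverse (jac z) * z" for z
      have "integrable S1 f" "integral\<^sup>L S1 f = 0" using i j0 by (simp_all add: f_def [abs_def])
      then have "(LINT z|S1. 1 + cnj b * cnj (f z) + b * f z) = 1" by simp
      then show ?thesis by (simp add: f_def)
    qed
    finally show ?thesis .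
  qed
  have neg: "(LINT z|S1. mob z powi - int (Suc n) * complex_of_real (wt z)) = 0" for n
  proof -
    have "(LINT z|S1. mob z powi - int (Suc n) * complex_of_real (wt z))
       = (LINT z|S1. cnj (mob z ^ Suc n * complex_of_real (wt z)))"
    proof (rule LINT_S1_cong)
      fix z :: complex assume z: "norm z = 1"
      show "mob z powi - int (Suc n) * complex_of_real (wt z) =
        cnj (mob z ^ Suc n * complex_of_real (wt z))"
        unfolding complex_cnj_mult complex_cnj_power unit_circle_inverse[OF norm_mob_eq_1[OF z], symmetric]
        by (simp add: power_int_minus power_inverse del: of_nat_Suc)
    qed measurable
    then show ?thesis using pos[of n] by (simp only: Bochner_Integration.integral_cnj complex_cnj_zero)
  qed
  show ?thesis
  proof (cases k)
    case (nonneg n)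
    have "(LINT z|S1. mob z powi int n * complex_of_real (wt z)) = (if n = 0 then 1 else 0)"
      unfolding power_int_of_nat using pos[of "n - 1"] zero by (cases n) auto
    then show ?thesis unfolding mult_1_right integral_S1_powi nonneg by simp
  next
    case (neg n)
    then show ?thesis using \<open>(LINT z|S1. mob z powi - int (Suc n) * complex_of_real (wt z)) = 0\<close>
      by (simp add: integral_S1_powi del: of_real_inverse)
  qed
qed

text \<open>\<open>weight_moments\<close> matches the trigonometric moments, and
  \<open>S1_moments_determine\<close> upgrades this to an equality of measures. Substitution in
  integrals and the pull-back of null sets are read off from it.\<close>

lemma S1_invariant: "S1 = distr (density S1 (\<lambda>z. ennreal (wt z))) borel mob"
proof (rule measure_eqI)
  fix A assume "A \<in> sets S1"
  then have [measurable]: "A \<in> sets borel" by simp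
  have [measurable]: "mob -` A \<in> sets borel" using measurable_sets[OF mob_measurable, of A] by simp
  have w: "integrable S1 wt"
    using weight_integrable by (simp only: complex_of_real_integrable_eq)
  have "complex_of_real (LINT z|S1. indicator A z) = (LINT z|S1. indicator A z * 1)"
    unfolding integral_complex_of_real[symmetric]
    by (rule Bochner_Integration.integral_cong) (auto simp: indicator_def)
  also have "\<dots> = (LINT z|S1. indicator A (mob z) * complex_of_real (wt z))"
    by (rule S1_moments_determine) (auto simp: weight_moments norm_mob_eq_1 weight_integrable simp del: of_real_inverse)
  also have "\<dots> = complex_of_real (LINT z|S1. indicator A (mob z) * wt z)"
    unfolding integral_complex_of_real[symmetric]
    by (rule Bochner_Integration.integral_cong) (auto simp: indicator_def)
  finally have eq: "measure S1 A = (LINT z|S1. indicator A (mob z) * wt z)"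
    by (simp only: of_real_eq_iff) simp
  have "emeasure (distr (density S1 (\<lambda>z. ennreal (wt z))) borel mob) A
     = (\<integral>\<^sup>+ z. ennreal (wt z) * indicator (mob -` A) z \<partial>S1)"
    by (simp add: emeasure_distr emeasure_density)
  also have "\<dots> = (\<integral>\<^sup>+ z. ennreal (indicator A (mob z) * wt z) \<partial>S1)"
    by (intro nn_integral_cong) (auto simp: indicator_def)
  also have "\<dots> = ennreal (LINT z|S1. indicator A (mob z) * wt z)"
  proof (rule nn_integral_eq_integral)
    show "integrable S1 (\<lambda>z. indicator A (mob z) * wt z)"
      by (rule Bochner_Integration.integrable_bound[OF w]) (auto simp: indicator_def)
  qed (auto simp: indicator_def)
  finally show "emeasure S1 A = emeasure (distr (density S1 (\<lambda>z. ennreal (wt z))) borel mob) A"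
    by (simp add: S1.emeasure_eq_measure eq)
qed simp

lemma integral_mob:
  fixes f :: "complex \<Rightarrow> 'b::{banach, second_countable_topology}"
  assumes [measurable]: "f \<in> borel_measurable borel"
  shows "(LINT z|S1. wt z *\<^sub>R f (mob z)) = (LINT z|S1. f z)"
  by (subst (2) S1_invariant, subst integral_distr) (auto simp: integral_density)

lemma integrable_mob:
  fixes f :: "complex \<Rightarrow> 'b::{banach, second_countable_topology}"
  assumes [measurable]: "f \<in> borel_measurable borel" and f: "integrable S1 f"
  shows "integrable S1 (\<lambda>z. wt z *\<^sub>R f (mob z))"
  using f by (subst (asm) S1_invariant, subst (asm) integrable_distr_eq) (auto simp: integrable_density)

text \<open>Strict positivity of \<open>wt\<close> on the circle removes the density, so null sets
  pull back to null sets and \<open>tr\<close> acts on classes.\<close>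

lemma AE_mob:
  assumes "AE z in S1. P z" and [measurable]: "Measurable.pred borel P"
  shows "AE z in S1. P (mob z)"
proof -
  have "AE z in S1. 0 < ennreal (wt z) \<longrightarrow> P (mob z)"
    using assms(1) by (subst (asm) S1_invariant, subst (asm) AE_distr_iff) (auto simp: AE_density)
  moreover have "AE z in S1. 0 < ennreal (wt z)"
    by (rule AE_S1_I) (use jac_nz in \<open>auto simp: wt_def\<close>)
  ultimately show ?thesis by (elim AE_mp) (auto intro: AE_I2)
qed

section \<open>The half-density action as an isometry preserving both summands\<close>

lemma tr_measurable [measurable (raw)]:
  assumes [measurable]: "f \<in> borel_measurable borel"
  shows "tr f \<in> borel_measurable borel"
  unfolding tr_def [abs_def] by measurable

lemma norm_tr: "(norm (tr f z))\<^sup>2 = wt z *\<^sub>R (norm (f (mob z)))\<^sup>2"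
  by (simp add: tr_def wt_def norm_mult norm_inverse power_mult_distrib power_inverse)

lemma HD_tr [simp]: "f \<in> HD \<Longrightarrow> tr f \<in> HD"
proof -
  assume f: "f \<in> HD"
  note [measurable] = HD_measurable[OF f]
  show ?thesis
    unfolding HD_def using integrable_mob[OF _ HD_square_integrable[OF f]]
    by (simp only: norm_tr mem_Collect_eq) measurable
qed

lemma hd_norm_tr: "f \<in> HD \<Longrightarrow> hd_norm (tr f) = hd_norm f"
proof -
  assume f: "f \<in> HD"
  note [measurable] = HD_measurable[OF f]
  show ?thesis unfolding hd_norm_def norm_tr by (subst integral_mob) auto
qed

lemma tr_cong:
  assumes "f \<in> HD" "h \<in> HD" "hd_eq f h"
  shows "hd_eq (tr f) (tr h)"
proof -
  note [measurable] = HD_measurable[OF assms(1)] HD_measurable[OF assms(2)]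
  from AE_mob[of "\<lambda>z. f z = h z"] show ?thesis
    using assms(3) unfolding hd_eq_def tr_def by (auto elim!: AE_mp intro: AE_I2)
qed

text \<open>The product of two half-densities is a 1-form, and the integral of f h dz is invariant
  under substitution: on the circle \<open>mob z * wt z\<close> equals z / jac^2.\<close>

lemma tr_pairing:
  assumes "f \<in> HD" "h \<in> HD"
  shows "(LINT z|S1. tr f z * tr h z * z) = (LINT z|S1. f z * h z * z)"
proof -
  note [measurable] = HD_measurable[OF assms(1)] HD_measurable[OF assms(2)]
  have "(LINT z|S1. tr f z * tr h z * z) = (LINT z|S1. wt z *\<^sub>R (f (mob z) * h (mob z) * mob z))"
  proof (rule LINT_S1_cong)
    fix z :: complex assume z: "norm z = 1"
    show "tr f z * tr h z * z = wt z *\<^sub>R (f (mob z) * h (mob z) * mob z)"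
    proof -
      have "wt z *\<^sub>R (f (mob z) * h (mob z) * mob z) = f (mob z) * h (mob z) * (mob z * complex_of_real (wt z))"
        by (simp add: scaleR_conv_of_real)
      then show ?thesis unfolding mob_weight[OF z] by (simp add: tr_def)
    qed
  qed measurable
  also have "\<dots> = (LINT z|S1. f z * h z * z)" by (rule integral_mob) measurable
  finally show ?thesis .
qed

lemma tr_add: "tr (\<lambda>z. f z + h z) = (\<lambda>z. tr f z + tr h z)"
  and tr_diff: "tr (\<lambda>z. f z - h z) = (\<lambda>z. tr f z - tr h z)"
  and tr_cmult: "tr (\<lambda>z. c * f z) = (\<lambda>z. c * tr f z)"
  and tr_sum: "tr (\<lambda>z. \<Sum>i\<in>I. F i z) = (\<lambda>z. \<Sum>i\<in>I. tr (F i) z)"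
  by (auto simp: tr_def fun_eq_iff algebra_simps sum_distrib_left)

text \<open>A transformed power z^n is holomorphic on the closed disc. Conjugation on the circle
  exchanges a z - cnj b and \<open>jac\<close> up to powers of z, so a transformed negative power is
  the conjugate of z times such a function, and the spare factor z kills its mean.\<close>

lemma hd_coeff_tr_powi:
  "j < 0 \<Longrightarrow> hd_coeff (tr (\<lambda>z. z powi int n)) j = 0"
  "j \<ge> 0 \<Longrightarrow> hd_coeff (tr (\<lambda>z. z powi neg_index n)) j = 0"
proof -
  assume "j < 0"
  then obtain k where k: "- j = int (Suc k)" by (metis neg_0_less_iff_less zero_less_imp_eq_int not0_implies_Suc less_numeral_extra(3) zless_nat_conj gr0_implies_Suc)
  have "hd_coeff (tr (\<lambda>z. z powi int n)) j = (LINT z|S1. (a * z - cnj b) ^ n * inverse (jac z) ^ Suc n * z ^ k * z)"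
    unfolding hd_coeff_def k tr_def power_int_of_nat
    by (rule LINT_S1_cong) (measurable, simp add: mob_power)
  then show "hd_coeff (tr (\<lambda>z. z powi int n)) j = 0" by (simp only: pairing_aux)
next
  assume "j \<ge> 0"
  then obtain k where k: "j = int k" by (metis nonneg_int_cases)
  have "hd_coeff (tr (\<lambda>z. z powi neg_index n)) j
      = (LINT z|S1. cnj ((a * z - cnj b) ^ n * inverse (jac z) ^ Suc n * z ^ k * z))"
    unfolding hd_coeff_def k tr_def
  proof (rule LINT_S1_cong)
    fix z :: complex assume z: "norm z = 1"
    then have nz: "jac z \<noteq> 0" "z \<noteq> 0" "a * z - cnj b \<noteq> 0" using jac_nz[of z] cnj_jac[OF z, symmetric] by auto
    have cj: "cnj (jac z) = (a * z - cnj b) * inverse z"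
      using cnj_jac[OF z] nz by (simp add: field_simps)
    have cz: "cnj (a * z - cnj b) = jac z * inverse z"
      using unit_circle_inverse[OF z, symmetric] nz by (simp add: jac_def field_simps)
    have "cnj ((a * z - cnj b) ^ n * inverse (jac z) ^ Suc n * z ^ k * z)
        = (jac z * inverse z) ^ n * inverse ((a * z - cnj b) * inverse z) ^ Suc n * inverse z ^ k * inverse z"
      unfolding complex_cnj_mult complex_cnj_power complex_cnj_inverse cz cj unit_circle_inverse[OF z] ..
    also have "\<dots> = mob z powi neg_index n * inverse (jac z) * z powi - int k"
    proof -
      have "mob z powi neg_index n = inverse (mob z) ^ Suc n"
        by (simp only: power_int_minus power_int_of_nat power_inverse)
      also have "inverse (mob z) = jac z * inverse (a * z - cnj b)"
        by (simp add: mob_def divide_inverse)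
      finally have m: "mob z powi neg_index n = (jac z * inverse (a * z - cnj b)) ^ Suc n" .
      have zk: "z powi - int k = inverse z ^ k"
        by (simp only: power_int_minus power_int_of_nat power_inverse)
      have A: "(jac z * inverse z) ^ n * inverse ((a * z - cnj b) * inverse z) ^ Suc n * inverse z ^ k * inverse z
        = (jac z ^ n * inverse (a * z - cnj b) ^ Suc n) * (inverse z ^ n * z ^ Suc n * inverse z) * inverse z ^ k"
        by (simp add: power_mult_distrib)
      have B: "inverse z ^ n * z ^ Suc n * inverse z = 1"
        using nz by (simp add: power_inverse field_simps)
      have C: "jac z ^ n * inverse (a * z - cnj b) ^ Suc n = (jac z * inverse (a * z - cnj b)) ^ Suc n * inverse (jac z)"
        using nz by (simp add: power_mult_distrib)
      show ?thesis unfolding m zk A B C mult_1_right ..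
    qed
    finally show "mob z powi neg_index n * inverse (jac z) * z powi - int k
      = cnj ((a * z - cnj b) ^ n * inverse (jac z) ^ Suc n * z ^ k * z)" ..
  qed measurable
  then show "hd_coeff (tr (\<lambda>z. z powi neg_index n)) j = 0"
    by (simp only: Bochner_Integration.integral_cnj pairing_aux complex_cnj_zero)
qed

text \<open>\<open>tr\<close> is an isometry, so vanishing on basis functions passes to limits of
  finite expansions.\<close>

lemma hd_coeff_tr_zero:
  fixes e :: "nat \<Rightarrow> int"
  assumes e: "inj e" and f: "f \<in> HD" and supp: "\<And>j. j \<notin> range e \<Longrightarrow> hd_coeff f j = 0"
    and zero: "\<And>i. hd_coeff (tr (\<lambda>z. z powi e i)) j = 0"
  shows "hd_coeff (tr f) j = 0"
proof -
  let ?U = "\<lambda>N. trig_sum e (\<lambda>i. hd_coeff f (e i)) {..<N}"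
  have "(\<lambda>N. hd_norm (tr (\<lambda>z. f z - ?U N z))) \<longlonglongrightarrow> 0"
    using hd_expansion[OF e f supp] by (simp add: hd_norm_tr HD_diff f)
  then have "(\<lambda>N. hd_coeff (tr (?U N)) j) \<longlonglongrightarrow> hd_coeff (tr f) j"
    by (intro hd_coeff_tendsto) (auto simp: f tr_diff)
  moreover have "hd_coeff (tr (?U N)) j = 0" for N
    unfolding trig_sum_def [abs_def] tr_sum tr_cmult
    by (subst hd_coeff_sum) (auto simp: hd_coeff_cmult zero HD_cmult)
  ultimately show ?thesis by (simp add: LIMSEQ_const_iff)
qed

lemma HD_plus_tr: "f \<in> HD_plus \<Longrightarrow> tr f \<in> HD_plus"
  by (auto simp: HD_plus_iff notin_range_int intro!: hd_coeff_tr_zero[of int] hd_coeff_tr_powi)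

lemma HD_minus_tr: "f \<in> HD_minus \<Longrightarrow> tr f \<in> HD_minus"
proof -
  assume f: "f \<in> HD_minus"
  then have "hd_coeff f j = 0" if "j \<notin> range neg_index" for j
    using that unfolding HD_minus_iff by blast
  from hd_coeff_tr_zero[OF inj_neg_index HD_minus_subset[OF f] this hd_coeff_tr_powi(2)]
  show ?thesis using f by (simp add: HD_minus_def)
qed

lemma su11_inverse: "su11 (cnj a) (- b)"
  using det by unfold_locales simp

lemma tr_tr_inverse:
  assumes "norm z = 1"
  shows "tr (su11.tr (cnj a) (- b) f) z = f z"
proof -
  interpret inv: su11 "cnj a" "- b" by (rule su11_inverse)
  have nz: "jac z \<noteq> 0" using assms jac_nz by simp
  have "a * jac z + b * (a * z - cnj b) = a * cnj a - b * cnj b"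
    by (simp add: jac_def algebra_simps)
  then have j: "inv.jac (mob z) = inverse (jac z)"
    using nz unfolding det_complex inv.jac_def mob_def by (simp add: field_simps)
  have "cnj a * (a * z - cnj b) + cnj b * jac z = (a * cnj a - b * cnj b) * z"
    by (simp add: jac_def algebra_simps)
  then have m: "inv.mob (mob z) = z"
    using nz unfolding det_complex inv.mob_def j by (simp add: mob_def field_simps)
  show ?thesis using nz by (simp add: tr_def inv.tr_def j m)
qed

end

section \<open>Hilbert--Schmidt matrices\<close>

text \<open>Bounding all finite rectangles avoids double series; row sums, column sums and the
  Hilbert-Schmidt norm are controlled by passing to limits.\<close>

definition hs_bound :: "(nat \<Rightarrow> nat \<Rightarrow> complex) \<Rightarrow> real \<Rightarrow> bool" where
  "hs_bound M S \<longleftrightarrow> (\<forall>K N. (\<Sum>k<K. \<Sum>n<N. (norm (M k n))\<^sup>2) \<le> S)"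

text \<open>A relation instead of a function, because an image is fixed only up to null sets;
  \<open>mat_op\<close> then selects a representative.\<close>

definition mat_image :: "(nat \<Rightarrow> nat \<Rightarrow> complex) \<Rightarrow> (complex \<Rightarrow> complex) \<Rightarrow> (complex \<Rightarrow> complex) \<Rightarrow> bool" where
  "mat_image M f u \<longleftrightarrow> u \<in> HD_plus \<and>
    (\<forall>k. (\<lambda>n. hd_coeff f (neg_index n) * M k n) sums hd_coeff u (int k))"

definition mat_op :: "(nat \<Rightarrow> nat \<Rightarrow> complex) \<Rightarrow> hd_op" where
  "mat_op M f = (SOME u. mat_image M f u)"

lemma mat_image_unique: "mat_image M f u \<Longrightarrow> mat_image M f v \<Longrightarrow> hd_eq u v"
  by (rule HD_plus_eqI) (auto simp: mat_image_def intro: sums_unique2)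

lemma mat_op_eq: "mat_image M f u \<Longrightarrow> mat_image M f (mat_op M f)"
  unfolding mat_op_def by (rule someI[where P="mat_image M f"])

lemma hs_bound_row: "hs_bound M S \<Longrightarrow> summable (\<lambda>n. (norm (M k n))\<^sup>2)"
proof (rule summableI_nonneg_bounded[where x=S])
  fix N assume "hs_bound M S"
  then have "(\<Sum>k<Suc k. \<Sum>n<N. (norm (M k n))\<^sup>2) \<le> S" by (simp add: hs_bound_def del: sum.lessThan_Suc)
  moreover have "0 \<le> (\<Sum>k<k. \<Sum>n<N. (norm (M k n))\<^sup>2)" by (intro sum_nonneg) auto
  ultimately show "(\<Sum>n<N. (norm (M k n))\<^sup>2) \<le> S" by simp
qed auto

lemma hs_bound_column_sum:
  assumes "hs_bound M S"
  shows "summable (\<lambda>k. (norm (M k n))\<^sup>2)" "(\<Sum>n<N. \<Sum>k. (norm (M k n))\<^sup>2) \<le> S"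
proof -
  have b: "(\<Sum>n<N. \<Sum>k<K. (norm (M k n))\<^sup>2) \<le> S" for N K
    using assms by (subst sum.swap) (simp add: hs_bound_def)
  show s: "summable (\<lambda>k. (norm (M k n))\<^sup>2)" for n
  proof (rule summableI_nonneg_bounded[where x=S])
    fix K
    have "0 \<le> (\<Sum>n<n. \<Sum>k<K. (norm (M k n))\<^sup>2)" by (intro sum_nonneg) auto
    then show "(\<Sum>k<K. (norm (M k n))\<^sup>2) \<le> S" using b[of K "Suc n"] by simp
  qed auto
  have "(\<lambda>K. \<Sum>n<N. \<Sum>k<K. (norm (M k n))\<^sup>2) \<longlonglongrightarrow> (\<Sum>n<N. \<Sum>k. (norm (M k n))\<^sup>2)"
    by (intro tendsto_sum summable_LIMSEQ s)
  then show "(\<Sum>n<N. \<Sum>k. (norm (M k n))\<^sup>2) \<le> S"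
    by (rule LIMSEQ_le_const2) (use b in auto)
qed

text \<open>Cauchy-Schwarz in each row bounds the finite truncations by rectangle sums, the bound
  survives the limit in N, and Riesz-Fischer turns the square-summable coefficients into a
  function.\<close>

lemma mat_image_exists:
  assumes M: "hs_bound M S" and f: "f \<in> HD_minus"
  obtains u where "mat_image M f u" "(hd_norm u)\<^sup>2 \<le> S * (hd_norm f)\<^sup>2"
proof -
  define c where "c n = hd_coeff f (neg_index n)" for n
  have c: "(\<lambda>n. (norm (c n))\<^sup>2) sums (hd_norm f)\<^sup>2" unfolding c_def by (rule HD_minus_parseval[OF f])
  have c_le: "(\<Sum>n<N. (norm (c n))\<^sup>2) \<le> (hd_norm f)\<^sup>2" for N
    using c sum_le_suminf[OF sums_summable[OF c], of "{..<N}"] by (simp add: sums_iff)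
  have summ: "summable (\<lambda>n. c n * M k n)" for k
  proof (rule summable_comparison_test')
    show "summable (\<lambda>n. (norm (c n))\<^sup>2 + (norm (M k n))\<^sup>2)"
      by (intro summable_add sums_summable[OF c] hs_bound_row[OF M])
    fix n
    have "0 \<le> norm (c n) * norm (M k n)" by simp
    then show "norm (c n * M k n) \<le> (norm (c n))\<^sup>2 + (norm (M k n))\<^sup>2"
      using zero_le_power2[of "norm (c n) - norm (M k n)"] unfolding norm_mult power2_diff by linarith
  qed
  define v where "v k = (\<Sum>n. c n * M k n)" for k
  have v: "(\<lambda>n. c n * M k n) sums v k" for k
    unfolding v_def by (rule summable_sums[OF summ])
  have bound: "(\<Sum>k<K. (norm (\<Sum>n<N. c n * M k n))\<^sup>2) \<le> S * (hd_norm f)\<^sup>2" for K N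
  proof -
    have "(norm (\<Sum>n<N. c n * M k n))\<^sup>2 \<le> (\<Sum>n<N. (norm (M k n))\<^sup>2) * (hd_norm f)\<^sup>2" for k
    proof -
      have "(norm (\<Sum>n<N. c n * M k n))\<^sup>2 \<le> (\<Sum>n<N. norm (c n) * norm (M k n))\<^sup>2"
        by (intro power_mono order_trans[OF norm_sum]) (auto simp: norm_mult)
      also have "\<dots> \<le> (\<Sum>n<N. (norm (c n))\<^sup>2) * (\<Sum>n<N. (norm (M k n))\<^sup>2)"
        by (rule Cauchy_Schwarz_ineq_sum)
      also have "\<dots> \<le> (hd_norm f)\<^sup>2 * (\<Sum>n<N. (norm (M k n))\<^sup>2)"
        by (intro mult_right_mono c_le sum_nonneg) auto
      finally show ?thesis by (simp add: mult.commute)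
    qed
    then have "(\<Sum>k<K. (norm (\<Sum>n<N. c n * M k n))\<^sup>2) \<le> (\<Sum>k<K. \<Sum>n<N. (norm (M k n))\<^sup>2) * (hd_norm f)\<^sup>2"
      unfolding sum_distrib_right by (intro sum_mono) (simp add: sum_distrib_right)
    also have "\<dots> \<le> S * (hd_norm f)\<^sup>2"
      using M by (intro mult_right_mono) (auto simp: hs_bound_def)
    finally show ?thesis .
  qed
  have v_bound: "(\<Sum>k<K. (norm (v k))\<^sup>2) \<le> S * (hd_norm f)\<^sup>2" for K
  proof (rule LIMSEQ_le_const2)
    show "(\<lambda>N. \<Sum>k<K. (norm (\<Sum>n<N. c n * M k n))\<^sup>2) \<longlonglongrightarrow> (\<Sum>k<K. (norm (v k))\<^sup>2)"
      by (intro tendsto_intros v[unfolded sums_def])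
  qed (use bound in auto)
  then have vs: "summable (\<lambda>k. (norm (v k))\<^sup>2)"
    by (intro summableI_nonneg_bounded[where x="S * (hd_norm f)\<^sup>2"]) auto
  obtain u where u: "u \<in> HD" "\<And>k. hd_coeff u (int k) = v k" "\<And>j. j \<notin> range int \<Longrightarrow> hd_coeff u j = 0"
    by (rule hd_riesz_fischer[OF inj_of_nat vs]) blast
  then have up: "u \<in> HD_plus" by (simp add: HD_plus_iff)
  show ?thesis
  proof (rule that)
    show "mat_image M f u" using up u v by (simp add: mat_image_def c_def)
    have "(hd_norm u)\<^sup>2 = (\<Sum>k. (norm (v k))\<^sup>2)"
      using HD_plus_parseval[OF up] by (simp add: u(2) sums_iff)
    also have "\<dots> \<le> S * (hd_norm f)\<^sup>2"
      by (rule suminf_le_const[OF vs v_bound])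
    finally show "(hd_norm u)\<^sup>2 \<le> S * (hd_norm f)\<^sup>2" .
  qed
qed

lemma mat_op_image: "hs_bound M S \<Longrightarrow> f \<in> HD_minus \<Longrightarrow> mat_image M f (mat_op M f)"
  using mat_image_exists mat_op_eq by blast

lemma mat_op_norm: "hs_bound M S \<Longrightarrow> f \<in> HD_minus \<Longrightarrow> (hd_norm (mat_op M f))\<^sup>2 \<le> S * (hd_norm f)\<^sup>2"
proof -
  assume M: "hs_bound M S" and f: "f \<in> HD_minus"
  obtain u where u: "mat_image M f u" "(hd_norm u)\<^sup>2 \<le> S * (hd_norm f)\<^sup>2"
    using mat_image_exists[OF M f] by blast
  have "hd_norm (mat_op M f) = hd_norm u"
    using u(1) mat_op_eq[OF u(1)] mat_image_unique[OF mat_op_eq[OF u(1)] u(1)]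
    by (intro hd_norm_cong) (auto simp: mat_image_def HD_plus_subset)
  then show ?thesis using u(2) by simp
qed

lemma mat_image_cong: "mat_image M f u \<Longrightarrow> f \<in> HD \<Longrightarrow> h \<in> HD \<Longrightarrow> hd_eq f h \<Longrightarrow> mat_image M h u"
  unfolding mat_image_def using hd_coeff_cong[of f h] by simp

lemma mat_image_add:
  "f \<in> HD \<Longrightarrow> h \<in> HD \<Longrightarrow> mat_image M f u \<Longrightarrow> mat_image M h v \<Longrightarrow>
    mat_image M (\<lambda>z. f z + h z) (\<lambda>z. u z + v z)"
  unfolding mat_image_def
  by (auto simp: HD_plus_add hd_coeff_add HD_plus_subset ring_distribs intro: sums_add)

lemma mat_image_cmult:
  "mat_image M f u \<Longrightarrow> mat_image M (\<lambda>z. c * f z) (\<lambda>z. c * u z)"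
  unfolding mat_image_def
  by (auto simp: HD_plus_cmult hd_coeff_cmult mult.assoc intro: sums_mult)

lemma mat_op_bounded:
  assumes M: "hs_bound M S"
  shows "bounded_op (mat_op M)"
  unfolding bounded_op_def
proof (intro conjI ballI allI impI)
  fix f assume f: "f \<in> HD_minus"
  show "mat_op M f \<in> HD_plus" using mat_op_image[OF M f] by (simp add: mat_image_def)
  fix h assume h: "h \<in> HD_minus"
  show "hd_eq (mat_op M f) (mat_op M h)" if "hd_eq f h"
    using mat_image_unique[OF mat_image_cong[OF mat_op_image[OF M f]] mat_op_image[OF M h]] f h that
    by (simp add: HD_minus_subset)
  show "hd_eq (mat_op M (\<lambda>z. f z + h z)) (\<lambda>z. mat_op M f z + mat_op M h z)"
    by (rule mat_image_unique[OF mat_op_image[OF M HD_minus_add[OF f h]] mat_image_add])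
       (use f h M in \<open>auto intro: HD_minus_subset mat_op_image\<close>)
next
  fix c f assume f: "f \<in> HD_minus"
  show "hd_eq (mat_op M (\<lambda>z. c * f z)) (\<lambda>z. c * mat_op M f z)"
    by (rule mat_image_unique[OF mat_op_image[OF M HD_minus_cmult[OF f]] mat_image_cmult[OF mat_op_image[OF M f]]])
next
  show "\<exists>C. \<forall>f\<in>HD_minus. hd_norm (mat_op M f) \<le> C * hd_norm f"
  proof (intro exI ballI)
    fix f assume f: "f \<in> HD_minus"
    have "hd_norm (mat_op M f) \<le> sqrt (S * (hd_norm f)\<^sup>2)"
      using mat_op_norm[OF M f] by (rule real_le_rsqrt)
    then show "hd_norm (mat_op M f) \<le> sqrt S * hd_norm f" by (simp add: real_sqrt_mult)
  qed
qed

lemma mat_image_basis: "mat_image M (\<lambda>z. z powi neg_index n) u \<Longrightarrow> hd_coeff u (int k) = M k n"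
proof -
  assume "mat_image M (\<lambda>z. z powi neg_index n) u"
  then have "(\<lambda>m. hd_coeff (\<lambda>z. z powi neg_index n) (neg_index m) * M k m) sums hd_coeff u (int k)"
    by (simp add: mat_image_def)
  moreover have "(\<lambda>m. hd_coeff (\<lambda>z. z powi neg_index n) (neg_index m) * M k m) = (\<lambda>m. if m = n then M k m else 0)"
    unfolding hd_coeff_powi by auto
  ultimately show ?thesis using sums_single[of n "M k"] sums_unique2 by metis
qed

lemma mat_op_basis: "hs_bound M S \<Longrightarrow> hd_coeff (mat_op M (\<lambda>z. z powi neg_index n)) (int k) = M k n"
  using mat_image_basis mat_op_image HD_minus_powi by blast

lemma mat_op_HS:
  assumes M: "hs_bound M S"
  shows "HS_op (mat_op M)" "HS_norm (mat_op M) \<le> sqrt S"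
proof -
  have "mat_op M (\<lambda>z. z powi neg_index n) \<in> HD_plus" for n
    using mat_op_image[OF M HD_minus_powi] by (simp add: mat_image_def)
  from HD_plus_parseval[OF this]
  have eq: "(hd_norm (mat_op M (\<lambda>z. z powi neg_index n)))\<^sup>2 = (\<Sum>k. (norm (M k n))\<^sup>2)" for n
    by (simp add: mat_op_basis[OF M] sums_iff del: of_nat_Suc)
  have nn: "0 \<le> (\<Sum>k. (norm (M k n))\<^sup>2)" for n
    by (intro suminf_nonneg hs_bound_column_sum[OF M]) auto
  have s: "summable (\<lambda>n. \<Sum>k. (norm (M k n))\<^sup>2)"
    by (rule summableI_nonneg_bounded[OF nn hs_bound_column_sum(2)[OF M]])
  show "HS_op (mat_op M)" unfolding HS_op_def eq using s mat_op_bounded[OF M] by simp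
  show "HS_norm (mat_op M) \<le> sqrt S" unfolding HS_norm_def eq
    by (intro real_sqrt_le_mono suminf_le_const[OF s hs_bound_column_sum(2)[OF M]])
qed

lemma bounded_op_norm: "bounded_op T \<Longrightarrow> \<exists>C. \<forall>f\<in>HD_minus. hd_norm (T f) \<le> C * hd_norm f"
  by (simp add: bounded_op_def)

lemma bounded_op_in_HD: "bounded_op T \<Longrightarrow> f \<in> HD_minus \<Longrightarrow> T f \<in> HD"
  by (auto simp: bounded_op_def intro: HD_plus_subset)

lemma bounded_op_coeff_add:
  "bounded_op T \<Longrightarrow> f \<in> HD_minus \<Longrightarrow> h \<in> HD_minus \<Longrightarrow>
    hd_coeff (T (\<lambda>z. f z + h z)) j = hd_coeff (T f) j + hd_coeff (T h) j"
  by (subst hd_coeff_add[symmetric])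
     (auto simp: bounded_op_in_HD HD_minus_add HD_add bounded_op_def HD_plus_subset intro!: hd_coeff_cong)

lemma bounded_op_coeff_cmult:
  "bounded_op T \<Longrightarrow> f \<in> HD_minus \<Longrightarrow> hd_coeff (T (\<lambda>z. c * f z)) j = c * hd_coeff (T f) j"
  by (subst hd_coeff_cmult[symmetric])
     (auto simp: bounded_op_in_HD HD_minus_cmult HD_cmult bounded_op_def HD_plus_subset intro!: hd_coeff_cong)

lemma HD_minus_zero: "(\<lambda>z. 0) \<in> HD_minus"
  by (simp add: HD_minus_def)

lemma HD_minus_sum: "(\<And>i. i \<in> I \<Longrightarrow> f i \<in> HD_minus) \<Longrightarrow> (\<lambda>z. \<Sum>i\<in>I. f i z) \<in> HD_minus"
  by (induction I rule: infinite_finite_induct) (auto intro: HD_minus_add HD_minus_zero)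

lemma bounded_op_coeff_zero: "bounded_op T \<Longrightarrow> hd_coeff (T (\<lambda>z. 0)) j = 0"
  using bounded_op_coeff_cmult[OF _ HD_minus_zero, of T 0] by simp

lemma bounded_op_coeff_sum:
  assumes T: "bounded_op T" and f: "\<And>i. i \<in> I \<Longrightarrow> f i \<in> HD_minus"
  shows "hd_coeff (T (\<lambda>z. \<Sum>i\<in>I. f i z)) j = (\<Sum>i\<in>I. hd_coeff (T (f i)) j)"
  using f
proof (induction I rule: infinite_finite_induct)
  case (insert i I)
  have "hd_coeff (T (\<lambda>z. f i z + (\<Sum>i\<in>I. f i z))) j = hd_coeff (T (f i)) j + hd_coeff (T (\<lambda>z. \<Sum>i\<in>I. f i z)) j"
    by (rule bounded_op_coeff_add[OF T]) (use insert.prems in \<open>auto intro: HD_minus_sum\<close>)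
  then show ?case using insert by simp
qed (simp_all add: bounded_op_coeff_zero T)

text \<open>Continuity allows \<open>f\<close> to be replaced by its finite expansions, and
  linearity, which holds only almost everywhere, is used on Fourier coefficients. A bounded operator
  is thus the operator of its own matrix.\<close>

lemma bounded_op_image:
  assumes T: "bounded_op T" and f: "f \<in> HD_minus"
  shows "mat_image (\<lambda>k n. hd_coeff (T (\<lambda>z. z powi neg_index n)) (int k)) f (T f)"
  unfolding mat_image_def
proof (intro conjI allI)
  show Tf: "T f \<in> HD_plus" using T f by (simp add: bounded_op_def)
  fix k
  define c where "c n = hd_coeff f (neg_index n)" for n
  let ?U = "\<lambda>N. trig_sum neg_index c {..<N}"
  obtain C where C: "\<forall>f\<in>HD_minus. hd_norm (T f) \<le> C * hd_norm f"
    using bounded_op_norm[OF T] by blast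
  have lim: "(\<lambda>N. hd_norm (\<lambda>z. f z - ?U N z)) \<longlonglongrightarrow> 0"
    unfolding c_def
  proof (rule hd_expansion[OF inj_neg_index HD_minus_subset[OF f]])
    show "hd_coeff f j = 0" if "j \<notin> range neg_index" for j
      using that f unfolding HD_minus_iff by blast
  qed
  have U: "?U N \<in> HD_minus" for N by (rule HD_minus_trig_sum) simp
  have d: "(\<lambda>z. f z - ?U N z) \<in> HD_minus" for N
    using HD_minus_add[OF f HD_minus_cmult[OF U, of "-1"]] by simp
  have "norm (hd_coeff (T f) (int k) - hd_coeff (T (?U N)) (int k)) \<le> C * hd_norm (\<lambda>z. f z - ?U N z)" for N
  proof -
    have "hd_coeff (T f) (int k) = hd_coeff (T (\<lambda>z. ?U N z + (f z - ?U N z))) (int k)" by simp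
    also have "\<dots> = hd_coeff (T (?U N)) (int k) + hd_coeff (T (\<lambda>z. f z - ?U N z)) (int k)"
      by (rule bounded_op_coeff_add[OF T U d])
    finally have "norm (hd_coeff (T f) (int k) - hd_coeff (T (?U N)) (int k)) = norm (hd_coeff (T (\<lambda>z. f z - ?U N z)) (int k))"
      by simp
    also have "\<dots> \<le> hd_norm (T (\<lambda>z. f z - ?U N z))"
      by (rule hd_coeff_le_norm[OF bounded_op_in_HD[OF T d]])
    also have "\<dots> \<le> C * hd_norm (\<lambda>z. f z - ?U N z)" using C d by blast
    finally show ?thesis .
  qed
  moreover have "(\<lambda>N. C * hd_norm (\<lambda>z. f z - ?U N z)) \<longlonglongrightarrow> 0"
    using tendsto_mult_right_zero[OF lim] .
  ultimately have "(\<lambda>N. hd_coeff (T f) (int k) - hd_coeff (T (?U N)) (int k)) \<longlonglongrightarrow> 0"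
    by (rule Lim_null_comparison[OF always_eventually, OF allI])
  from tendsto_diff[OF tendsto_const[of "hd_coeff (T f) (int k)"] this]
  have "(\<lambda>N. hd_coeff (T (?U N)) (int k)) \<longlonglongrightarrow> hd_coeff (T f) (int k)" by simp
  moreover have "hd_coeff (T (?U N)) (int k) = (\<Sum>n<N. c n * hd_coeff (T (\<lambda>z. z powi neg_index n)) (int k))" for N
    unfolding trig_sum_def [abs_def]
    by (simp add: bounded_op_coeff_sum[OF T] bounded_op_coeff_cmult[OF T] HD_minus_cmult HD_minus_powi del: of_nat_Suc)
  ultimately show "(\<lambda>n. hd_coeff f (neg_index n) * hd_coeff (T (\<lambda>z. z powi neg_index n)) (int k)) sums hd_coeff (T f) (int k)"
    by (simp add: sums_def c_def del: of_nat_Suc)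
qed

text \<open>The images exist because \<open>T\<close> provides them; a Hilbert-Schmidt estimate of
  \<open>M\<close> need not come first. The matrix of a transformed symbol is treated in this
  way.\<close>

lemma mat_op_eq_bounded_op:
  assumes "bounded_op T" "\<And>k n. hd_coeff (T (\<lambda>z. z powi neg_index n)) (int k) = M k n"
  shows "op_eq (mat_op M) T"
  unfolding op_eq_def
proof
  fix f assume "f \<in> HD_minus"
  then have "mat_image M f (T f)" using bounded_op_image[OF assms(1)] assms(2) by (simp del: of_nat_Suc)
  then show "hd_eq (mat_op M f) (T f)" using mat_op_eq mat_image_unique by blast
qed

context su11
begin

lemma bounded_op_conj:
  assumes T: "bounded_op T"
  shows "bounded_op (\<lambda>f. tr (T (su11.tr (cnj a) (- b) f)))"
proof -
  interpret inv: su11 "cnj a" "- b" by (rule su11_inverse)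
  have Tp: "f \<in> HD_minus \<Longrightarrow> T f \<in> HD_plus" for f
    using T by (simp add: bounded_op_def)
  note HD = HD_minus_subset HD_plus_subset inv.HD_minus_tr Tp HD_plus_tr
  obtain C where C: "\<forall>f\<in>HD_minus. hd_norm (T f) \<le> C * hd_norm f"
    using bounded_op_norm[OF T] by blast
  show ?thesis
    unfolding bounded_op_def
  proof (intro conjI ballI allI impI)
    fix f assume f: "f \<in> HD_minus"
    show "tr (T (inv.tr f)) \<in> HD_plus" by (intro HD f)
    fix h assume h: "h \<in> HD_minus"
    show "hd_eq (tr (T (inv.tr f))) (tr (T (inv.tr h)))" if "hd_eq f h"
    proof (rule tr_cong)
      have "hd_eq (inv.tr f) (inv.tr h)" using that by (intro inv.tr_cong HD_minus_subset f h)
      then show "hd_eq (T (inv.tr f)) (T (inv.tr h))"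
        using T f h by (simp add: bounded_op_def inv.HD_minus_tr)
    qed (intro HD f h)+
    have "hd_eq (tr (T (\<lambda>z. inv.tr f z + inv.tr h z))) (tr (\<lambda>z. T (inv.tr f) z + T (inv.tr h) z))"
    proof (rule tr_cong)
      show "hd_eq (T (\<lambda>z. inv.tr f z + inv.tr h z)) (\<lambda>z. T (inv.tr f) z + T (inv.tr h) z)"
        using T f h by (simp add: bounded_op_def inv.HD_minus_tr)
    qed (intro HD f h HD_plus_add HD_minus_add)+
    then show "hd_eq (tr (T (inv.tr (\<lambda>z. f z + h z)))) (\<lambda>z. tr (T (inv.tr f)) z + tr (T (inv.tr h)) z)"
      by (simp add: inv.tr_add tr_add)
  next
    fix c f assume f: "f \<in> HD_minus"
    have "hd_eq (tr (T (\<lambda>z. c * inv.tr f z))) (tr (\<lambda>z. c * T (inv.tr f) z))"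
    proof (rule tr_cong)
      show "hd_eq (T (\<lambda>z. c * inv.tr f z)) (\<lambda>z. c * T (inv.tr f) z)"
        using T f by (simp add: bounded_op_def inv.HD_minus_tr)
    qed (intro HD f HD_plus_cmult HD_minus_cmult)+
    then show "hd_eq (tr (T (inv.tr (\<lambda>z. c * f z)))) (\<lambda>z. c * tr (T (inv.tr f)) z)"
      by (simp add: inv.tr_cmult tr_cmult)
  next
    have "hd_norm (tr (T (inv.tr f))) \<le> C * hd_norm f" if f: "f \<in> HD_minus" for f
      using C[rule_format, OF inv.HD_minus_tr[OF f]] f by (simp add: hd_norm_tr inv.hd_norm_tr HD)
    then show "\<exists>C. \<forall>f\<in>HD_minus. hd_norm (tr (T (inv.tr f))) \<le> C * hd_norm f" by blast
  qed
qed

end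

section \<open>The matrix of the differential operator\<close>

text \<open>Pascal's rule acts as summation by parts: an alternating sum of order s + 1 is one of
  order s over first differences.\<close>

lemma alternating_binomial_Suc:
  fixes g :: "nat \<Rightarrow> real"
  shows "(\<Sum>i\<le>Suc s. (-1) ^ i * real (Suc s choose i) * g i)
    = (\<Sum>i\<le>s. (-1) ^ i * real (s choose i) * (g i - g (Suc i)))"
proof -
  have "(\<Sum>i\<le>Suc s. (-1) ^ i * real (Suc s choose i) * g i)
      = g 0 - (\<Sum>i\<le>s. (-1) ^ i * real (Suc s choose Suc i) * g (Suc i))"
    by (subst sum.atMost_Suc_shift) (simp add: sum_negf del: binomial_Suc_Suc)
  also have "\<dots> = g 0 - (\<Sum>i\<le>s. (-1) ^ i * real (s choose Suc i) * g (Suc i)) - (\<Sum>i\<le>s. (-1) ^ i * real (s choose i) * g (Suc i))"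
    by (simp add: ring_distribs sum.distrib)
  also have "g 0 - (\<Sum>i\<le>s. (-1) ^ i * real (s choose Suc i) * g (Suc i)) = (\<Sum>i\<le>Suc s. (-1) ^ i * real (s choose i) * g i)"
    by (subst sum.atMost_Suc_shift) (simp add: sum_negf)
  also have "\<dots> = (\<Sum>i\<le>s. (-1) ^ i * real (s choose i) * g i)" by simp
  finally show ?thesis by (simp add: right_diff_distrib sum_subtractf)
qed

text \<open>Each difference in the upper index lowers the lower index by one, so s of them leave (M
  choose r).\<close>

lemma alternating_binomial_sum:
  "(\<Sum>i\<le>s. (-1) ^ i * real (s choose i) * real ((M + s - i) choose (r + s))) = real (M choose r)"
proof (induction s)
  case (Suc s)
  have "(\<Sum>i\<le>Suc s. (-1) ^ i * real (Suc s choose i) * real ((M + Suc s - i) choose (r + Suc s)))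
     = (\<Sum>i\<le>s. (-1) ^ i * real (s choose i) * real ((M + s - i) choose (r + s)))"
    unfolding alternating_binomial_Suc
    by (intro sum.cong refl) (simp add: Suc_diff_le)
  then show ?case using Suc by simp
qed simp

text \<open>Vandermonde's convolution for x = -(p + 1) + (x + p + 1), with the negative upper index
  reflected. The free parameter \<open>p\<close> is later chosen so that x + p + 1 does not depend
  on the summation index.\<close>

lemma binomial_vandermonde_negative:
  "real (x choose s) = (\<Sum>j\<le>s. (-1) ^ j * real ((p + j) choose j) * real ((x + p + 1) choose (s - j)))"
proof -
  have "(of_nat x :: real) gchoose s = ((- of_nat (p + 1)) + of_nat (x + p + 1)) gchoose s" by simp
  also have "\<dots> = (\<Sum>j=0..s. ((- of_nat (p + 1)) gchoose j) * (of_nat (x + p + 1) gchoose (s - j)))"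
    by (rule gbinomial_Vandermonde[symmetric])
  also have "\<dots> = (\<Sum>j\<le>s. (-1) ^ j * real ((p + j) choose j) * real ((x + p + 1) choose (s - j)))"
  proof (intro sum.cong)
    fix j
    have "((- of_nat (p + 1) :: real) gchoose j) = (-1) ^ j * (of_nat (p + j) gchoose j)"
      by (subst gbinomial_minus) simp
    then show "((- of_nat (p + 1) :: real) gchoose j) * (of_nat (x + p + 1) gchoose (s - j))
        = (-1) ^ j * real ((p + j) choose j) * real ((x + p + 1) choose (s - j))"
      by (simp only: binomial_gbinomial)
  qed auto
  finally show ?thesis by (simp only: binomial_gbinomial)
qed

text \<open>The j-th derivative of z^(-n-1) contributes (-1)^j j! (n+j choose j), the (s-j)-th
  derivative of z^(k+n+s+1) contributes (s-j)! (k+n+s+1 choose s-j), and the factorials cancel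
  against (s choose j) / s!. What remains is this weight.\<close>

definition hankel_weight :: "nat \<Rightarrow> nat \<Rightarrow> nat \<Rightarrow> real" where
  "hankel_weight s k n = (\<Sum>j\<le>s. (-1) ^ j * real ((s + j) choose j) *
     real ((k + n + s + 1) choose (s - j)) * real ((n + j) choose j))"

text \<open>Trinomial revision. In the next proof it gathers the dependence on i into a single
  binomial coefficient, ready for the alternating sum.\<close>

lemma choose_trinomial: "((n + j) choose j) * (n choose s) = ((n + j) choose (s + j)) * ((s + j) choose j)"
proof (cases "s \<le> n")
  case True
  then show ?thesis using choose_mult[of j "s + j" "n + j"] by simp
qed (simp add: binomial_eq_0)

text \<open>The right-hand side is the coefficient of \<open>z^k w^n\<close> in
  \<open>(z - w)^s / ((1 - z) (1 - w))^(s + 1)\<close>.\<close>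

lemma hankel_weight_alt:
  "hankel_weight s k n = (\<Sum>i\<le>s. (-1) ^ i * real (s choose i) * real ((k + i) choose s) * real ((n + s - i) choose s))"
proof -
  have "(\<Sum>i\<le>s. (-1) ^ i * real (s choose i) * real ((k + i) choose s) * real ((n + s - i) choose s))
      = (\<Sum>i\<le>s. \<Sum>j\<le>s. (-1) ^ j * real ((s + j) choose j) * real ((k + n + s + 1) choose (s - j)) *
          ((-1) ^ i * real (s choose i) * real ((n + j + s - i) choose (j + s))))"
  proof (intro sum.cong refl)
    fix i assume "i \<in> {..s}"
    \<comment> \<open>Vandermonde is applied with p = n + s - i, which makes x + p + 1 equal to k +
      n + s + 1 for every i; the sum over i can then be carried out for fixed j.\<close>
    then have i: "k + i + (n + s - i) + 1 = k + n + s + 1" by simp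
    have "(-1) ^ i * real (s choose i) * real ((k + i) choose s) * real ((n + s - i) choose s)
      = (\<Sum>j\<le>s. (-1) ^ i * real (s choose i) * (-1) ^ j * real ((k + n + s + 1) choose (s - j)) *
          real (((n + s - i + j) choose j) * ((n + s - i) choose s)))"
      unfolding binomial_vandermonde_negative[of "k + i" s "n + s - i"] i
      by (simp add: sum_distrib_left sum_distrib_right mult_ac)
    also have "\<dots> = (\<Sum>j\<le>s. (-1) ^ j * real ((s + j) choose j) * real ((k + n + s + 1) choose (s - j)) *
          ((-1) ^ i * real (s choose i) * real ((n + j + s - i) choose (j + s))))"
    proof (intro sum.cong refl)
      fix j
      have "n + s - i + j = n + j + s - i" using \<open>i \<in> {..s}\<close> by simp
      then show "(-1) ^ i * real (s choose i) * (-1) ^ j * real ((k + n + s + 1) choose (s - j)) *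
          real (((n + s - i + j) choose j) * ((n + s - i) choose s))
        = (-1) ^ j * real ((s + j) choose j) * real ((k + n + s + 1) choose (s - j)) *
          ((-1) ^ i * real (s choose i) * real ((n + j + s - i) choose (j + s)))"
        unfolding choose_trinomial by (simp add: mult_ac add.commute[of s j])
    qed
    finally show "(-1) ^ i * real (s choose i) * real ((k + i) choose s) * real ((n + s - i) choose s)
      = (\<Sum>j\<le>s. (-1) ^ j * real ((s + j) choose j) * real ((k + n + s + 1) choose (s - j)) *
          ((-1) ^ i * real (s choose i) * real ((n + j + s - i) choose (j + s))))" .
  qed
  also have "\<dots> = (\<Sum>j\<le>s. (-1) ^ j * real ((s + j) choose j) * real ((k + n + s + 1) choose (s - j)) *
      (\<Sum>i\<le>s. (-1) ^ i * real (s choose i) * real ((n + j + s - i) choose (j + s))))"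
    by (subst sum.swap) (simp add: sum_distrib_left)
  also have "\<dots> = hankel_weight s k n"
    unfolding alternating_binomial_sum hankel_weight_def ..
  finally show ?thesis ..
qed

text \<open>Each summand of the alternative form has a vanishing binomial, since k < s - i or n < i.
  These are the entries that would see Taylor coefficients of index at most 2 s, so the matrix
  depends only on the class of the symbol.\<close>

lemma hankel_weight_zero:
  assumes "k + n < s"
  shows "hankel_weight s k n = 0"
  unfolding hankel_weight_alt
proof (intro sum.neutral ballI)
  fix i assume "i \<in> {..s}"
  then have "k + i < s \<or> n + s - i < s" using assms by auto
  then show "(-1) ^ i * real (s choose i) * real ((k + i) choose s) * real ((n + s - i) choose s) = 0"
    by (auto simp: binomial_eq_0)
qed

text \<open>Each summand is a product of polynomials of degrees s - j and j, hence the power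
  s.\<close>

lemma hankel_weight_bound:
  "\<bar>hankel_weight s k n\<bar> \<le> (\<Sum>j\<le>s. real ((s + j) choose j)) * real (k + n + s + 1) ^ s"
proof -
  let ?N = "k + n + s + 1"
  have "\<bar>hankel_weight s k n\<bar> \<le> (\<Sum>j\<le>s. real ((s + j) choose j) * (real (?N choose (s - j)) * real ((n + j) choose j)))"
    unfolding hankel_weight_def by (rule order_trans[OF sum_abs]) (simp add: abs_mult power_abs mult.assoc)
  also have "\<dots> \<le> (\<Sum>j\<le>s. real ((s + j) choose j) * real ?N ^ s)"
  proof (intro sum_mono mult_left_mono)
    fix j assume j: "j \<in> {..s}"
    have "?N choose (s - j) \<le> ?N ^ (s - j)" by (rule binomial_le_pow) simp
    moreover have "(n + j) choose j \<le> (n + j) ^ j" by (rule binomial_le_pow) simp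
    moreover have "(n + j) ^ j \<le> ?N ^ j" using j by (intro power_mono) auto
    ultimately have "(?N choose (s - j)) * ((n + j) choose j) \<le> ?N ^ (s - j) * ?N ^ j"
      by (intro mult_mono) linarith+
    also have "\<dots> = ?N ^ s" using j by (simp flip: power_add)
    finally have "real ((?N choose (s - j)) * ((n + j) choose j)) \<le> real (?N ^ s)"
      by (rule of_nat_mono)
    then show "real (?N choose (s - j)) * real ((n + j) choose j) \<le> real ?N ^ s"
      by (simp only: of_nat_mult of_nat_power)
  qed auto
  finally show ?thesis by (simp only: sum_distrib_right)
qed

section \<open>Laurent coefficients of the differential operator\<close>

abbreviation taylor :: "(complex \<Rightarrow> complex) \<Rightarrow> nat \<Rightarrow> complex" where
  "taylor x m \<equiv> fps_nth (fps_expansion x 0) m"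

definition hankel_matrix :: "nat \<Rightarrow> (complex \<Rightarrow> complex) \<Rightarrow> nat \<Rightarrow> nat \<Rightarrow> complex" where
  "hankel_matrix s x k n = taylor x (k + n + s + 1) * of_real (hankel_weight s k n)"

lemma fls_sum_nth: "fls_nth (\<Sum>i\<in>I. F i) m = (\<Sum>i\<in>I. fls_nth (F i) m)"
  by (induction I rule: infinite_finite_induct) simp_all

text \<open>In Pochhammer form one formula serves both the Taylor series of the symbol and the
  negative powers to which the operator is applied.\<close>

lemma fls_higher_deriv_nth:
  fixes F :: "complex fls"
  shows "fls_nth ((fls_deriv ^^ j) F) i = pochhammer (of_int (i + 1)) j * fls_nth F (i + int j)"
proof (induction j arbitrary: i)
  case (Suc j)
  have "fls_nth ((fls_deriv ^^ Suc j) F) i = of_int (i + 1) * fls_nth ((fls_deriv ^^ j) F) (i + 1)" by simp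
  also have "\<dots> = pochhammer (of_int (i + 1)) (Suc j) * fls_nth F (i + int (Suc j))"
    unfolding Suc pochhammer_rec by (simp add: add_ac)
  finally show ?case .
qed simp

lemma pochhammer_choose: "pochhammer (of_nat n + 1 :: complex) j = fact j * of_nat ((n + j) choose j)"
proof -
  have "of_nat ((n + j) choose j) = pochhammer (of_nat (n + j) - of_nat j + 1 :: complex) j / fact j"
    unfolding binomial_gbinomial by (rule gbinomial_pochhammer')
  then show ?thesis by simp
qed

lemma L_diff_monomial:
  "fls_nth (L_diff s x (fls_const c * fls_X_intpow (neg_index n))) (int k) = c * hankel_matrix s x k n"
proof -
  let ?E = "fps_to_fls (fps_expansion x 0)"
  have D: "(fls_deriv ^^ j) (fls_const c * fls_X_intpow (neg_index n))
     = fls_const (c * ((-1) ^ j * fact j * of_nat ((n + j) choose j))) * fls_X_intpow (neg_index n - int j)" for j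
  proof (rule fls_eqI)
    fix i
    have p: "pochhammer (of_int (neg_index n - int j + 1)) j = ((-1) ^ j * fact j * of_nat ((n + j) choose j) :: complex)"
    proof -
      have "pochhammer (of_int (neg_index n - int j + 1)) j = pochhammer (- (of_nat (n + j) :: complex)) j"
        by (rule arg_cong[where f="\<lambda>u. pochhammer u j"]) simp
      also have "\<dots> = (-1) ^ j * pochhammer (of_nat (n + j) - of_nat j + 1) j" by (rule pochhammer_minus)
      also have "of_nat (n + j) - of_nat j + 1 = (of_nat n + 1 :: complex)" by simp
      finally show ?thesis by (simp add: pochhammer_choose)
    qed
    show "fls_nth ((fls_deriv ^^ j) (fls_const c * fls_X_intpow (neg_index n))) i =
      fls_nth (fls_const (c * ((-1) ^ j * fact j * of_nat ((n + j) choose j))) * fls_X_intpow (neg_index n - int j)) i"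
    proof (cases "i = neg_index n - int j")
      case True
      show ?thesis unfolding fls_higher_deriv_nth True p by simp
    next
      case False
      then have "i + int j \<noteq> neg_index n" by auto
      then have "fls_nth (fls_const c * fls_X_intpow (neg_index n)) (i + int j) = 0" by auto
      with False show ?thesis by (simp only: fls_higher_deriv_nth) auto
    qed
  qed
  have "fls_nth (L_diff s x (fls_const c * fls_X_intpow (neg_index n))) (int k)
     = (\<Sum>j\<le>s. c * (1 / fact s * of_nat (s choose j) * of_nat ((s + j) choose j) *
         ((-1) ^ j * fact j * of_nat ((n + j) choose j)) *
         fls_nth ((fls_deriv ^^ (s - j)) ?E) (int (k + n + 1 + j))))"
    unfolding L_diff_def fls_sum_nth D
  proof (intro sum.cong refl)
    fix j
    let ?G = "(fls_deriv ^^ (s - j)) ?E"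
    let ?p = "1 / fact s * of_nat (s choose j) * of_nat ((s + j) choose j) :: complex"
    let ?q = "c * ((-1) ^ j * fact j * of_nat ((n + j) choose j))"
    have "fls_const ?p * ?G * (fls_const ?q * fls_X_intpow (neg_index n - int j))
        = fls_const (?p * ?q) * (?G * fls_X_intpow (neg_index n - int j))"
      by (simp only: fls_const_mult_const[symmetric] mult_ac)
    also have "?G * fls_X_intpow (neg_index n - int j) = fls_shift (- (neg_index n - int j)) ?G"
      by (rule fls_X_intpow_times_conv_shift)
    finally have eq: "fls_const ?p * ?G * (fls_const ?q * fls_X_intpow (neg_index n - int j))
        = fls_const (?p * ?q) * fls_shift (- (neg_index n - int j)) ?G" .
    have i: "int k + - (neg_index n - int j) = int (k + n + 1 + j)" by simp
    show "fls_nth (fls_const ?p * ?G * (fls_const ?q * fls_X_intpow (neg_index n - int j))) (int k)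
        = c * (?p * ((-1) ^ j * fact j * of_nat ((n + j) choose j)) * fls_nth ?G (int (k + n + 1 + j)))"
      unfolding eq fls_mult_const_nth fls_shift_nth i by (simp only: mult_ac)
  qed
  also have "\<dots> = (\<Sum>j\<le>s. c * (taylor x (k + n + s + 1) * ((-1) ^ j * of_nat ((s + j) choose j) *
       of_nat ((k + n + s + 1) choose (s - j)) * of_nat ((n + j) choose j))))"
  proof (intro sum.cong refl)
    fix j assume j: "j \<in> {..s}"
    have "fls_nth ((fls_deriv ^^ (s - j)) ?E) (int (k + n + 1 + j))
       = pochhammer (of_nat (k + n + 1 + j) + 1) (s - j) * taylor x (k + n + s + 1)"
    proof -
      have "int (k + n + 1 + j) + int (s - j) = int (k + n + s + 1)" using j by simp
      moreover have "of_int (int (k + n + 1 + j) + 1) = (of_nat (k + n + 1 + j) + 1 :: complex)" by simp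
      moreover have "fls_nth ?E (int m) = taylor x m" for m by simp
      ultimately show ?thesis by (simp only: fls_higher_deriv_nth)
    qed
    also have "pochhammer (of_nat (k + n + 1 + j) + 1 :: complex) (s - j)
       = fact (s - j) * of_nat ((k + n + s + 1) choose (s - j))"
      unfolding pochhammer_choose using j by (simp add: add.assoc)
    finally have e: "fls_nth ((fls_deriv ^^ (s - j)) ?E) (int (k + n + 1 + j))
       = fact (s - j) * of_nat ((k + n + s + 1) choose (s - j)) * taylor x (k + n + s + 1)" .
    \<comment> \<open>This is the cancellation of all factorials against the prefactor 1/s! of the
      operator.\<close>
    have f: "of_nat (s choose j) * (fact j * fact (s - j)) = (fact s :: complex)"
      using binomial_fact_lemma[of j s] j by (metis atMost_iff mult.commute of_nat_fact of_nat_mult)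
    show "c * (1 / fact s * of_nat (s choose j) * of_nat ((s + j) choose j) *
         ((-1) ^ j * fact j * of_nat ((n + j) choose j)) *
         fls_nth ((fls_deriv ^^ (s - j)) ?E) (int (k + n + 1 + j)))
      = c * (taylor x (k + n + s + 1) * ((-1) ^ j * of_nat ((s + j) choose j) *
       of_nat ((k + n + s + 1) choose (s - j)) * of_nat ((n + j) choose j)))"
      unfolding e using j by (simp add: f[symmetric] field_simps)
  qed
  also have "\<dots> = c * hankel_matrix s x k n"
    by (simp add: hankel_matrix_def hankel_weight_def sum_distrib_left)
  finally show ?thesis .
qed

lemma L_diff_sum: "L_diff s x (\<Sum>i\<in>I. F i) = (\<Sum>i\<in>I. L_diff s x (F i))"
proof -
  have d: "(fls_deriv ^^ j) (\<Sum>i\<in>I. F i) = (\<Sum>i\<in>I. (fls_deriv ^^ j) (F i))" for j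
    by (induction j) (simp_all add: fls_deriv_sum)
  show ?thesis
    unfolding L_diff_def d sum_distrib_left by (rule sum.swap)
qed

lemma is_Pplus_L_PminusI:
  assumes T: "bounded_op T"
    and basis: "\<And>k n. hd_coeff (T (\<lambda>z. z powi neg_index n)) (int k) = hankel_matrix s x k n"
  shows "is_Pplus_L_Pminus s x T"
  unfolding is_Pplus_L_Pminus_def
proof (intro conjI T allI)
  fix N k :: nat and c :: "nat \<Rightarrow> complex"
  have r: "(\<Sum>n=1..N. g n) = (\<Sum>n<N. g (Suc n))" for g :: "nat \<Rightarrow> 'a::comm_monoid_add"
    by (rule sum.reindex_bij_witness[of _ Suc "\<lambda>n. n - 1"]) auto
  have "hd_coeff (T (\<lambda>z. \<Sum>n=1..N. c n * z powi (- int n))) (int k) = (\<Sum>n<N. c (Suc n) * hankel_matrix s x k n)"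
    unfolding r by (simp only: bounded_op_coeff_sum[OF T] bounded_op_coeff_cmult[OF T] HD_minus_cmult HD_minus_powi basis)
  also have "\<dots> = fls_nth (L_diff s x (\<Sum>n=1..N. fls_const (c n) * fls_X_intpow (- int n))) (int k)"
    unfolding r L_diff_sum fls_sum_nth L_diff_monomial ..
  finally show "hd_coeff (T (\<lambda>z. \<Sum>n=1..N. c n * z powi (- int n))) (int k) =
      fps_nth (fls_regpart (L_diff s x (\<Sum>n=1..N. fls_const (c n) * fls_X_intpow (- int n)))) k"
    by simp
qed

section \<open>Weighted norms on the disc\<close>

text \<open>The plane is identified with \<open>real^2\<close>, where volume is known to be
  invariant under orthogonal maps; rotations of the complex plane inherit this.\<close>

definition cart_complex :: "real^2 \<Rightarrow> complex" where
  "cart_complex v = Complex (v $ 1) (v $ 2)"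

definition complex_cart :: "complex \<Rightarrow> real^2" where
  "complex_cart z = (\<chi> i. if i = 1 then Re z else Im z)"

lemma complex_cart_nth [simp]: "complex_cart z $ 1 = Re z" "complex_cart z $ 2 = Im z"
  by (simp_all add: complex_cart_def)

lemma complex_cart_inverse [simp]: "cart_complex (complex_cart z) = z" "complex_cart (cart_complex v) = v"
  by (simp_all add: cart_complex_def vec_eq_iff forall_2)

lemma norm_complex_cart: "norm (complex_cart z) = norm z"
  by (simp add: norm_vec_def L2_set_def sum_2 cmod_def)

lemma cart_complex_measurable [measurable]: "cart_complex \<in> borel_measurable borel"
  unfolding cart_complex_def [abs_def] complex_eq
  by (intro borel_measurable_continuous_onI continuous_intros)

lemma cart_complex_box: "cart_complex -` box l u = box (complex_cart l) (complex_cart u)"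
  by (auto simp: cart_complex_def mem_box_cart forall_2 mem_box Basis_complex_def)

lemma distr_cart_complex: "lborel = distr lborel borel cart_complex"
proof (rule lborel_eqI)
  fix l u :: complex assume lu: "\<And>b. b \<in> Basis \<Longrightarrow> l \<bullet> b \<le> u \<bullet> b"
  have le: "Re l \<le> Re u" "Im l \<le> Im u" using lu[of 1] lu[of \<i>] by (auto simp: Basis_complex_def)
  have "emeasure (distr lborel borel cart_complex) (box l u) = emeasure lborel (box (complex_cart l) (complex_cart u))"
    by (simp add: emeasure_distr cart_complex_box)
  also have "\<dots> = (\<Prod>b\<in>Basis. (complex_cart u - complex_cart l) \<bullet> b)"
    by (rule emeasure_lborel_box)
       (use le in \<open>auto simp: Basis_vec_def inner_axis complex_cart_def\<close>)
  also have "(\<Prod>b\<in>Basis. (complex_cart u - complex_cart l) \<bullet> b) = (\<Prod>i\<in>UNIV. (complex_cart u - complex_cart l) $ i)"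
    by (simp add: Basis_vec_def cart_eq_inner_axis axis_eq_axis prod.UNION_disjoint)
  also have "\<dots> = (Re u - Re l) * (Im u - Im l)"
    by (simp add: UNIV_2)
  also have "\<dots> = (\<Prod>b\<in>Basis. (u - l) \<bullet> b)" by (simp add: Basis_complex_def)
  finally show "emeasure (distr lborel borel cart_complex) (box l u) = ennreal (\<Prod>b\<in>Basis. (u - l) \<bullet> b)" .
qed simp

lemma norm_cart_complex: "norm (cart_complex v) = norm v"
  by (metis norm_complex_cart complex_cart_inverse(2))

lemma orthogonal_rotation:
  assumes "norm u = 1"
  shows "orthogonal_transformation (\<lambda>v. complex_cart (u * cart_complex v))"
  unfolding orthogonal_transformation
proof
  show "linear (\<lambda>v. complex_cart (u * cart_complex v))"
    by (auto simp: linear_iff vec_eq_iff forall_2 cart_complex_def algebra_simps)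
  show "\<forall>v. norm (complex_cart (u * cart_complex v)) = norm v"
    using assms by (simp add: norm_complex_cart norm_cart_complex norm_mult)
qed

lemma distr_rotation:
  assumes u: "norm u = 1"
  shows "lborel = distr lborel borel ((*) (u :: complex))"
proof (rule lborel_eqI)
  fix l r :: complex assume lr: "\<And>b. b \<in> Basis \<Longrightarrow> l \<bullet> b \<le> r \<bullet> b"
  define B where "B = box (complex_cart l) (complex_cart r)"
  \<comment> \<open>The preimage of a box under multiplication by \<open>u\<close> is its image
    under multiplication by \<open>cnj u\<close>, the inverse rotation.\<close>
  define R where "R v = complex_cart (cnj u * cart_complex v)" for v
  have uu: "u * cnj u = 1" using u complex_norm_square[of u] by simp
  have B: "B = cart_complex -` box l r" by (simp add: B_def cart_complex_box)
  have R: "orthogonal_transformation R" unfolding R_def using u by (intro orthogonal_rotation) simp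
  have img: "cart_complex -` ((*) u -` box l r) = R ` B"
  proof (intro set_eqI iffI)
    fix v assume "v \<in> cart_complex -` ((*) u -` box l r)"
    then have "complex_cart (u * cart_complex v) \<in> B" by (simp add: B)
    moreover have "R (complex_cart (u * cart_complex v)) = v"
      using uu by (simp add: R_def mult.assoc[symmetric] mult.commute[of "cnj u"])
    ultimately show "v \<in> R ` B" by (metis imageI)
  next
    fix v assume "v \<in> R ` B"
    then show "v \<in> cart_complex -` ((*) u -` box l r)"
      using uu by (auto simp: R_def B mult.assoc[symmetric])
  qed
  have open_img: "open ((*) u -` box l r)"
    by (intro open_vimage open_box continuous_intros)
  then have sets_img: "(*) u -` box l r \<in> sets borel" by auto
  have "emeasure (distr lborel borel ((*) u)) (box l r) = emeasure lborel ((*) u -` box l r)"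
    by (simp add: emeasure_distr)
  also have "\<dots> = emeasure lborel (R ` B)"
    using sets_img by (subst distr_cart_complex) (simp add: emeasure_distr img)
  also have "\<dots> = emeasure lebesgue (R ` B)"
  proof -
    have "R ` B \<in> sets borel" unfolding img[symmetric]
      using measurable_sets[OF cart_complex_measurable sets_img] by simp
    then show ?thesis by simp
  qed
  also have "\<dots> = ennreal (measure lebesgue (R ` B))"
    using measurable_orthogonal_image[OF R, of B] by (simp add: B_def emeasure_eq_measure2 fmeasurableD2)
  also have "measure lebesgue (R ` B) = measure lebesgue B"
    by (rule measure_orthogonal_image[OF R]) (simp add: B_def)
  also have "ennreal (measure lebesgue B) = emeasure lborel B"
    by (simp add: B_def emeasure_eq_measure2 emeasure_lborel_box_finite less_top[symmetric])
  also have "\<dots> = emeasure lborel (box l r)"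
    by (subst distr_cart_complex) (simp add: emeasure_distr B)
  also have "\<dots> = (\<Prod>b\<in>Basis. (r - l) \<bullet> b)" using lr by simp
  finally show "emeasure (distr lborel borel ((*) u)) (box l r) = (\<Prod>b\<in>Basis. (r - l) \<bullet> b)" .
qed simp

lemma nn_integral_rotation:
  assumes u: "norm u = 1" and [measurable]: "h \<in> borel_measurable borel"
  shows "(\<integral>\<^sup>+ z. h (u * z) \<partial>lborel) = (\<integral>\<^sup>+ z. h (z :: complex) \<partial>lborel)"
  by (subst (2) distr_rotation[OF u]) (simp add: nn_integral_distr)

text \<open>Averaging over all rotations takes the place of polar coordinates: the inner integral is
  over a circle, where Parseval's identity computes it.\<close>

lemma nn_integral_rotation_average:
  fixes h :: "complex \<Rightarrow> ennreal"
  assumes [measurable]: "h \<in> borel_measurable borel"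
  shows "(\<integral>\<^sup>+ z. h z \<partial>lborel) = (\<integral>\<^sup>+ z. (\<integral>\<^sup>+ u. h (u * z) \<partial>S1) \<partial>lborel)"
proof -
  interpret pair_sigma_finite S1 "lborel :: complex measure" ..
  have "(\<integral>\<^sup>+ z. h z \<partial>lborel) = (\<integral>\<^sup>+ u. (\<integral>\<^sup>+ z. h z \<partial>lborel) \<partial>S1)"
    by (simp add: emeasure_S1_UNIV)
  also have "\<dots> = (\<integral>\<^sup>+ u. (\<integral>\<^sup>+ z. h (u * z) \<partial>lborel) \<partial>S1)"
    by (rule nn_integral_cong_AE, rule AE_S1_I) (simp add: nn_integral_rotation)
  also have "\<dots> = (\<integral>\<^sup>+ z. (\<integral>\<^sup>+ u. h (u * z) \<partial>S1) \<partial>lborel)"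
    by (rule Fubini'[symmetric]) measurable
  finally show ?thesis .
qed

section \<open>Parseval's identity for weighted area in the disc\<close>

lemma hd_power_series:
  assumes g: "summable (\<lambda>b. norm (g b))" and [measurable]: "G \<in> borel_measurable borel"
    and G: "\<And>z. norm z = 1 \<Longrightarrow> (\<lambda>b. g b * z ^ b) sums G z"
  shows "G \<in> HD_plus" "hd_coeff G (int k) = g k"
proof -
  have "norm (G z) \<le> (\<Sum>b. norm (g b))" if z: "norm z = 1" for z
  proof -
    have eq: "norm (g b * z ^ b) = norm (g b)" for b using z by (simp add: norm_mult norm_power)
    have "norm (\<Sum>b. g b * z ^ b) \<le> (\<Sum>b. norm (g b * z ^ b))"
      by (rule summable_norm) (simp add: eq g)
    then show ?thesis using G[OF z] by (simp add: eq sums_iff)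
  qed
  then have HD: "G \<in> HD" by (intro HD_bounded) auto
  have "(\<lambda>b. g b * (LINT z|S1. z ^ b * z powi - j)) sums hd_coeff G j" for j
    unfolding hd_coeff_def
    by (rule integral_S1_power_series[OF g _ _ G]) (auto intro: HD_integrable)
  moreover have "(LINT z|S1. z ^ b * z powi - j) = (if int b = j then 1 else 0)" for b j
    using hd_coeff_powi[of "int b" j] by (simp add: hd_coeff_def)
  ultimately have s: "(\<lambda>b. g b * (if int b = j then 1 else 0)) sums hd_coeff G j" for j by simp
  have "hd_coeff G j = 0" if "j < 0" for j
  proof -
    have "(\<lambda>b. g b * (if int b = j then 1 else 0)) = (\<lambda>b. 0)" using that by auto
    with s[of j] show ?thesis by (metis sums_unique2 sums_zero)
  qed
  with HD show "G \<in> HD_plus" by (simp add: HD_plus_def)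
  have "(\<lambda>b. g b * (if int b = int k then 1 else 0)) = (\<lambda>b. if b = k then g b else 0)" by auto
  with s[of "int k"] sums_single[of k g] show "hd_coeff G (int k) = g k" by (metis sums_unique2)
qed

lemma taylor_sums:
  assumes "f holomorphic_on ball 0 1" "norm z < 1"
  shows "(\<lambda>n. taylor f n * z ^ n) sums f z"
  using holomorphic_power_series[OF assms(1), of z] assms(2) by (simp add: fps_expansion_def)

lemma taylor_abs_summable:
  assumes "f holomorphic_on ball 0 1" "norm z < 1"
  shows "summable (\<lambda>n. norm (taylor f n * z ^ n))"
proof -
  define r where "r = (norm z + 1) / 2"
  have r: "norm z < r" "r < 1" using assms(2) by (auto simp: r_def field_simps)
  then have "0 < r" using norm_ge_zero[of z] by linarith
  then have "summable (\<lambda>n. taylor f n * of_real r ^ n)"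
    using taylor_sums[OF assms(1), of "of_real r"] r by (auto simp: sums_iff)
  then show ?thesis by (rule powser_insidea) (use r \<open>0 < r\<close> in auto)
qed

text \<open>Extension by zero yields a Borel function on the whole plane from one that is controlled
  only in the disc.\<close>

definition disc_fun :: "(complex \<Rightarrow> complex) \<Rightarrow> complex \<Rightarrow> complex" where
  "disc_fun f z = (if norm z < 1 then f z else 0)"

lemma disc_fun_measurable:
  assumes "f holomorphic_on ball 0 1"
  shows "disc_fun f \<in> borel_measurable borel"
proof -
  have "(\<lambda>z. indicator (ball 0 1) z *\<^sub>R f z) \<in> borel_measurable borel"
    by (rule borel_measurable_continuous_on_indicator)
       (use assms in \<open>auto intro: holomorphic_on_imp_continuous_on\<close>)
  also have "(\<lambda>z. indicator (ball 0 1) z *\<^sub>R f z) = disc_fun f"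
    by (auto simp: disc_fun_def indicator_def fun_eq_iff)
  finally show ?thesis .
qed

lemma circle_mean_square:
  assumes f: "f holomorphic_on ball 0 1" and z: "norm z < 1"
  shows "(\<integral>\<^sup>+ u. ennreal ((norm (disc_fun f (u * z)))\<^sup>2) \<partial>S1) = (\<Sum>n. ennreal ((norm (taylor f n))\<^sup>2 * norm z ^ (2 * n)))"
proof -
  note [measurable] = disc_fun_measurable[OF f]
  define G where "G u = disc_fun f (u * z)" for u
  define g where "g n = taylor f n * z ^ n" for n
  have [measurable]: "G \<in> borel_measurable borel" unfolding G_def by measurable
  have g: "summable (\<lambda>n. norm (g n))" unfolding g_def by (rule taylor_abs_summable[OF f z])
  have G: "(\<lambda>n. g n * u ^ n) sums G u" if "norm u = 1" for u
    using taylor_sums[OF f, of "u * z"] that z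
    by (simp add: G_def g_def disc_fun_def norm_mult power_mult_distrib mult_ac)
  have p: "G \<in> HD_plus" and c: "hd_coeff G (int n) = g n" for n
    using hd_power_series[OF g _ G] by auto
  have "(\<integral>\<^sup>+ u. ennreal ((norm (G u))\<^sup>2) \<partial>S1) = ennreal ((hd_norm G)\<^sup>2)"
    unfolding hd_norm_sq using p by (intro nn_integral_eq_integral HD_square_integrable HD_plus_subset) auto
  also have "(hd_norm G)\<^sup>2 = (\<Sum>n. (norm (g n))\<^sup>2)"
    using HD_plus_parseval[OF p] by (simp add: c sums_iff)
  also have "ennreal \<dots> = (\<Sum>n. ennreal ((norm (g n))\<^sup>2))"
    using HD_plus_parseval[OF p] by (intro suminf_ennreal2[symmetric]) (auto simp: c sums_iff)
  finally show ?thesis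
    by (simp add: G_def g_def norm_mult norm_power power_mult_distrib mult.commute[of 2] flip: power_mult)
qed

definition disc_weight :: "nat \<Rightarrow> complex \<Rightarrow> real" where
  "disc_weight s z = (if norm z < 1 then (1 - (norm z)\<^sup>2) ^ (2 * s) else 0)"

lemma disc_weight_nonneg [simp]: "0 \<le> disc_weight s z"
  by (simp add: disc_weight_def)

lemma disc_weight_le_1: "disc_weight s z \<le> 1"
  by (auto simp: disc_weight_def power_le_one_iff intro!: power_le_one)

lemma disc_weight_measurable [measurable]: "disc_weight s \<in> borel_measurable borel"
  unfolding disc_weight_def [abs_def] by measurable

text \<open>The squared norm of z^n in the weighted Bergman space, a beta integral of order n^(-(2 s
  + 1)).\<close>

definition disc_moment :: "nat \<Rightarrow> nat \<Rightarrow> real" where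
  "disc_moment s n = (LINT z|lborel. norm (z :: complex) ^ (2 * n) * disc_weight s z)"

lemma disc_moment_nn:
  "(\<integral>\<^sup>+ z. ennreal (norm (z :: complex) ^ (2 * n) * disc_weight s z) \<partial>lborel) = ennreal (disc_moment s n)"
proof -
  have "integrable lborel (\<lambda>z :: complex. norm z ^ (2 * n) * disc_weight s z)"
  proof (rule Bochner_Integration.integrable_bound)
    show "integrable lborel (indicator (ball 0 1) :: complex \<Rightarrow> real)"
      by (rule integrable_real_indicator) (use emeasure_bounded_finite[OF bounded_ball[of "0 :: complex" 1]] in auto)
    show "AE z :: complex in lborel. norm (norm z ^ (2 * n) * disc_weight s z) \<le> norm (indicator (ball 0 1) z :: real)"
    proof (rule AE_I2)
      fix z :: complex
      show "norm (norm z ^ (2 * n) * disc_weight s z) \<le> norm (indicator (ball 0 1) z :: real)"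
      proof (cases "norm z < 1")
        case True
        then have "norm z ^ (2 * n) * disc_weight s z \<le> 1"
          using disc_weight_le_1 by (intro mult_le_one power_le_one) auto
        with True show ?thesis by simp
      qed (simp add: disc_weight_def)
    qed
  qed measurable
  then show ?thesis unfolding disc_moment_def by (intro nn_integral_eq_integral) auto
qed

lemma disc_moment_nonneg [simp]: "0 \<le> disc_moment s n"
  unfolding disc_moment_def by (rule integral_nonneg_AE) auto

text \<open>Monomials are orthogonal on every circle around 0, hence for the radially weighted area.
  Working with values in [0, \<infinity>] gives membership and norm from one identity.\<close>

lemma disc_nn_integral:
  assumes f: "f holomorphic_on ball 0 1"
  shows "(\<integral>\<^sup>+ z. ennreal ((norm (disc_fun f z))\<^sup>2 * disc_weight s z) \<partial>lborel)
    = (\<Sum>n. ennreal ((norm (taylor f n))\<^sup>2 * disc_moment s n))"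
proof -
  note [measurable] = disc_fun_measurable[OF f]
  have w: "disc_weight s (u * z) = disc_weight s z" if "norm u = 1" for u z
    using that by (simp add: disc_weight_def norm_mult)
  have "(\<integral>\<^sup>+ z. ennreal ((norm (disc_fun f z))\<^sup>2 * disc_weight s z) \<partial>lborel)
     = (\<integral>\<^sup>+ z. (\<integral>\<^sup>+ u. ennreal ((norm (disc_fun f (u * z)))\<^sup>2 * disc_weight s (u * z)) \<partial>S1) \<partial>lborel)"
    by (rule nn_integral_rotation_average) measurable
  also have "\<dots> = (\<integral>\<^sup>+ z. (\<Sum>n. ennreal ((norm (taylor f n))\<^sup>2) * ennreal (norm z ^ (2 * n) * disc_weight s z)) \<partial>lborel)"
  proof (rule nn_integral_cong)
    fix z :: complex
    have "(\<integral>\<^sup>+ u. ennreal ((norm (disc_fun f (u * z)))\<^sup>2 * disc_weight s (u * z)) \<partial>S1)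
       = (\<integral>\<^sup>+ u. ennreal (disc_weight s z) * ennreal ((norm (disc_fun f (u * z)))\<^sup>2) \<partial>S1)"
      by (intro nn_integral_cong_AE AE_S1_I) (simp add: w mult.commute ennreal_mult)
    also have "\<dots> = ennreal (disc_weight s z) * (\<integral>\<^sup>+ u. ennreal ((norm (disc_fun f (u * z)))\<^sup>2) \<partial>S1)"
      by (rule nn_integral_cmult) measurable
    also have "\<dots> = ennreal (disc_weight s z) * (\<Sum>n. ennreal ((norm (taylor f n))\<^sup>2 * norm z ^ (2 * n)))"
    proof (cases "norm z < 1")
      case True
      show ?thesis unfolding circle_mean_square[OF f True] ..
    next
      case False
      then have "disc_weight s z = 0" by (simp add: disc_weight_def)
      then show ?thesis by simp
    qed
    also have "\<dots> = (\<Sum>n. ennreal ((norm (taylor f n))\<^sup>2) * ennreal (norm z ^ (2 * n) * disc_weight s z))"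
      unfolding ennreal_suminf_cmult[symmetric]
      by (intro suminf_cong) (simp flip: ennreal_mult add: mult_ac)
    finally show "(\<integral>\<^sup>+ u. ennreal ((norm (disc_fun f (u * z)))\<^sup>2 * disc_weight s (u * z)) \<partial>S1)
      = (\<Sum>n. ennreal ((norm (taylor f n))\<^sup>2) * ennreal (norm z ^ (2 * n) * disc_weight s z))" .
  qed
  also have "\<dots> = (\<Sum>n. \<integral>\<^sup>+ z. ennreal ((norm (taylor f n))\<^sup>2) * ennreal (norm (z :: complex) ^ (2 * n) * disc_weight s z) \<partial>lborel)"
    by (rule nn_integral_suminf) measurable
  also have "\<dots> = (\<Sum>n. ennreal ((norm (taylor f n))\<^sup>2 * disc_moment s n))"
    by (subst nn_integral_cmult) (measurable, simp add: disc_moment_nn flip: ennreal_mult)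
  finally show ?thesis .
qed

text \<open>On the annulus n/(n+2) \<le> |z|^2 \<le> (n+1)/(n+2), of area pi/(n+2), the weight is at
  least (n+2)^(-2 s), and |z|^(2 n) is at least (1 + 2/n)^(-n) \<ge> exp (-2). The constant is
  therefore pi exp (-2).\<close>

lemma disc_moment_lower:
  "\<exists>\<kappa>>0. \<forall>n. \<kappa> / real (n + 2) ^ (2 * s + 1) \<le> disc_moment s n"
proof -
  define V where "V = unit_ball_vol (real DIM(complex))"
  have V2: "unit_ball_vol 2 = V" by (simp add: V_def)
  have V: "V > 0" unfolding V_def by (rule unit_ball_vol_pos) simp
  have "V * exp (-2) / real (n + 2) ^ (2 * s + 1) \<le> disc_moment s n" for n
  proof -
    define N where "N = real n + 2"
    define r1 where "r1 = sqrt (real n / N)"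
    define r2 where "r2 = sqrt ((real n + 1) / N)"
    have N: "N > 0" by (simp add: N_def)
    have r: "r1\<^sup>2 = real n / N" "r2\<^sup>2 = (real n + 1) / N" "0 \<le> r1" "0 \<le> r2"
      using N by (auto simp: r1_def r2_def)
    have r12: "r1 \<le> r2" unfolding r1_def r2_def using N by (intro real_sqrt_le_mono divide_right_mono) auto
    have r2: "r2 < 1" unfolding r2_def using N by (simp add: N_def)
    define A where "A = cball (0 :: complex) r2 - cball 0 r1"
    have em: "emeasure lborel A = ennreal (V / N)"
    proof -
      have "emeasure lborel A = emeasure lborel (cball (0 :: complex) r2) - emeasure lborel (cball (0 :: complex) r1)"
        unfolding A_def by (rule emeasure_Diff) (use r r12 in \<open>auto simp: emeasure_cball\<close>)
      also have "\<dots> = ennreal (V * r2\<^sup>2 - V * r1\<^sup>2)"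
        using r V N by (simp add: emeasure_cball V2 ennreal_minus)
      also have "V * r2\<^sup>2 - V * r1\<^sup>2 = V / N" unfolding r by (simp add: ring_distribs add_divide_distrib)
      finally show ?thesis .
    qed
    define c where "c = exp (-2) * (1 / N) ^ (2 * s)"
    have "0 \<le> c" using N by (simp add: c_def)
    then have "ennreal (c * (V / N)) = ennreal c * emeasure lborel A"
      unfolding em using V N by (intro ennreal_mult) auto
    also have "\<dots> = (\<integral>\<^sup>+ z. ennreal c * indicator A z \<partial>lborel)"
      by (rule nn_integral_cmult_indicator[symmetric]) (simp add: A_def)
    also have "\<dots> \<le> (\<integral>\<^sup>+ z. ennreal (norm (z :: complex) ^ (2 * n) * disc_weight s z) \<partial>lborel)"
    proof (rule nn_integral_mono)
      fix z :: complex
      show "ennreal c * indicator A z \<le> ennreal (norm z ^ (2 * n) * disc_weight s z)"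
      proof (cases "z \<in> A")
        case True
        then have z: "r1 \<le> norm z" "norm z \<le> r2" by (auto simp: A_def)
        have z1: "real n / N \<le> (norm z)\<^sup>2" using power_mono[OF z(1), of 2] r by simp
        have z2: "(norm z)\<^sup>2 \<le> (real n + 1) / N" using power_mono[OF z(2), of 2] r by simp
        have "exp (-2) \<le> (real n / N) ^ n"
        proof (cases "n = 0")
          case False
          have "(N / real n) ^ n = (1 + 2 / real n) ^ n" using False by (simp add: N_def field_simps)
          also have "\<dots> \<le> exp (2 / real n) ^ n" by (intro power_mono exp_ge_add_one_self) auto
          also have "\<dots> = exp 2" using False by (simp flip: exp_of_nat_mult)
          finally have "inverse (exp 2) \<le> inverse ((N / real n) ^ n)"
            using N False by (intro le_imp_inverse_le) auto
          then show ?thesis by (simp add: exp_minus power_divide)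
        qed simp
        also have "\<dots> \<le> ((norm z)\<^sup>2) ^ n" using z1 N by (intro power_mono) auto
        finally have a: "exp (-2) \<le> norm z ^ (2 * n)" by (simp add: power_mult)
        have "1 / N = 1 - (real n + 1) / N" using N by (simp add: N_def field_simps)
        then have "1 / N \<le> 1 - (norm z)\<^sup>2" using z2 by simp
        then have b: "(1 / N) ^ (2 * s) \<le> disc_weight s z"
          using z(2) r2 N by (auto simp: disc_weight_def intro!: power_mono)
        have "c \<le> norm z ^ (2 * n) * disc_weight s z"
          unfolding c_def using a b N by (intro mult_mono) auto
        then show ?thesis using True by (simp add: ennreal_leI)
      qed simp
    qed
    also have "\<dots> = ennreal (disc_moment s n)" by (rule disc_moment_nn)
    finally have "c * (V / N) \<le> disc_moment s n" by (simp add: ennreal_le_iff)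
    also have "c * (V / N) = V * exp (-2) / real (n + 2) ^ (2 * s + 1)"
      by (simp add: c_def N_def power_divide mult_ac add.commute)
    finally show ?thesis .
  qed
  then show ?thesis using V by (intro exI[of _ "V * exp (-2)"]) auto
qed

section \<open>Taylor coefficients and the norm of a symbol\<close>

lemma taylor_eqI:
  assumes r: "r > 0" and s: "\<And>z. norm z < r \<Longrightarrow> (\<lambda>n. c n * z ^ n) sums f z"
  shows "taylor f n = c n"
proof -
  have "(\<lambda>n. fps_nth (Abs_fps c) n * z ^ n) sums f z" if "norm z < r" for z using s[OF that] by simp
  then have "f has_fps_expansion Abs_fps c"
    using r by (intro has_fps_expansionI[OF eventually_nhds_in_open[of "ball 0 r", THEN eventually_mono]]) auto
  then show ?thesis by (simp add: fps_expansion_eqI)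
qed

lemma taylor_add:
  assumes "f holomorphic_on ball 0 1" "g holomorphic_on ball 0 1"
  shows "taylor (\<lambda>z. f z + g z) n = taylor f n + taylor g n"
  by (rule taylor_eqI[of 1]) (auto simp: ring_distribs intro!: sums_add taylor_sums assms)

lemma taylor_cmult:
  assumes "f holomorphic_on ball 0 1"
  shows "taylor (\<lambda>z. c * f z) n = c * taylor f n"
  by (rule taylor_eqI[of 1]) (auto simp: mult.assoc intro!: sums_mult taylor_sums assms)

lemma taylor_cong:
  assumes "f holomorphic_on ball 0 1" "\<And>z. norm z < 1 \<Longrightarrow> f z = g z"
  shows "taylor g n = taylor f n"
  by (rule taylor_eqI[of 1]) (auto simp flip: assms(2) intro!: taylor_sums assms(1))

lemma taylor_poly: "taylor (poly p) n = coeff p n"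
proof (rule taylor_eqI[of 1])
  fix z :: complex
  show "(\<lambda>n. coeff p n * z ^ n) sums poly p z"
    unfolding poly_altdef by (rule sums_finite) (auto simp: coeff_eq_0)
qed simp

lemma taylor_sum:
  assumes "\<And>i. i \<in> I \<Longrightarrow> f i holomorphic_on ball 0 1"
  shows "taylor (\<lambda>z. \<Sum>i\<in>I. f i z) n = (\<Sum>i\<in>I. taylor (f i) n)"
  using assms
proof (induction I rule: infinite_finite_induct)
  case (insert i I)
  then show ?case by (simp add: taylor_add holomorphic_on_sum)
qed (use taylor_poly[of 0] in \<open>simp_all add: poly_0 [abs_def]\<close>)

definition deriv_factor :: "nat \<Rightarrow> nat \<Rightarrow> real" where
  "deriv_factor s n = fact (n + 2 * s + 1) / fact n"

lemma taylor_I_map: "taylor (I_map s x) n = of_real (deriv_factor s n) * taylor x (n + 2 * s + 1)"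
proof -
  have "(deriv ^^ n) (I_map s x) 0 = (deriv ^^ (n + 2 * s + 1)) x 0"
    unfolding I_map_def by (simp only: add.assoc funpow_add[of n] o_apply)
  then show ?thesis by (simp add: fps_expansion_def deriv_factor_def del: funpow.simps fact_Suc)
qed

lemma deriv_factor_ge: "real (n + 1) ^ (2 * s + 1) \<le> deriv_factor s n"
proof -
  have "fact n * (n + 1) ^ k \<le> (fact (n + k) :: nat)" for k
  proof (induction k)
    case (Suc k)
    have "fact n * (n + 1) ^ Suc k = (n + 1) * (fact n * (n + 1) ^ k)" by (simp only: power_Suc mult_ac)
    also have "\<dots> \<le> (n + k + 1) * fact (n + k)" using Suc by (intro mult_mono) auto
    finally show ?case by simp
  qed simp
  from this[of "2 * s + 1"] have "real (fact n * (n + 1) ^ (2 * s + 1)) \<le> real (fact (n + (2 * s + 1)))"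
    by (rule of_nat_mono)
  then show ?thesis by (simp add: deriv_factor_def field_simps add.assoc del: fact_Suc power_Suc)
qed

lemma HL2_iff:
  "f \<in> HL2 (Suc s) \<longleftrightarrow> f holomorphic_on ball 0 1 \<and> summable (\<lambda>n. (norm (taylor f n))\<^sup>2 * disc_moment s n)"
  and HL2_norm_sums: "f \<in> HL2 (Suc s) \<Longrightarrow> (\<lambda>n. (norm (taylor f n))\<^sup>2 * disc_moment s n) sums (HL2_norm (Suc s) f)\<^sup>2"
proof -
  let ?h = "\<lambda>z. (norm (disc_fun f z))\<^sup>2 * disc_weight s z"
  let ?c = "\<lambda>n. (norm (taylor f n))\<^sup>2 * disc_moment s n"
  have eq: "(\<lambda>z. indicator (ball 0 1) z *\<^sub>R ((norm (f z))\<^sup>2 * (1 - (norm z)\<^sup>2) ^ (2 * Suc s - 2))) = ?h"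
    by (auto simp: fun_eq_iff disc_fun_def disc_weight_def)
  have iff: "integrable lborel ?h \<longleftrightarrow> summable ?c" and int: "summable ?c \<Longrightarrow> integral\<^sup>L lborel ?h = suminf ?c"
    if f: "f holomorphic_on ball 0 1"
  proof -
    note [measurable] = disc_fun_measurable[OF f]
    have "integrable lborel ?h \<longleftrightarrow> (\<Sum>n. ennreal (?c n)) < \<infinity>"
      by (simp add: integrable_iff_bounded disc_nn_integral[OF f])
    also have "\<dots> \<longleftrightarrow> summable ?c"
    proof
      assume "(\<Sum>n. ennreal (?c n)) < \<infinity>"
      then show "summable ?c" by (intro summable_suminf_not_top) auto
    next
      assume "summable ?c"
      then show "(\<Sum>n. ennreal (?c n)) < \<infinity>" by (subst suminf_ennreal2) auto
    qed
    finally show "integrable lborel ?h \<longleftrightarrow> summable ?c" .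
    assume s: "summable ?c"
    have "integral\<^sup>L lborel ?h = enn2real (\<integral>\<^sup>+ z. ennreal (?h z) \<partial>lborel)"
      by (rule integral_eq_nn_integral) auto
    also have "\<dots> = enn2real (ennreal (suminf ?c))"
      unfolding disc_nn_integral[OF f] by (subst suminf_ennreal2) (use s in auto)
    also have "\<dots> = suminf ?c" using s by (intro enn2real_ennreal suminf_nonneg) auto
    finally show "integral\<^sup>L lborel ?h = suminf ?c" .
  qed
  show "f \<in> HL2 (Suc s) \<longleftrightarrow> f holomorphic_on ball 0 1 \<and> summable ?c"
    unfolding HL2_def set_integrable_def mem_Collect_eq eq using iff by blast
  assume "f \<in> HL2 (Suc s)"
  then have f: "f holomorphic_on ball 0 1" and "integrable lborel ?h"
    unfolding HL2_def set_integrable_def mem_Collect_eq eq by blast+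
  then have s: "summable ?c" using iff by blast
  have "(HL2_norm (Suc s) f)\<^sup>2 = integral\<^sup>L lborel ?h"
    unfolding HL2_norm_def set_lebesgue_integral_def eq
    by (rule real_sqrt_pow2) (auto intro: integral_nonneg_AE)
  then show "?c sums (HL2_norm (Suc s) f)\<^sup>2" using int[OF f s] s by (simp add: sums_iff)
qed

text \<open>The weight with which the Taylor coefficient of index n + 2 s + 1 enters the squared
  norm; lower coefficients are killed by the 2 s + 1 derivatives.\<close>

definition Hneg_weight :: "nat \<Rightarrow> nat \<Rightarrow> real" where
  "Hneg_weight s n = (deriv_factor s n)\<^sup>2 * disc_moment s n"

lemma taylor_I_map_weight:
  "(norm (taylor (I_map s x) n))\<^sup>2 * disc_moment s n = (norm (taylor x (n + 2 * s + 1)))\<^sup>2 * Hneg_weight s n"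
  by (simp add: taylor_I_map norm_mult power_mult_distrib Hneg_weight_def)

lemma Hneg_weight_nonneg [simp]: "0 \<le> Hneg_weight s n"
  by (simp add: Hneg_weight_def)

lemma Hneg_holomorphic: "x \<in> Hneg s \<Longrightarrow> x holomorphic_on ball 0 1"
  by (simp add: Hneg_def)

lemma I_map_holomorphic: "x holomorphic_on S \<Longrightarrow> open S \<Longrightarrow> I_map s x holomorphic_on S"
  unfolding I_map_def by (rule holomorphic_higher_deriv)

lemma Hneg_iff: "x \<in> Hneg s \<longleftrightarrow> x holomorphic_on ball 0 1 \<and>
    summable (\<lambda>n. (norm (taylor x (n + 2 * s + 1)))\<^sup>2 * Hneg_weight s n)"
  by (auto simp: Hneg_def HL2_iff taylor_I_map_weight intro: I_map_holomorphic)

lemma Hneg_norm_sums: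
  "x \<in> Hneg s \<Longrightarrow> (\<lambda>n. (norm (taylor x (n + 2 * s + 1)))\<^sup>2 * Hneg_weight s n) sums (Hneg_norm s x)\<^sup>2"
  using HL2_norm_sums[of "I_map s x" s] by (simp add: Hneg_def Hneg_norm_def taylor_I_map_weight)

lemma Hneg_norm_nonneg: "0 \<le> Hneg_norm s x"
  unfolding Hneg_norm_def HL2_norm_def set_lebesgue_integral_def
  by (intro real_sqrt_ge_zero integral_nonneg_AE AE_I2)
     (auto simp: indicator_def intro!: mult_nonneg_nonneg zero_le_power power_le_one)

text \<open>The squared derivative factor contributes (n+1)^(4 s + 2) and the moment costs (n+2)^(2
  s + 1), where n + 2 \<le> 2 (n + 1).\<close>

lemma Hneg_weight_lower:
  "\<exists>\<kappa>>0. \<forall>n. \<kappa> * real (n + 1) ^ (2 * s + 1) \<le> Hneg_weight s n"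
proof -
  obtain \<kappa> where \<kappa>: "\<kappa> > 0" and le: "\<kappa> / real (n + 2) ^ (2 * s + 1) \<le> disc_moment s n" for n
    using disc_moment_lower[of s] by blast
  let ?d = "2 * s + 1"
  have "\<kappa> / 2 ^ ?d * real (n + 1) ^ ?d \<le> Hneg_weight s n" for n
  proof -
    have "\<kappa> / (2 * real (n + 1)) ^ ?d \<le> \<kappa> / real (n + 2) ^ ?d"
      using \<kappa> by (intro divide_left_mono power_mono) auto
    also note le
    finally have m: "\<kappa> / (2 * real (n + 1)) ^ ?d \<le> disc_moment s n" .
    have "(real (n + 1) ^ ?d)\<^sup>2 * (\<kappa> / (2 * real (n + 1)) ^ ?d) \<le> (deriv_factor s n)\<^sup>2 * disc_moment s n"
      using \<kappa> deriv_factor_ge[of n s] m by (intro mult_mono power_mono) auto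
    also have "(real (n + 1) ^ ?d)\<^sup>2 * (\<kappa> / (2 * real (n + 1)) ^ ?d) = \<kappa> / 2 ^ ?d * real (n + 1) ^ ?d"
      by (simp only: power_mult_distrib power2_eq_square) (simp add: field_simps del: power_Suc)
    finally show ?thesis by (simp add: Hneg_weight_def)
  qed
  then show ?thesis using \<kappa> by (intro exI[of _ "\<kappa> / 2 ^ ?d"]) auto
qed

text \<open>The derivative of order 2 s + 1 is bounded on the closed disc, and the weight is at most
  1.\<close>

lemma Hneg_holomorphic_closed:
  assumes x: "x holomorphic_on S" and S: "open S" "cball 0 1 \<subseteq> S"
  shows "x \<in> Hneg s"
proof -
  let ?f = "I_map s x"
  have f: "?f holomorphic_on S" by (rule I_map_holomorphic[OF x S(1)])
  have "compact (?f ` cball 0 1)"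
    by (intro compact_continuous_image holomorphic_on_imp_continuous_on holomorphic_on_subset[OF f S(2)]) auto
  then have "bounded (?f ` cball 0 1)" by (rule compact_imp_bounded)
  then obtain C where C': "\<forall>y\<in>?f ` cball 0 1. norm y \<le> C" unfolding bounded_iff by blast
  then have C: "norm (?f z) \<le> C" if "norm z \<le> 1" for z using that by simp
  have ball: "ball 0 1 \<subseteq> S" using S(2) ball_subset_cball by blast
  have fb: "?f holomorphic_on ball 0 1" by (rule holomorphic_on_subset[OF f ball])
  note [measurable] = disc_fun_measurable[OF fb]
  have "integrable lborel (\<lambda>z. (norm (disc_fun ?f z))\<^sup>2 * disc_weight s z)"
  proof (rule Bochner_Integration.integrable_bound)
    show "integrable lborel (\<lambda>z. C\<^sup>2 * indicator (ball 0 1) (z :: complex) :: real)"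
      by (intro integrable_mult_right integrable_real_indicator)
         (use emeasure_bounded_finite[OF bounded_ball[of "0 :: complex" 1]] in auto)
    have "norm ((norm (disc_fun ?f z))\<^sup>2 * disc_weight s z) \<le> norm (C\<^sup>2 * indicator (ball 0 1) z :: real)" for z
    proof (cases "norm z < 1")
      case True
      have "(norm (?f z))\<^sup>2 * disc_weight s z \<le> C\<^sup>2 * 1"
        using C[of z] True disc_weight_le_1 by (intro mult_mono power_mono) auto
      then show ?thesis using True by (simp add: disc_fun_def)
    qed (simp add: disc_weight_def)
    then show "AE z in lborel. norm ((norm (disc_fun ?f z))\<^sup>2 * disc_weight s z) \<le> norm (C\<^sup>2 * indicator (ball 0 1) z :: real)"
      by simp
  qed measurable
  also have "(\<lambda>z. (norm (disc_fun ?f z))\<^sup>2 * disc_weight s z)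
      = (\<lambda>z. indicator (ball 0 1) z *\<^sub>R ((norm (?f z))\<^sup>2 * (1 - (norm z)\<^sup>2) ^ (2 * (s + 1) - 2)))"
    by (auto simp: fun_eq_iff disc_fun_def disc_weight_def)
  finally show ?thesis
    unfolding Hneg_def HL2_def set_integrable_def using fb holomorphic_on_subset[OF x ball] by simp
qed

lemma Hneg_power: "(\<lambda>z. z ^ m) \<in> Hneg s"
  by (rule Hneg_holomorphic_closed[of _ UNIV]) (auto intro!: holomorphic_intros)

lemma Hneg_add: "x \<in> Hneg s \<Longrightarrow> y \<in> Hneg s \<Longrightarrow> (\<lambda>z. x z + y z) \<in> Hneg s"
proof -
  assume x: "x \<in> Hneg s" and y: "y \<in> Hneg s"
  note hx = Hneg_holomorphic[OF x] and hy = Hneg_holomorphic[OF y]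
  have "summable (\<lambda>n. (norm (taylor x (n + 2 * s + 1) + taylor y (n + 2 * s + 1)))\<^sup>2 * Hneg_weight s n)"
  proof (rule summable_comparison_test')
    show "summable (\<lambda>n. 2 * ((norm (taylor x (n + 2 * s + 1)))\<^sup>2 * Hneg_weight s n)
        + 2 * ((norm (taylor y (n + 2 * s + 1)))\<^sup>2 * Hneg_weight s n))"
      using x y by (intro summable_add summable_mult) (auto simp: Hneg_iff)
    fix n
    let ?u = "taylor x (n + 2 * s + 1)" and ?v = "taylor y (n + 2 * s + 1)"
    have "(norm (?u + ?v))\<^sup>2 \<le> (norm ?u + norm ?v)\<^sup>2"
      by (intro power_mono norm_triangle_ineq) auto
    also have "\<dots> \<le> 2 * (norm ?u)\<^sup>2 + 2 * (norm ?v)\<^sup>2"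
      using zero_le_power2[of "norm ?u - norm ?v"] by (simp add: power2_eq_square algebra_simps)
    finally have "(norm (?u + ?v))\<^sup>2 * Hneg_weight s n \<le> (2 * (norm ?u)\<^sup>2 + 2 * (norm ?v)\<^sup>2) * Hneg_weight s n"
      by (intro mult_right_mono) auto
    then show "norm ((norm (?u + ?v))\<^sup>2 * Hneg_weight s n) \<le> 2 * ((norm ?u)\<^sup>2 * Hneg_weight s n) + 2 * ((norm ?v)\<^sup>2 * Hneg_weight s n)"
      by (simp add: algebra_simps)
  qed
  then show ?thesis using hx hy by (simp add: Hneg_iff taylor_add holomorphic_on_add)
qed

lemma Hneg_cmult: "x \<in> Hneg s \<Longrightarrow> (\<lambda>z. c * x z) \<in> Hneg s"
  by (auto simp: Hneg_iff taylor_cmult norm_mult power_mult_distrib mult.assoc intro!: holomorphic_intros summable_mult)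

lemma Hneg_class_eq_taylor:
  assumes "x holomorphic_on ball 0 1" "y holomorphic_on ball 0 1" "Hneg_class_eq s x y" "2 * s < m"
  shows "taylor x m = taylor y m"
proof -
  obtain p where p: "degree p \<le> 2 * s" "\<And>z. z \<in> ball 0 1 \<Longrightarrow> x z - y z = poly p z"
    using assms(3) by (auto simp: Hneg_class_eq_def)
  have "taylor x m = taylor (\<lambda>z. y z + poly p z) m"
    by (rule taylor_cong) (use p(2) assms(2) in \<open>auto simp: algebra_simps intro!: holomorphic_intros\<close>)
  also have "\<dots> = taylor y m + coeff p m"
    by (simp add: taylor_add[OF assms(2)] holomorphic_intros taylor_poly)
  also have "coeff p m = 0" using p(1) assms(4) by (intro coeff_eq_0) simp
  finally show ?thesis by simp
qed

lemma Hneg_class_eq_in_Hneg: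
  assumes "x holomorphic_on ball 0 1" "y \<in> Hneg s" "Hneg_class_eq s x y"
  shows "x \<in> Hneg s"
  using assms Hneg_class_eq_taylor[OF assms(1) Hneg_holomorphic[OF assms(2)] assms(3)]
  by (simp add: Hneg_iff)

section \<open>Hilbert-Schmidt bound for the matrix of a symbol\<close>

lemma hankel_matrix_class_eq:
  assumes "x holomorphic_on ball 0 1" "y holomorphic_on ball 0 1" "Hneg_class_eq s x y"
  shows "hankel_matrix s x = hankel_matrix s y"
proof (intro ext)
  fix k n
  show "hankel_matrix s x k n = hankel_matrix s y k n"
    using Hneg_class_eq_taylor[OF assms, of "k + n + s + 1"] hankel_weight_zero[of k n s]
    by (cases "k + n < s") (auto simp: hankel_matrix_def)
qed

lemma hankel_matrix_add:
  "x holomorphic_on ball 0 1 \<Longrightarrow> y holomorphic_on ball 0 1 \<Longrightarrow>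
    hankel_matrix s (\<lambda>z. x z + y z) k n = hankel_matrix s x k n + hankel_matrix s y k n"
  by (simp add: hankel_matrix_def taylor_add ring_distribs)

lemma hankel_matrix_cmult:
  "x holomorphic_on ball 0 1 \<Longrightarrow> hankel_matrix s (\<lambda>z. c * x z) k n = c * hankel_matrix s x k n"
  by (simp add: hankel_matrix_def taylor_cmult)

text \<open>The antidiagonal k + n = m contains m + 1 points.\<close>

lemma sum_rectangle_le_diagonal:
  fixes g :: "nat \<Rightarrow> real"
  assumes "\<And>m. 0 \<le> g m"
  shows "(\<Sum>k<K. \<Sum>n<N. g (k + n)) \<le> (\<Sum>m<K + N. real (m + 1) * g m)"
proof -
  have "(\<Sum>k<K. \<Sum>n<N. g (k + n)) = (\<Sum>(k, n)\<in>{..<K} \<times> {..<N}. g (k + n))"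
    by (simp add: sum.cartesian_product)
  also have "\<dots> \<le> (\<Sum>(k, n)\<in>{(k, n). k + n < K + N}. g (k + n))"
  proof (rule sum_mono2)
    have "{(k, n). k + n < K + N} \<subseteq> {..<K + N} \<times> {..<K + N}" by auto
    then show "finite {(k, n). k + n < K + N}" by (rule finite_subset) simp
  qed (use assms in auto)
  also have "\<dots> = (\<Sum>m<K + N. \<Sum>i\<le>m. g (i + (m - i)))"
    by (rule sum.triangle_reindex)
  also have "\<dots> = (\<Sum>m<K + N. real (m + 1) * g m)" by (intro sum.cong) auto
  finally show ?thesis .
qed

lemma sum_shift_zero:
  fixes g :: "nat \<Rightarrow> real"
  assumes "\<And>m. m < s \<Longrightarrow> g m = 0" "\<And>m. 0 \<le> g m"
  shows "(\<Sum>m<L. g m) \<le> (\<Sum>n<L. g (n + s))"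
proof -
  have "(\<Sum>m<L. g m) \<le> (\<Sum>m<s + L. g m)" by (rule sum_mono2) (use assms in auto)
  also have "\<dots> = (\<Sum>m<s. g m) + (\<Sum>n<L. g (n + s))"
    by (induction L) (auto simp: add_ac)
  finally show ?thesis using assms(1) by simp
qed

text \<open>Up to a constant, a squared entry with k + n = m is at most |x_(m+s+1)|^2 (m+s+1)^(2 s),
  and there are m + 1 such entries. With m = n + s the total is of order |x_(n+2s+1)|^2 (n+1)^(2 s +
  1), matching the lower bound for the weight of the norm. The factor (2 s + 1)^(2 s + 1) in the
  constant comes from n + 2 s + 1 \<le> (2 s + 1) (n + 1).\<close>

lemma hankel_matrix_hs_bound:
  "\<exists>C\<ge>0. \<forall>x\<in>Hneg s. hs_bound (hankel_matrix s x) (C * (Hneg_norm s x)\<^sup>2)"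
proof -
  obtain \<kappa> where \<kappa>: "\<kappa> > 0" and lower: "\<kappa> * real (n + 1) ^ (2 * s + 1) \<le> Hneg_weight s n" for n
    using Hneg_weight_lower[of s] by blast
  define A where "A = (\<Sum>j\<le>s. real ((s + j) choose j))"
  define C where "C = A\<^sup>2 * real (2 * s + 1) ^ (2 * s + 1) / \<kappa>"
  have C: "C \<ge> 0" using \<kappa> by (auto simp: C_def)
  have "hs_bound (hankel_matrix s x) (C * (Hneg_norm s x)\<^sup>2)" if x: "x \<in> Hneg s" for x
    unfolding hs_bound_def
  proof (intro allI)
    fix K N
    define g where "g m = (if m < s then 0 else (norm (taylor x (m + s + 1)))\<^sup>2 * (A * real (m + s + 1) ^ s)\<^sup>2)" for m
    have g0: "0 \<le> g m" for m by (simp add: g_def)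
    have "(norm (hankel_matrix s x k n))\<^sup>2 \<le> g (k + n)" for k n
    proof (cases "k + n < s")
      case False
      have "\<bar>hankel_weight s k n\<bar>\<^sup>2 \<le> (A * real (k + n + s + 1) ^ s)\<^sup>2"
        using hankel_weight_bound[of s k n] unfolding A_def by (intro power_mono) auto
      then show ?thesis using False
        by (simp add: hankel_matrix_def g_def norm_mult power_mult_distrib mult_left_mono)
    qed (simp add: hankel_matrix_def hankel_weight_zero g_def)
    then have "(\<Sum>k<K. \<Sum>n<N. (norm (hankel_matrix s x k n))\<^sup>2) \<le> (\<Sum>k<K. \<Sum>n<N. g (k + n))"
      by (intro sum_mono)
    also have "\<dots> \<le> (\<Sum>m<K + N. real (m + 1) * g m)"
      by (rule sum_rectangle_le_diagonal[OF g0])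
    also have "\<dots> \<le> (\<Sum>n<K + N. real (n + s + 1) * g (n + s))"
      by (rule sum_shift_zero) (auto simp: g_def)
    also have "\<dots> \<le> (\<Sum>n<K + N. C * ((norm (taylor x (n + 2 * s + 1)))\<^sup>2 * Hneg_weight s n))"
    proof (rule sum_mono)
      fix n
      have b: "real (n + 2 * s + 1) \<le> real (2 * s + 1) * real (n + 1)"
        unfolding of_nat_mult[symmetric] by (intro of_nat_mono) simp
      have "real (n + s + 1) * (A * real (n + 2 * s + 1) ^ s)\<^sup>2 \<le> A\<^sup>2 * real (n + 2 * s + 1) ^ (2 * s + 1)"
      proof -
        have "real (n + s + 1) * (A * real (n + 2 * s + 1) ^ s)\<^sup>2 \<le> real (n + 2 * s + 1) * (A * real (n + 2 * s + 1) ^ s)\<^sup>2"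
          by (intro mult_right_mono) auto
        also have "\<dots> = A\<^sup>2 * real (n + 2 * s + 1) ^ (2 * s + 1)"
          by (simp add: power_mult_distrib power_mult[symmetric] mult.commute[of s])
        finally show ?thesis .
      qed
      also have "\<dots> \<le> A\<^sup>2 * (real (2 * s + 1) * real (n + 1)) ^ (2 * s + 1)"
        using b by (intro mult_left_mono power_mono) auto
      also have "\<dots> = C * (\<kappa> * real (n + 1) ^ (2 * s + 1))"
        using \<kappa> by (simp only: C_def power_mult_distrib) (simp add: field_simps del: power_Suc)
      also have "\<dots> \<le> C * Hneg_weight s n" by (intro mult_left_mono lower C)
      finally have "(norm (taylor x (n + 2 * s + 1)))\<^sup>2 * (real (n + s + 1) * (A * real (n + 2 * s + 1) ^ s)\<^sup>2)
          \<le> (norm (taylor x (n + 2 * s + 1)))\<^sup>2 * (C * Hneg_weight s n)"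
        by (intro mult_left_mono) auto
      moreover have "g (n + s) = (norm (taylor x (n + 2 * s + 1)))\<^sup>2 * (A * real (n + 2 * s + 1) ^ s)\<^sup>2"
      proof -
        have idx: "n + s + s + 1 = n + 2 * s + 1" by simp
        show ?thesis unfolding g_def idx by simp
      qed
      ultimately show "real (n + s + 1) * g (n + s) \<le> C * ((norm (taylor x (n + 2 * s + 1)))\<^sup>2 * Hneg_weight s n)"
        by (simp only: mult.left_commute[of "real (n + s + 1)"] mult.left_commute[of C])
    qed
    also have "\<dots> = C * (\<Sum>n<K + N. (norm (taylor x (n + 2 * s + 1)))\<^sup>2 * Hneg_weight s n)"
      by (simp add: sum_distrib_left)
    also have "\<dots> \<le> C * (Hneg_norm s x)\<^sup>2"
    proof (intro mult_left_mono C)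
      have "(\<Sum>n<K + N. (norm (taylor x (n + 2 * s + 1)))\<^sup>2 * Hneg_weight s n)
         \<le> (\<Sum>n. (norm (taylor x (n + 2 * s + 1)))\<^sup>2 * Hneg_weight s n)"
        using Hneg_norm_sums[OF x] by (intro sum_le_suminf) (auto simp: sums_iff)
      then show "(\<Sum>n<K + N. (norm (taylor x (n + 2 * s + 1)))\<^sup>2 * Hneg_weight s n) \<le> (Hneg_norm s x)\<^sup>2"
        using Hneg_norm_sums[OF x] by (simp add: sums_iff)
    qed
    finally show "(\<Sum>k<K. \<Sum>n<N. (norm (hankel_matrix s x k n))\<^sup>2) \<le> C * (Hneg_norm s x)\<^sup>2" .
  qed
  with C show ?thesis by blast
qed

section \<open>Continuous functionals of the symbol and the orbit symbols\<close>

lemma Hneg_truncation: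
  assumes x: "x \<in> Hneg s"
  defines "t N z \<equiv> \<Sum>m<N. taylor x m * z ^ m"
  shows "t N \<in> Hneg s" "(\<lambda>z. x z - t N z) \<in> Hneg s"
    "(\<lambda>N. Hneg_norm s (\<lambda>z. x z - t N z)) \<longlonglongrightarrow> 0"
proof -
  note hx = Hneg_holomorphic[OF x]
  have t: "t N \<in> Hneg s" for N
    unfolding t_def by (rule Hneg_holomorphic_closed[of _ UNIV]) (auto intro!: holomorphic_intros)
  then show "t N \<in> Hneg s" .
  have d: "(\<lambda>z. x z - t N z) \<in> Hneg s" for N
    using Hneg_add[OF x Hneg_cmult[OF t[of N], of "-1"]] by simp
  then show "(\<lambda>z. x z - t N z) \<in> Hneg s" .
  have tay: "taylor (\<lambda>z. x z - t N z) m = (if m < N then 0 else taylor x m)" for N m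
  proof (rule taylor_eqI[of 1])
    fix z :: complex assume z: "norm z < 1"
    have "(\<lambda>m. if m \<in> {..<N} then taylor x m * z ^ m else 0) sums t N z"
      unfolding t_def by (rule sums_If_finite_set) simp
    from sums_diff[OF taylor_sums[OF hx z] this]
    have "(\<lambda>m. taylor x m * z ^ m - (if m < N then taylor x m * z ^ m else 0)) sums (x z - t N z)" by simp
    also have "(\<lambda>m. taylor x m * z ^ m - (if m < N then taylor x m * z ^ m else 0))
        = (\<lambda>m. (if m < N then 0 else taylor x m) * z ^ m)" by auto
    finally show "(\<lambda>m. (if m < N then 0 else taylor x m) * z ^ m) sums (x z - t N z)" .
  qed simp
  define q where "q n = (norm (taylor x (n + 2 * s + 1)))\<^sup>2 * Hneg_weight s n" for n
  have q: "summable q" using x by (simp add: Hneg_iff q_def [abs_def])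
  have q0: "0 \<le> q n" for n by (simp add: q_def)
  \<comment> \<open>The norm starts at the Taylor index 2 s + 1, so truncation at N + (2 s + 1)
    leaves exactly the tail of \<open>q\<close> from N on.\<close>
  have "(\<lambda>N. Hneg_norm s (\<lambda>z. x z - t (N + (2 * s + 1)) z)) \<longlonglongrightarrow> 0"
  proof (rule Lim_null_comparison[OF always_eventually, OF allI])
    fix N
    have "(\<lambda>n. if n < N then 0 else q n) sums (Hneg_norm s (\<lambda>z. x z - t (N + (2 * s + 1)) z))\<^sup>2"
      using Hneg_norm_sums[OF d[of "N + (2 * s + 1)"]] unfolding tay q_def
      by (rule sums_cong[THEN iffD1, rotated]) auto
    then have "(\<lambda>n. if n + N < N then 0 else q (n + N)) sums ((Hneg_norm s (\<lambda>z. x z - t (N + (2 * s + 1)) z))\<^sup>2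
        - (\<Sum>n<N. if n < N then 0 else q n))"
      by (rule sums_split_initial_segment)
    then have "(\<lambda>n. q (n + N)) sums ((Hneg_norm s (\<lambda>z. x z - t (N + (2 * s + 1)) z))\<^sup>2)" by simp
    then have "(Hneg_norm s (\<lambda>z. x z - t (N + (2 * s + 1)) z))\<^sup>2 = (\<Sum>n. q (n + N))" by (simp add: sums_iff)
    then show "norm (Hneg_norm s (\<lambda>z. x z - t (N + (2 * s + 1)) z)) \<le> sqrt (\<Sum>n. q (n + N))"
      using Hneg_norm_nonneg by (simp add: real_le_rsqrt)
  next
    show "(\<lambda>N. sqrt (\<Sum>n. q (n + N))) \<longlonglongrightarrow> 0"
      using tendsto_real_sqrt[OF suminf_exist_split2[OF q]] by simp
  qed
  then show "(\<lambda>N. Hneg_norm s (\<lambda>z. x z - t N z)) \<longlonglongrightarrow> 0" by (rule LIMSEQ_offset)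
qed

text \<open>Taylor polynomials converge in the transported norm, so a bounded linear functional is a
  series in its values on monomials. This lets the orbit symbols, whose coefficients are powers of
  \<beta>, act as generating functions.\<close>

lemma Hneg_functional_sums:
  assumes x: "x \<in> Hneg s"
    and add: "\<And>x y. x \<in> Hneg s \<Longrightarrow> y \<in> Hneg s \<Longrightarrow> \<phi> (\<lambda>z. x z + y z) = \<phi> x + \<phi> y"
    and cmult: "\<And>c x. x \<in> Hneg s \<Longrightarrow> \<phi> (\<lambda>z. c * x z) = c * \<phi> x"
    and bound: "\<And>x. x \<in> Hneg s \<Longrightarrow> norm (\<phi> x :: complex) \<le> C * Hneg_norm s x"
  shows "(\<lambda>m. taylor x m * \<phi> (\<lambda>z. z ^ m)) sums \<phi> x"
proof -
  define t where "t N z = (\<Sum>m<N. taylor x m * z ^ m)" for N z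
  note tr = Hneg_truncation[OF x, folded t_def]
  have t: "\<phi> (t N) = (\<Sum>m<N. taylor x m * \<phi> (\<lambda>z. z ^ m))" for N
  proof (induction N)
    case 0
    have "\<phi> (\<lambda>z. 0) = 0" using cmult[OF Hneg_power[of 0], of 0] by simp
    then show ?case by (simp add: t_def [abs_def])
  next
    case (Suc N)
    have "\<phi> (\<lambda>z. t N z + taylor x N * z ^ N) = \<phi> (t N) + \<phi> (\<lambda>z. taylor x N * z ^ N)"
      by (intro add tr Hneg_cmult Hneg_power)
    then show ?case using Suc cmult[OF Hneg_power] by (simp add: t_def [abs_def])
  qed
  have "\<phi> x - \<phi> (t N) = \<phi> (\<lambda>z. x z - t N z)" for N
    using add[OF tr(1,2), of N N] by simp
  then have "norm (\<phi> x - \<phi> (t N)) \<le> C * Hneg_norm s (\<lambda>z. x z - t N z)" for N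
    using bound[OF tr(2), of N] by simp
  from Lim_null_comparison[OF always_eventually, OF allI, OF this tendsto_mult_right_zero[OF tr(3)]]
  have "(\<lambda>N. \<phi> x - \<phi> (t N)) \<longlonglongrightarrow> 0" .
  from tendsto_diff[OF tendsto_const[of "\<phi> x"] this] show ?thesis by (simp add: sums_def t)
qed

text \<open>The symbols y_\<beta> of the overview; from index 2 s + 1 on their Taylor coefficients
  are 1, \<beta>, \<beta>^2 and so on.\<close>

definition geo :: "nat \<Rightarrow> complex \<Rightarrow> complex \<Rightarrow> complex" where
  "geo s \<beta> z = z ^ (2 * s + 1) * inverse (1 - \<beta> * z)"

lemma geo_0: "geo s 0 = (\<lambda>z. z ^ (2 * s + 1))"
  by (simp add: geo_def fun_eq_iff)

lemma one_minus_mult_nz: "norm \<beta> < 1 \<Longrightarrow> norm z \<le> 1 \<Longrightarrow> 1 - \<beta> * z \<noteq> (0 :: complex)"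
proof
  assume "norm \<beta> < 1" "norm z \<le> 1" "1 - \<beta> * z = 0"
  then have "norm (\<beta> * z) = 1" by (metis eq_iff_diff_eq_0 norm_one)
  moreover have "norm (\<beta> * z) < 1"
    using \<open>norm \<beta> < 1\<close> \<open>norm z \<le> 1\<close> by (metis mult_left_le norm_ge_zero norm_mult order_le_less_trans)
  ultimately show False by simp
qed

lemma geo_Hneg:
  assumes "norm \<beta> < 1"
  shows "geo s \<beta> \<in> Hneg s"
proof (rule Hneg_holomorphic_closed)
  show "geo s \<beta> holomorphic_on {z. 1 - \<beta> * z \<noteq> 0}"
    unfolding geo_def [abs_def] by (intro holomorphic_intros) auto
  show "open {z. 1 - \<beta> * z \<noteq> 0}" by (intro open_Collect_neq continuous_intros)
  show "cball 0 1 \<subseteq> {z. 1 - \<beta> * z \<noteq> 0}" using one_minus_mult_nz[OF assms] by auto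
qed

lemma taylor_geo:
  assumes "norm \<beta> < 1"
  shows "taylor (geo s \<beta>) m = (if 2 * s + 1 \<le> m then \<beta> ^ (m - (2 * s + 1)) else 0)"
proof (rule taylor_eqI[of 1])
  fix z :: complex assume z: "norm z < 1"
  have "norm (\<beta> * z) < 1"
    using assms z by (metis mult_left_le norm_ge_zero norm_mult order_le_less_trans less_imp_le)
  from sums_mult[OF geometric_sums[OF this], of "z ^ (2 * s + 1)"]
  have "(\<lambda>n. z ^ (2 * s + 1) * (\<beta> * z) ^ n) sums geo s \<beta> z"
    by (simp add: geo_def inverse_eq_divide)
  also have "(\<lambda>n. z ^ (2 * s + 1) * (\<beta> * z) ^ n) = (\<lambda>n. (if 2 * s + 1 \<le> n + (2 * s + 1) then \<beta> ^ (n + (2 * s + 1) - (2 * s + 1)) else 0) * z ^ (n + (2 * s + 1)))"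
    by (simp add: fun_eq_iff power_mult_distrib power_add)
  finally show "(\<lambda>m. (if 2 * s + 1 \<le> m then \<beta> ^ (m - (2 * s + 1)) else 0) * z ^ m) sums geo s \<beta> z"
    by (subst sums_zero_iff_shift[of "2 * s + 1", symmetric]) auto
qed simp

text \<open>The functions \<open>geo s \<beta>\<close> are, up to polynomials of degree at most \<open>2 s\<close> and scalars, the
  orbit of \<open>z ^ (2 s + 1)\<close>.\<close>

lemma geo_total:
  fixes \<phi> :: "(complex \<Rightarrow> complex) \<Rightarrow> complex"
  assumes sums: "\<And>x. x \<in> Hneg s \<Longrightarrow> (\<lambda>m. taylor x m * \<phi> (\<lambda>z. z ^ m)) sums \<phi> x"
    and geo: "\<And>\<beta>. norm \<beta> < 1 \<Longrightarrow> \<phi> (geo s \<beta>) = 0"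
    and low: "\<And>m. m \<le> 2 * s \<Longrightarrow> \<phi> (\<lambda>z. z ^ m) = 0"
    and x: "x \<in> Hneg s"
  shows "\<phi> x = 0"
proof -
  have "\<phi> (\<lambda>z. z ^ (n + (2 * s + 1))) = 0" for n
  proof -
    \<comment> \<open>As a function of \<beta>, the value at \<open>geo s \<beta>\<close> is a power
      series with the values on monomials as coefficients. It vanishes on the disc, and its
      coefficients are compared with those of the zero polynomial.\<close>
    have "(\<lambda>n. \<phi> (\<lambda>z. z ^ (n + (2 * s + 1))) * \<beta> ^ n) sums poly 0 \<beta>" if \<beta>: "norm \<beta> < 1" for \<beta>
    proof -
      have "(\<lambda>m. (if 2 * s + 1 \<le> m then \<beta> ^ (m - (2 * s + 1)) else 0) * \<phi> (\<lambda>z. z ^ m)) sums 0"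
        using sums[OF geo_Hneg[OF \<beta>]] by (simp only: taylor_geo[OF \<beta>] geo[OF \<beta>])
      then have "(\<lambda>n. (if 2 * s + 1 \<le> n + (2 * s + 1) then \<beta> ^ (n + (2 * s + 1) - (2 * s + 1)) else 0) * \<phi> (\<lambda>z. z ^ (n + (2 * s + 1)))) sums 0"
        by (subst sums_zero_iff_shift) auto
      then show ?thesis by (simp add: mult.commute)
    qed
    then have "taylor (poly 0) n = \<phi> (\<lambda>z. z ^ (n + (2 * s + 1)))"
      by (rule taylor_eqI[where c="\<lambda>n. \<phi> (\<lambda>z. z ^ (n + (2 * s + 1)))", OF zero_less_one])
    then show ?thesis unfolding taylor_poly coeff_0 ..
  qed
  then have high: "\<phi> (\<lambda>z. z ^ (m - (2 * s + 1) + (2 * s + 1))) = 0" for m .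
  have "\<phi> (\<lambda>z. z ^ m) = 0" for m
  proof (cases "m \<le> 2 * s")
    case False
    then have "m - (2 * s + 1) + (2 * s + 1) = m" by simp
    with high[of m] show ?thesis by (simp only:)
  qed (rule low)
  with sums[OF x] show ?thesis by (simp add: sums_iff)
qed

section \<open>Kernels of the orbit of the lowest weight symbol\<close>

lemma negative_binomial_sums:
  fixes t :: complex
  assumes "norm t < 1"
  shows "(\<lambda>q. of_nat ((q + s) choose s) * t ^ q) sums inverse (1 - t) ^ (s + 1)"
proof -
  have t: "1 - t \<noteq> 0" using assms by auto
  have c: "(- of_nat (s + 1) gchoose q) * (- t) ^ q = of_nat ((q + s) choose s) * t ^ q" for q
  proof -
    have "(- of_nat (s + 1) :: complex) gchoose q = (-1) ^ q * (of_nat (s + q) gchoose q)"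
      by (subst gbinomial_minus) simp
    also have "(of_nat (s + q) :: complex) gchoose q = of_nat ((q + s) choose s)"
      unfolding binomial_gbinomial[symmetric] using binomial_symmetric[of q "s + q"] by (simp add: add.commute)
    finally show ?thesis by (simp add: power_minus[of t])
  qed
  have "(\<lambda>q. (- of_nat (s + 1) gchoose q) * (- t) ^ q) sums ((1 + - t) powr (- of_nat (s + 1)))"
    by (rule gen_binomial_complex) (use assms in simp)
  moreover have "(1 + - t) powr (- of_nat (s + 1)) = inverse (1 - t) ^ (s + 1)"
  proof -
    have "(1 + - t) powr (- of_nat (s + 1)) = inverse ((1 - t) powr (of_nat (s + 1)))"
      by (simp only: powr_minus) simp
    also have "(1 - t) powr (of_nat (s + 1)) = (1 - t) ^ (s + 1)"
      using t by (subst powr_nat) auto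
    finally show ?thesis by (simp only: power_inverse)
  qed
  ultimately show ?thesis by (simp only: c)
qed

text \<open>Binomial expansion of (z - w)^s splits the kernel into products of one such function of
  z and one of w.\<close>

definition kernel_fun :: "nat \<Rightarrow> complex \<Rightarrow> nat \<Rightarrow> complex \<Rightarrow> complex" where
  "kernel_fun s \<beta> i z = z ^ i * inverse (1 - \<beta> * z) ^ (s + 1)"

definition kernel_coeff :: "nat \<Rightarrow> complex \<Rightarrow> nat \<Rightarrow> nat \<Rightarrow> complex" where
  "kernel_coeff s \<beta> i m = (if i \<le> m then of_nat ((m - i + s) choose s) * \<beta> ^ (m - i) else 0)"

lemma norm_mult_less_1: "norm \<beta> < 1 \<Longrightarrow> norm z \<le> 1 \<Longrightarrow> norm (\<beta> * z :: complex) < 1"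
  by (metis mult_left_le norm_ge_zero norm_mult order_le_less_trans)

lemma kernel_fun_sums:
  assumes "norm \<beta> < 1" "norm z = 1"
  shows "(\<lambda>m. kernel_coeff s \<beta> i m * z ^ m) sums kernel_fun s \<beta> i z"
proof (subst sums_zero_iff_shift[of i, symmetric])
  have "norm (\<beta> * z) < 1" using assms by (intro norm_mult_less_1) auto
  from sums_mult[OF negative_binomial_sums[OF this], of "z ^ i"]
  show "(\<lambda>m. kernel_coeff s \<beta> i (m + i) * z ^ (m + i)) sums kernel_fun s \<beta> i z"
    by (simp add: kernel_fun_def kernel_coeff_def power_mult_distrib power_add mult_ac)
qed (simp add: kernel_coeff_def)

lemma kernel_coeff_summable:
  assumes "norm \<beta> < 1"
  shows "summable (\<lambda>m. norm (kernel_coeff s \<beta> i m))"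
proof -
  have "(\<lambda>m. kernel_coeff s (of_real (norm \<beta>)) i m * 1 ^ m) sums kernel_fun s (of_real (norm \<beta>)) i 1"
    by (rule kernel_fun_sums) (use assms in auto)
  then have "summable (\<lambda>m. kernel_coeff s (of_real (norm \<beta>)) i m)" by (simp add: sums_iff)
  moreover have "kernel_coeff s (of_real (norm \<beta>)) i m = of_real (norm (kernel_coeff s \<beta> i m))" for m
    by (simp add: kernel_coeff_def norm_mult norm_power)
  ultimately have "summable (\<lambda>m. complex_of_real (norm (kernel_coeff s \<beta> i m)))" by simp
  then show ?thesis by (rule summable_of_real_iff[THEN iffD1])
qed

lemma kernel_fun_measurable [measurable]: "kernel_fun s \<beta> i \<in> borel_measurable borel"
  unfolding kernel_fun_def [abs_def] by measurable

lemma kernel_fun_HD_plus: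
  assumes "norm \<beta> < 1"
  shows "kernel_fun s \<beta> i \<in> HD_plus" "hd_coeff (kernel_fun s \<beta> i) (int k) = kernel_coeff s \<beta> i k"
  using hd_power_series[OF kernel_coeff_summable[OF assms] kernel_fun_measurable kernel_fun_sums[OF assms]] by blast+

definition kernel :: "nat \<Rightarrow> complex \<Rightarrow> complex \<Rightarrow> complex \<Rightarrow> complex" where
  "kernel s \<beta> z w = (z - w) ^ s * inverse ((1 - \<beta> * z) * (1 - \<beta> * w)) ^ (s + 1)"

text \<open>Written as a sum of s + 1 products and not as an integral over the kernel, so that its
  values are visibly combinations of finitely many \<open>kernel_fun\<close>; the integral form,
  needed for covariance, is recovered below.\<close>

definition kernel_op :: "nat \<Rightarrow> complex \<Rightarrow> hd_op" where
  "kernel_op s \<beta> f z = (\<Sum>i\<le>s. (- 1) ^ i * of_nat (s choose i) *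
     (LINT w|S1. kernel_fun s \<beta> i w * f w * w) * kernel_fun s \<beta> (s - i) z)"

lemma kernel_expand:
  "kernel s \<beta> z w = (\<Sum>i\<le>s. (- 1) ^ i * of_nat (s choose i) * kernel_fun s \<beta> i w * kernel_fun s \<beta> (s - i) z)"
proof -
  have "(z - w) ^ s = (- w + z) ^ s" by simp
  also have "\<dots> = (\<Sum>i\<le>s. of_nat (s choose i) * (- w) ^ i * z ^ (s - i))" by (rule binomial_ring)
  also have "\<dots> = (\<Sum>i\<le>s. (- 1) ^ i * of_nat (s choose i) * w ^ i * z ^ (s - i))"
    by (intro sum.cong refl) (simp add: power_minus[of w])
  finally show ?thesis
    unfolding kernel_def by (simp add: kernel_fun_def sum_distrib_left sum_distrib_right power_mult_distrib mult_ac)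
qed

lemma pairing_integrable:
  assumes "f \<in> HD" "h \<in> HD"
  shows "integrable S1 (\<lambda>z. f z * h z * z)"
  using integrable_S1_bounded_mult[OF _ _ integrable_HD_mult[OF assms], of "\<lambda>z. z" 1] by (simp add: mult.commute)

lemma kernel_op_integral:
  assumes "norm \<beta> < 1" "f \<in> HD"
  shows "kernel_op s \<beta> f z = (LINT w|S1. kernel s \<beta> z w * f w * w)"
proof -
  have i: "integrable S1 (\<lambda>w. kernel_fun s \<beta> i w * f w * w)" for i
    by (rule pairing_integrable[OF HD_plus_subset[OF kernel_fun_HD_plus(1)[OF assms(1)]] assms(2)])
  have "(LINT w|S1. kernel s \<beta> z w * f w * w)
     = (LINT w|S1. (\<Sum>i\<le>s. ((- 1) ^ i * of_nat (s choose i) * kernel_fun s \<beta> (s - i) z) * (kernel_fun s \<beta> i w * f w * w)))"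
    by (rule Bochner_Integration.integral_cong) (simp_all add: kernel_expand sum_distrib_left sum_distrib_right mult_ac)
  also have "\<dots> = kernel_op s \<beta> f z"
    unfolding kernel_op_def using i
    by (subst Bochner_Integration.integral_sum) (auto intro!: sum.cong integrable_mult_right)
  finally show ?thesis ..
qed

text \<open>In the alternative form of the weight every term splits: \<beta>^(k+n-s) is
  \<beta>^(n-i) times \<beta>^(k-(s-i)), and the two binomials are the matching coefficients of the
  two kernel factors.\<close>

lemma hankel_matrix_geo:
  assumes "norm \<beta> < 1"
  shows "hankel_matrix s (geo s \<beta>) k n = (\<Sum>i\<le>s. (- 1) ^ i * of_nat (s choose i) * kernel_coeff s \<beta> i n * kernel_coeff s \<beta> (s - i) k)"
proof (cases "k + n < s")
  case True
  have z: "kernel_coeff s \<beta> i n * kernel_coeff s \<beta> (s - i) k = 0" for i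
    using True by (auto simp: kernel_coeff_def)
  have "(\<Sum>i\<le>s. (- 1) ^ i * of_nat (s choose i) * kernel_coeff s \<beta> i n * kernel_coeff s \<beta> (s - i) k) = 0"
    by (intro sum.neutral ballI) (simp only: mult.assoc z mult_zero_right)
  then show ?thesis using True by (simp add: hankel_matrix_def hankel_weight_zero)
next
  case False
  have e: "k + n + s + 1 - (2 * s + 1) = k + n - s" by simp
  have "hankel_matrix s (geo s \<beta>) k n = \<beta> ^ (k + n - s) * of_real (hankel_weight s k n)"
    using False unfolding hankel_matrix_def taylor_geo[OF assms] e by simp
  also have "\<dots> = (\<Sum>i\<le>s. (- 1) ^ i * of_nat (s choose i) * (\<beta> ^ (k + n - s) * (of_nat ((k + i) choose s) * of_nat ((n + s - i) choose s))))"
    by (simp add: hankel_weight_alt sum_distrib_left mult_ac)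
  also have "\<dots> = (\<Sum>i\<le>s. (- 1) ^ i * of_nat (s choose i) * (kernel_coeff s \<beta> i n * kernel_coeff s \<beta> (s - i) k))"
  proof (rule sum.cong[OF refl])
    fix i assume i: "i \<in> {..s}"
    have "\<beta> ^ (k + n - s) * (of_nat ((k + i) choose s) * of_nat ((n + s - i) choose s))
        = kernel_coeff s \<beta> i n * kernel_coeff s \<beta> (s - i) k"
    proof (cases "i \<le> n \<and> s - i \<le> k")
      case True
      then have e: "k + n - s = n - i + (k - (s - i))" "k - (s - i) + s = k + i" "n - i + s = n + s - i" using i by auto
      have "kernel_coeff s \<beta> i n = of_nat ((n + s - i) choose s) * \<beta> ^ (n - i)"
        "kernel_coeff s \<beta> (s - i) k = of_nat ((k + i) choose s) * \<beta> ^ (k - (s - i))"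
        using True unfolding kernel_coeff_def e(2,3) by simp_all
      then show ?thesis by (simp only: e(1) power_add mult_ac)
    next
      case False
      then have "n + s - i < s \<or> k + i < s" using i by auto
      then have "(n + s - i) choose s = 0 \<or> (k + i) choose s = 0" by (auto simp: binomial_eq_0)
      moreover have "kernel_coeff s \<beta> i n * kernel_coeff s \<beta> (s - i) k = 0"
        using False by (auto simp: kernel_coeff_def)
      ultimately show ?thesis by auto
    qed
    then show "(- 1) ^ i * of_nat (s choose i) * (\<beta> ^ (k + n - s) * (of_nat ((k + i) choose s) * of_nat ((n + s - i) choose s)))
        = (- 1) ^ i * of_nat (s choose i) * (kernel_coeff s \<beta> i n * kernel_coeff s \<beta> (s - i) k)" by (simp only:)
  qed
  finally show ?thesis by (simp add: mult.assoc)
qed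

text \<open>Pairing \<open>f\<close> with a power series in w picks out its coefficients at
  \<open>neg_index b\<close>, so the finite-rank operator has the matrix just computed.\<close>

lemma kernel_op_image:
  assumes \<beta>: "norm \<beta> < 1" and f: "f \<in> HD_minus"
  shows "mat_image (hankel_matrix s (geo s \<beta>)) f (kernel_op s \<beta> f)"
  unfolding mat_image_def
proof (intro conjI allI)
  note u = kernel_fun_HD_plus[OF \<beta>]
  have eq: "kernel_op s \<beta> f = (\<lambda>z. \<Sum>i\<le>s. ((- 1) ^ i * of_nat (s choose i) *
     (LINT w|S1. kernel_fun s \<beta> i w * f w * w)) * kernel_fun s \<beta> (s - i) z)"
    by (simp add: kernel_op_def fun_eq_iff)
  have HD: "kernel_op s \<beta> f \<in> HD" unfolding eq by (intro HD_sum HD_cmult HD_plus_subset u)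
  have c: "hd_coeff (kernel_op s \<beta> f) j = (\<Sum>i\<le>s. (- 1) ^ i * of_nat (s choose i) *
     (LINT w|S1. kernel_fun s \<beta> i w * f w * w) * hd_coeff (kernel_fun s \<beta> (s - i)) j)" for j
    unfolding eq by (subst hd_coeff_sum) (intro HD_cmult HD_plus_subset u, simp add: hd_coeff_cmult)
  show "kernel_op s \<beta> f \<in> HD_plus"
    using HD u(1) by (auto simp: HD_plus_def c intro!: sum.neutral)
  fix k
  have fi: "integrable S1 (\<lambda>w. f w * w)"
    using pairing_integrable[OF HD_minus_subset[OF f] HD_powi[of 0]] by simp
  have "(LINT w|S1. w ^ b * (f w * w)) = hd_coeff f (neg_index b)" for b
    unfolding hd_coeff_def by (simp add: mult_ac power_int_add_1 flip: power_int_of_nat)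
  then have p: "(\<lambda>b. kernel_coeff s \<beta> i b * hd_coeff f (neg_index b)) sums (LINT w|S1. kernel_fun s \<beta> i w * f w * w)" for i
    using integral_S1_power_series[OF kernel_coeff_summable[OF \<beta>] fi kernel_fun_measurable kernel_fun_sums[OF \<beta>]]
    by (simp add: mult.assoc del: of_nat_Suc)
  have "(\<lambda>n. \<Sum>i\<le>s. (- 1) ^ i * of_nat (s choose i) * kernel_coeff s \<beta> (s - i) k * (kernel_coeff s \<beta> i n * hd_coeff f (neg_index n)))
     sums (\<Sum>i\<le>s. (- 1) ^ i * of_nat (s choose i) * kernel_coeff s \<beta> (s - i) k * (LINT w|S1. kernel_fun s \<beta> i w * f w * w))"
    by (intro sums_sum sums_mult p)
  also have "(\<lambda>n. \<Sum>i\<le>s. (- 1) ^ i * of_nat (s choose i) * kernel_coeff s \<beta> (s - i) k * (kernel_coeff s \<beta> i n * hd_coeff f (neg_index n)))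
     = (\<lambda>n. hd_coeff f (neg_index n) * hankel_matrix s (geo s \<beta>) k n)"
    unfolding hankel_matrix_geo[OF \<beta>] by (simp add: fun_eq_iff sum_distrib_left mult_ac del: of_nat_Suc)
  also have "(\<Sum>i\<le>s. (- 1) ^ i * of_nat (s choose i) * kernel_coeff s \<beta> (s - i) k * (LINT w|S1. kernel_fun s \<beta> i w * f w * w))
     = hd_coeff (kernel_op s \<beta> f) (int k)"
    unfolding c u(2) by (intro sum.cong) (auto simp: mult_ac)
  finally show "(\<lambda>n. hd_coeff f (neg_index n) * hankel_matrix s (geo s \<beta>) k n) sums hd_coeff (kernel_op s \<beta> f) (int k)" .
qed

text \<open>At \<beta> = 0 the kernel factors are monomials, and the contour pairing of a tensor is
  the \<open>S1\<close> integral with an extra factor w.\<close>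

lemma l_op_eq_kernel_op:
  assumes f: "f \<in> HD"
  shows "l_op s f = kernel_op s 0 f"
proof -
  have eq: "1 / (2 * of_real pi * \<i>) * contour_integral (circlepath 0 1) (\<lambda>w. w ^ i * f w) = (LINT w|S1. kernel_fun s 0 i w * f w * w)" for i
  proof -
    have [measurable]: "f \<in> borel_measurable borel" using HD_measurable[OF f] .
    have "integrable S1 (\<lambda>w. w ^ i * f w)"
      using integrable_HD_mult[OF HD_powi[of "int i"] f] by simp
    from has_contour_integral_S1[OF _ this]
    have "contour_integral (circlepath 0 1) (\<lambda>w. w ^ i * f w) = 2 * of_real pi * \<i> * (LINT w|S1. kernel_fun s 0 i w * f w * w)"
      by (intro contour_integral_unique) (simp add: kernel_fun_def)
    then show ?thesis by simp
  qed
  have k: "kernel_fun s 0 i z = z ^ i" for i z by (simp add: kernel_fun_def)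
  show ?thesis
    unfolding fun_eq_iff l_op_def tensor_op_def kernel_op_def eq by (simp add: k mult.assoc)
qed

section \<open>Covariance of the kernels and of the symbols\<close>

context su11
begin

text \<open>Read off from 1 - \<beta> mob z = denom \<beta> (1 - move \<beta> z) / jac z:
  \<open>move\<close> is the Moebius action on the parameter induced by substituting
  \<open>mob z\<close> for z, and \<open>denom\<close> is its automorphy factor.\<close>

definition denom :: "complex \<Rightarrow> complex" where "denom \<beta> = cnj a + \<beta> * cnj b"
definition move :: "complex \<Rightarrow> complex" where "move \<beta> = (b + \<beta> * a) / denom \<beta>"

lemma denom_nz: "norm \<beta> < 1 \<Longrightarrow> denom \<beta> \<noteq> 0"
proof
  assume "norm \<beta> < 1" "denom \<beta> = 0"
  then have "cnj a = - (\<beta> * cnj b)" by (simp add: denom_def eq_neg_iff_add_eq_0)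
  then have "norm a = norm \<beta> * norm b" by (metis complex_mod_cnj norm_minus_cancel norm_mult)
  also have "\<dots> \<le> norm b" using \<open>norm \<beta> < 1\<close> by (simp add: mult_left_le_one_le)
  finally show False using norm_b_less by simp
qed

text \<open>The Schwarz-Pick computation again, now for the action on the parameter.\<close>

lemma norm_move: assumes "norm \<beta> < 1" shows "norm (move \<beta>) < 1"
proof -
  have "denom \<beta> * cnj (denom \<beta>) - (b + \<beta> * a) * cnj (b + \<beta> * a) = (a * cnj a - b * cnj b) * (1 - \<beta> * cnj \<beta>)"
    unfolding denom_def by (simp add: algebra_simps)
  then have "complex_of_real ((norm (denom \<beta>))\<^sup>2 - (norm (b + \<beta> * a))\<^sup>2) = complex_of_real (1 - (norm \<beta>)\<^sup>2)"
    unfolding det_complex of_real_diff of_real_1 complex_norm_square mult_1 .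
  then have "(norm (denom \<beta>))\<^sup>2 - (norm (b + \<beta> * a))\<^sup>2 = 1 - (norm \<beta>)\<^sup>2" unfolding of_real_eq_iff .
  moreover have "(norm \<beta>)\<^sup>2 < 1" using assms by (simp add: power_less_one_iff)
  ultimately have "(norm (b + \<beta> * a))\<^sup>2 < (norm (denom \<beta>))\<^sup>2" by linarith
  then have "norm (b + \<beta> * a) < norm (denom \<beta>)" by (rule power_less_imp_less_base) simp
  then show ?thesis using denom_nz[OF assms] by (simp add: move_def norm_divide)
qed

lemma one_minus_mob:
  assumes "norm \<beta> < 1" "jac z \<noteq> 0"
  shows "1 - \<beta> * mob z = denom \<beta> * (1 - move \<beta> * z) * inverse (jac z)"
proof -
  have "jac z - \<beta> * (a * z - cnj b) = denom \<beta> - (b + \<beta> * a) * z"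
    by (simp add: jac_def denom_def algebra_simps)
  also have "\<dots> = denom \<beta> * (1 - move \<beta> * z)"
    using denom_nz[OF assms(1)] by (simp add: move_def right_diff_distrib)
  finally show ?thesis using assms(2) by (simp add: mob_def field_simps)
qed

text \<open>The numerator gives (jac z jac w)^(-s), the denominator (jac z jac w)^(s+1) denom^(-2 s
  - 2), and the two half-density factors (jac z jac w)^(-1). The exponents s and s + 1 of the kernel
  are what makes all powers of \<open>jac\<close> cancel.\<close>

lemma kernel_mob:
  assumes \<beta>: "norm \<beta> < 1" and nz: "jac z \<noteq> 0" "jac w \<noteq> 0"
  shows "kernel s \<beta> (mob z) (mob w) * inverse (jac z) * inverse (jac w)
    = inverse (denom \<beta>) ^ (2 * s + 2) * kernel s (move \<beta>) z w"
proof -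
  let ?J = "jac z * jac w" and ?Q = "(1 - move \<beta> * z) * (1 - move \<beta> * w)"
  have J: "?J \<noteq> 0" using nz by simp
  have "(1 - \<beta> * mob z) * (1 - \<beta> * mob w) = denom \<beta> ^ 2 * ?Q * inverse ?J"
    unfolding one_minus_mob[OF \<beta> nz(1)] one_minus_mob[OF \<beta> nz(2)] by (simp add: power2_eq_square mult_ac)
  then have "inverse ((1 - \<beta> * mob z) * (1 - \<beta> * mob w)) ^ (s + 1)
      = (inverse (denom \<beta>) ^ 2) ^ (s + 1) * inverse ?Q ^ (s + 1) * ?J ^ (s + 1)"
    by (simp only: inverse_mult_distrib power_mult_distrib inverse_inverse_eq power_inverse)
  then have "kernel s \<beta> (mob z) (mob w) * inverse (jac z) * inverse (jac w)
    = (z - w) ^ s * inverse ?J ^ s * ((inverse (denom \<beta>) ^ 2) ^ (s + 1) * inverse ?Q ^ (s + 1) * ?J ^ (s + 1)) * inverse ?J"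
    unfolding kernel_def mob_diff[OF nz] by (simp only: divide_inverse power_mult_distrib inverse_mult_distrib mult_ac)
  also have "\<dots> = (inverse (denom \<beta>) ^ 2) ^ (s + 1) * ((z - w) ^ s * inverse ?Q ^ (s + 1)) * (inverse ?J ^ (s + 1) * ?J ^ (s + 1))"
    by (simp only: power_Suc2 Suc_eq_plus1[symmetric] mult_ac)
  also have "inverse ?J ^ (s + 1) * ?J ^ (s + 1) = 1"
    unfolding power_mult_distrib[symmetric] left_inverse[OF J] by simp
  also have "(inverse (denom \<beta>) ^ 2) ^ (s + 1) = inverse (denom \<beta>) ^ (2 * s + 2)"
    by (simp only: power_mult[symmetric]) simp
  finally show ?thesis by (simp add: kernel_def)
qed

lemma kernel_HD:
  assumes "norm \<beta> < 1" "norm z \<le> 1"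
  shows "kernel s \<beta> z \<in> HD"
proof (rule HD_continuous_circle)
  show "kernel s \<beta> z \<in> borel_measurable borel" unfolding kernel_def [abs_def] by measurable
  have "1 - \<beta> * w \<noteq> 0" if "norm w \<le> 1" for w by (rule one_minus_mult_nz) (use assms that in auto)
  then show "continuous_on (sphere 0 1) (kernel s \<beta> z)"
    unfolding kernel_def [abs_def] using assms(2) by (intro continuous_intros) auto
qed

text \<open>Invariance of the pairing moves the inverse transformation from \<open>f\<close> to the
  kernel, which is thereby transformed in both variables.\<close>

lemma tr_kernel_op:
  assumes \<beta>: "norm \<beta> < 1" and f: "f \<in> HD" and z: "norm z = 1"
  shows "tr (kernel_op s \<beta> (su11.tr (cnj a) (- b) f)) z = inverse (denom \<beta>) ^ (2 * s + 2) * kernel_op s (move \<beta>) f z"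
proof -
  interpret inv: su11 "cnj a" "- b" by (rule su11_inverse)
  let ?K = "kernel s \<beta> (mob z)"
  have K: "?K \<in> HD" using norm_mob_eq_1[OF z] by (intro kernel_HD \<beta>) auto
  have K': "kernel s (move \<beta>) z \<in> HD" using z norm_move[OF \<beta>] by (intro kernel_HD) auto
  note [measurable] = HD_measurable[OF f] HD_measurable[OF K] HD_measurable[OF K'] HD_measurable[OF HD_tr[OF K]]
    HD_measurable[OF HD_tr[OF inv.HD_tr[OF f]]]
  have "tr (kernel_op s \<beta> (inv.tr f)) z = inverse (jac z) * (LINT w|S1. ?K w * inv.tr f w * w)"
    unfolding tr_def kernel_op_integral[OF \<beta> inv.HD_tr[OF f]] by (rule mult.commute)
  also have "(LINT w|S1. ?K w * inv.tr f w * w) = (LINT w|S1. tr ?K w * tr (inv.tr f) w * w)"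
    by (rule tr_pairing[OF K inv.HD_tr[OF f], symmetric])
  also have "inverse (jac z) * \<dots> = (LINT w|S1. inverse (jac z) * (tr ?K w * tr (inv.tr f) w * w))"
    by simp
  also have "\<dots> = (LINT w|S1. inverse (denom \<beta>) ^ (2 * s + 2) * (kernel s (move \<beta>) z w * f w * w))"
  proof (rule LINT_S1_cong)
    fix w :: complex assume w: "norm w = 1"
    show "inverse (jac z) * (tr ?K w * tr (inv.tr f) w * w) = inverse (denom \<beta>) ^ (2 * s + 2) * (kernel s (move \<beta>) z w * f w * w)"
      using kernel_mob[OF \<beta> jac_nz jac_nz, of z w s] z w
      unfolding tr_tr_inverse[OF w] by (simp add: tr_def mult_ac)
  qed measurable
  also have "\<dots> = inverse (denom \<beta>) ^ (2 * s + 2) * kernel_op s (move \<beta>) f z"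
    unfolding kernel_op_integral[OF norm_move[OF \<beta>] f] by simp
  finally show ?thesis .
qed

definition pull :: "nat \<Rightarrow> (complex \<Rightarrow> complex) \<Rightarrow> complex \<Rightarrow> complex" where
  "pull s x z = x (mob z) * jac z ^ (2 * s)"

text \<open>With \<open>u = a z - cnj b\<close> and \<open>v = z / denom \<beta>\<close>, the difference of the two sides is
  \<open>(u^N - v^N) / (denom \<beta> (1 - move \<beta> z))\<close> for \<open>N = 2 s + 1\<close>, and
  \<open>u - v = - cnj b (1 - move \<beta> z)\<close>.\<close>

lemma pull_geo:
  assumes \<beta>: "norm \<beta> < 1"
  shows "Hneg_class_eq s (pull s (geo s \<beta>)) (\<lambda>z. inverse (denom \<beta>) ^ (2 * s + 2) * geo s (move \<beta>) z)"
proof -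
  let ?N = "2 * s + 1" and ?\<delta> = "denom \<beta>"
  define p where "p = smult (- cnj b * inverse ?\<delta>) (\<Sum>i<?N. [:0, inverse ?\<delta>:] ^ (?N - Suc i) * [:- cnj b, a:] ^ i)"
  have "degree p \<le> 2 * s"
  proof -
    have "degree ([:0, inverse ?\<delta>:] ^ (?N - Suc i) * [:- cnj b, a:] ^ i) \<le> 2 * s" if "i < ?N" for i
    proof -
      have "degree ([:0, inverse ?\<delta>:] ^ (?N - Suc i) * [:- cnj b, a:] ^ i)
         \<le> degree [:0, inverse ?\<delta>:] * (?N - Suc i) + degree [:- cnj b, a:] * i"
        by (intro order_trans[OF degree_mult_le] add_mono degree_power_le)
      also have "\<dots> \<le> 1 * (?N - Suc i) + 1 * i"
        by (intro add_mono mult_right_mono) auto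
      also have "\<dots> \<le> 2 * s" using that by simp
      finally show ?thesis .
    qed
    then show ?thesis unfolding p_def
      by (intro order_trans[OF degree_smult_le] degree_sum_le) auto
  qed
  moreover have "pull s (geo s \<beta>) z - inverse ?\<delta> ^ (2 * s + 2) * geo s (move \<beta>) z = poly p z" if z: "norm z < 1" for z
  proof -
    have j: "jac z \<noteq> 0" using z by (intro jac_nz) simp
    have q: "1 - move \<beta> * z \<noteq> 0" using norm_move[OF \<beta>] z by (intro one_minus_mult_nz) auto
    have d: "?\<delta> \<noteq> 0" by (rule denom_nz[OF \<beta>])
    let ?u = "a * z - cnj b" and ?v = "z * inverse ?\<delta>" and ?q = "1 - move \<beta> * z"
    have "a * ?\<delta> - cnj b * (b + \<beta> * a) = a * cnj a - b * cnj b"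
      by (simp add: denom_def algebra_simps)
    then have inv: "a - cnj b * move \<beta> = inverse ?\<delta>"
      unfolding det_complex using d by (simp add: move_def field_simps)
    have "?u - ?v = - cnj b * ?q"
      unfolding inv[symmetric] by (simp add: algebra_simps)
    then have diff: "?u ^ ?N - ?v ^ ?N = - cnj b * ?q * (\<Sum>i<?N. ?v ^ (?N - Suc i) * ?u ^ i)"
      unfolding power_diff_sumr2 by simp
    have "pull s (geo s \<beta>) z = ?u ^ ?N * inverse (?\<delta> * ?q)"
    proof -
      have "pull s (geo s \<beta>) z = (?u * inverse (jac z)) ^ ?N * inverse (?\<delta> * ?q * inverse (jac z)) * jac z ^ (2 * s)"
        unfolding pull_def geo_def one_minus_mob[OF \<beta> j] by (simp add: mob_def divide_inverse)
      also have "\<dots> = ?u ^ ?N * inverse (?\<delta> * ?q) * (inverse (jac z) ^ ?N * jac z ^ ?N)"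
        by (simp only: power_mult_distrib inverse_mult_distrib inverse_inverse_eq) (simp add: mult_ac)
      also have "inverse (jac z) ^ ?N * jac z ^ ?N = 1"
        using j by (simp only: power_mult_distrib[symmetric]) simp
      finally show ?thesis by simp
    qed
    moreover have "inverse ?\<delta> ^ (2 * s + 2) * geo s (move \<beta>) z = ?v ^ ?N * inverse (?\<delta> * ?q)"
      unfolding geo_def by (simp only: power_mult_distrib inverse_mult_distrib) (simp add: mult_ac)
    ultimately have "pull s (geo s \<beta>) z - inverse ?\<delta> ^ (2 * s + 2) * geo s (move \<beta>) z = (?u ^ ?N - ?v ^ ?N) * inverse (?\<delta> * ?q)"
      by (simp only: left_diff_distrib)
    also have "\<dots> = - cnj b * inverse ?\<delta> * (\<Sum>i<?N. ?v ^ (?N - Suc i) * ?u ^ i) * (?q * inverse ?q)"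
      unfolding diff by (simp only: inverse_mult_distrib mult_ac)
    also have "?q * inverse ?q = 1" using q by simp
    also have "- cnj b * inverse ?\<delta> * (\<Sum>i<?N. ?v ^ (?N - Suc i) * ?u ^ i) * 1 = poly p z"
      unfolding p_def by (simp add: poly_sum poly_power mult.commute[of a])
    finally show ?thesis .
  qed
  ultimately show ?thesis unfolding Hneg_class_eq_def by auto
qed

text \<open>The power of \<open>jac\<close> clears the denominators: (a z - cnj b)^m jac^(2 s - m)
  has degree at most 2 s.\<close>

lemma pull_power_class:
  assumes "m \<le> 2 * s"
  shows "Hneg_class_eq s (pull s (\<lambda>z. z ^ m)) (\<lambda>z. 0)"
proof -
  define p where "p = [:- cnj b, a:] ^ m * [:cnj a, - b:] ^ (2 * s - m)"
  have "degree p \<le> degree [:- cnj b, a:] * m + degree [:cnj a, - b:] * (2 * s - m)"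
    unfolding p_def by (intro order_trans[OF degree_mult_le] add_mono degree_power_le)
  also have "\<dots> \<le> 1 * m + 1 * (2 * s - m)" by (intro add_mono mult_right_mono) auto
  finally have "degree p \<le> 2 * s" using assms by simp
  moreover have "pull s (\<lambda>z. z ^ m) z = poly p z" if "norm z < 1" for z
  proof -
    have j: "jac z \<noteq> 0" using that by (intro jac_nz) simp
    have "jac z ^ (2 * s) = jac z ^ m * jac z ^ (2 * s - m)" using assms by (simp flip: power_add)
    then have "pull s (\<lambda>z. z ^ m) z = (a * z - cnj b) ^ m * jac z ^ (2 * s - m) * (inverse (jac z) ^ m * jac z ^ m)"
      by (simp only: pull_def mob_power mult_ac)
    also have "inverse (jac z) ^ m * jac z ^ m = 1"
      using j by (simp flip: power_mult_distrib)
    finally have "pull s (\<lambda>z. z ^ m) z = (a * z - cnj b) ^ m * jac z ^ (2 * s - m)" by simp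
    moreover have "poly [:- cnj b, a:] z = a * z - cnj b" "poly [:cnj a, - b:] z = jac z"
      by (simp_all add: jac_def)
    ultimately show ?thesis by (simp only: p_def poly_mult poly_power)
  qed
  ultimately show ?thesis unfolding Hneg_class_eq_def by auto
qed

lemma mob_holomorphic: "mob holomorphic_on ball 0 1"
  unfolding mob_def [abs_def] using jac_nz by (intro holomorphic_intros) auto

lemma pull_holomorphic:
  assumes "x holomorphic_on ball 0 1"
  shows "pull s x holomorphic_on ball 0 1"
proof -
  have "x \<circ> mob holomorphic_on ball 0 1"
    by (rule holomorphic_on_compose_gen[OF mob_holomorphic assms]) (use norm_mob_less_1 in auto)
  then show ?thesis unfolding pull_def [abs_def] by (intro holomorphic_intros) (simp add: o_def)
qed

text \<open>\<open>mob\<close> maps the disc of radius 1/2 into a disc of radius r < 1, on which the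
  Taylor series of x converges uniformly; derivatives at 0 then pass to the limit. Only local
  uniform convergence enters, so every holomorphic symbol is covered.\<close>

lemma taylor_pull_sums:
  assumes x: "x holomorphic_on ball 0 1"
  shows "(\<lambda>m. taylor x m * taylor (pull s (\<lambda>z. z ^ m)) i) sums taylor (pull s x) i"
proof -
  let ?A = "ball (0 :: complex) (1/2)"
  have sub: "cball 0 (1/2) \<subseteq> ball (0 :: complex) 1" by auto
  have cm: "continuous_on (cball 0 (1/2)) mob"
    using holomorphic_on_imp_continuous_on[OF mob_holomorphic] continuous_on_subset sub by blast
  have "\<exists>w\<in>cball 0 (1/2). \<forall>z\<in>cball 0 (1/2). norm (mob z) \<le> norm (mob w)"
    by (rule continuous_attains_sup) (auto intro!: continuous_intros cm)
  then obtain w where w: "w \<in> cball 0 (1/2)" "\<And>z. z \<in> cball 0 (1/2) \<Longrightarrow> norm (mob z) \<le> norm (mob w)" by blast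
  define r where "r = norm (mob w)"
  have r: "r < 1" "r \<ge> 0" using norm_mob_less_1[of w] w(1) by (auto simp: r_def)
  define J where "J = (norm a + norm b) ^ (2 * s)"
  have J: "norm (jac z ^ (2 * s)) \<le> J" if "norm z \<le> 1" for z
    unfolding norm_power J_def
  proof (rule power_mono)
    have "norm (jac z) \<le> norm (cnj a) + norm (b * z)" unfolding jac_def by (rule norm_triangle_ineq4)
    also have "\<dots> \<le> norm a + norm b" using that by (simp add: norm_mult mult_left_le)
    finally show "norm (jac z) \<le> norm a + norm b" .
  qed simp
  have J0: "0 \<le> J" by (simp add: J_def)
  let ?t = "\<lambda>m z. taylor x m * pull s (\<lambda>z. z ^ m) z"
  have ul: "uniform_limit ?A (\<lambda>N z. \<Sum>m<N. ?t m z) (\<lambda>z. suminf (\<lambda>m. ?t m z)) sequentially"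
  proof (rule Weierstrass_m_test)
    fix m and z :: complex assume z: "z \<in> ?A"
    have "norm (mob z) ^ m \<le> r ^ m" unfolding r_def using w(2)[of z] z by (intro power_mono) auto
    moreover have "norm (jac z ^ (2 * s)) \<le> J" using z by (intro J) auto
    ultimately have "norm (pull s (\<lambda>z. z ^ m) z) \<le> r ^ m * J"
      using r unfolding pull_def norm_mult norm_power by (intro mult_mono) (auto simp: norm_power)
    then show "norm (?t m z) \<le> norm (taylor x m * of_real r ^ m) * J"
      using r by (simp add: norm_mult norm_power mult.assoc mult_left_mono)
  next
    show "summable (\<lambda>m. norm (taylor x m * of_real r ^ m) * J)"
      using r by (intro summable_mult2 taylor_abs_summable[OF x]) auto
  qed
  have "uniform_limit ?A (\<lambda>N z. \<Sum>m<N. ?t m z) (pull s x) sequentially"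
  proof (rule uniform_limit_cong'[THEN iffD1, OF _ _ ul])
    fix z :: complex assume "z \<in> ?A"
    then have "norm (mob z) < 1" by (intro norm_mob_less_1) auto
    from sums_mult2[OF taylor_sums[OF x this], of "jac z ^ (2 * s)"]
    show "suminf (\<lambda>m. ?t m z) = pull s x z"
      by (simp add: pull_def mult.assoc sums_iff)
  qed simp
  then have "(\<lambda>N. (deriv ^^ i) (\<lambda>z. \<Sum>m<N. ?t m z) 0) \<longlonglongrightarrow> (deriv ^^ i) (pull s x) 0"
  proof (rule higher_deriv_complex_uniform_limit)
    have "pull s (\<lambda>z. z ^ m) holomorphic_on ?A" for m
      by (rule holomorphic_on_subset[OF pull_holomorphic]) (auto intro!: holomorphic_intros)
    then show "\<forall>\<^sub>F N in sequentially. (\<lambda>z. \<Sum>m<N. ?t m z) holomorphic_on ?A"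
      by (intro always_eventually allI holomorphic_intros)
  qed auto
  then have "(\<lambda>N. taylor (\<lambda>z. \<Sum>m<N. ?t m z) i) \<longlonglongrightarrow> taylor (pull s x) i"
    unfolding fps_expansion_def by (simp add: tendsto_divide)
  moreover have "taylor (\<lambda>z. \<Sum>m<N. ?t m z) i = (\<Sum>m<N. taylor x m * taylor (pull s (\<lambda>z. z ^ m)) i)" for N
  proof -
    have h: "pull s (\<lambda>z. z ^ m) holomorphic_on ball 0 1" for m by (intro pull_holomorphic holomorphic_intros)
    show ?thesis by (subst taylor_sum) (auto intro!: holomorphic_intros h simp: taylor_cmult[OF h])
  qed
  ultimately show ?thesis by (simp add: sums_def)
qed

end

section \<open>The Hankel map\<close>

definition hankel_op :: "nat \<Rightarrow> (complex \<Rightarrow> complex) \<Rightarrow> hd_op" where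
  "hankel_op s x = mat_op (hankel_matrix s x)"

lemma hankel_op_image:
  "x \<in> Hneg s \<Longrightarrow> f \<in> HD_minus \<Longrightarrow> mat_image (hankel_matrix s x) f (hankel_op s x f)"
  unfolding hankel_op_def using hankel_matrix_hs_bound[of s] mat_op_image by blast

lemma hankel_op_bounded: "x \<in> Hneg s \<Longrightarrow> bounded_op (hankel_op s x)"
  unfolding hankel_op_def using hankel_matrix_hs_bound[of s] mat_op_bounded by blast

lemma hankel_op_norm:
  "\<exists>C. \<forall>x\<in>Hneg s. \<forall>f\<in>HD_minus. hd_norm (hankel_op s x f) \<le> C * Hneg_norm s x * hd_norm f"
proof -
  obtain C where C: "C \<ge> 0" "\<forall>x\<in>Hneg s. hs_bound (hankel_matrix s x) (C * (Hneg_norm s x)\<^sup>2)"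
    using hankel_matrix_hs_bound[of s] by blast
  have "hd_norm (hankel_op s x f) \<le> sqrt C * Hneg_norm s x * hd_norm f" if "x \<in> Hneg s" "f \<in> HD_minus" for x f
  proof -
    have "(hd_norm (hankel_op s x f))\<^sup>2 \<le> C * (Hneg_norm s x)\<^sup>2 * (hd_norm f)\<^sup>2"
      unfolding hankel_op_def using C that mat_op_norm by blast
    then have "hd_norm (hankel_op s x f) \<le> sqrt (C * (Hneg_norm s x)\<^sup>2 * (hd_norm f)\<^sup>2)"
      by (rule real_le_rsqrt)
    then show ?thesis by (simp add: real_sqrt_mult Hneg_norm_nonneg)
  qed
  then show ?thesis by blast
qed

lemma hankel_op_add:
  assumes "x \<in> Hneg s" "y \<in> Hneg s"
  shows "op_eq (hankel_op s (\<lambda>z. x z + y z)) (\<lambda>f z. hankel_op s x f z + hankel_op s y f z)"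
  unfolding op_eq_def
proof
  fix f assume f: "f \<in> HD_minus"
  have "mat_image (hankel_matrix s (\<lambda>z. x z + y z)) f (\<lambda>z. hankel_op s x f z + hankel_op s y f z)"
    using hankel_op_image[OF assms(1) f] hankel_op_image[OF assms(2) f] assms
    by (auto simp: mat_image_def HD_plus_add hd_coeff_add HD_plus_subset hankel_matrix_add Hneg_holomorphic
        ring_distribs intro: sums_add)
  then show "hd_eq (hankel_op s (\<lambda>z. x z + y z) f) (\<lambda>z. hankel_op s x f z + hankel_op s y f z)"
    using mat_image_unique hankel_op_image[OF Hneg_add[OF assms] f] by blast
qed

lemma hankel_op_cmult:
  assumes "x \<in> Hneg s"
  shows "op_eq (hankel_op s (\<lambda>z. c * x z)) (\<lambda>f z. c * hankel_op s x f z)"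
  unfolding op_eq_def
proof
  fix f assume f: "f \<in> HD_minus"
  have "(\<lambda>n. c * (hd_coeff f (neg_index n) * hankel_matrix s x k n)) sums (c * hd_coeff (hankel_op s x f) (int k))" for k
    using hankel_op_image[OF assms f] by (intro sums_mult) (simp add: mat_image_def)
  then have "mat_image (hankel_matrix s (\<lambda>z. c * x z)) f (\<lambda>z. c * hankel_op s x f z)"
    using hankel_op_image[OF assms f] assms
    by (simp add: mat_image_def HD_plus_cmult hd_coeff_cmult hankel_matrix_cmult Hneg_holomorphic mult.left_commute)
  then show "hd_eq (hankel_op s (\<lambda>z. c * x z) f) (\<lambda>z. c * hankel_op s x f z)"
    using mat_image_unique hankel_op_image[OF Hneg_cmult[OF assms] f] by blast
qed

lemma hankel_op_geo:
  "norm \<beta> < 1 \<Longrightarrow> f \<in> HD_minus \<Longrightarrow> hd_eq (hankel_op s (geo s \<beta>) f) (kernel_op s \<beta> f)"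
  by (rule mat_image_unique[OF hankel_op_image[OF geo_Hneg] kernel_op_image])

lemma hankel_op_class_eq:
  assumes "x \<in> Hneg s" "y \<in> Hneg s" "Hneg_class_eq s x y"
  shows "hankel_op s x = hankel_op s y"
  unfolding hankel_op_def using hankel_matrix_class_eq[OF _ _ assms(3)] assms(1,2) Hneg_holomorphic by simp

section \<open>Equivariance of the operator\<close>

context su11
begin

text \<open>Both sides are series in their values on monomials, the left by boundedness, the right
  by \<open>taylor_pull_sums\<close>. By \<open>geo_total\<close> it suffices to compare them on
  \<open>geo s \<beta>\<close>, where kernel and symbol acquire the same factor denom^(-2 s - 2),
  and on powers up to 2 s, where both vanish.\<close>

lemma pull_coeff_eq:
  assumes x: "x \<in> Hneg s"
  shows "hd_coeff (tr (hankel_op s x (su11.tr (cnj a) (- b) (\<lambda>z. z powi neg_index n)))) (int k)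
    = hankel_matrix s (pull s x) k n"
proof -
  interpret inv: su11 "cnj a" "- b" by (rule su11_inverse)
  define h where "h = inv.tr (\<lambda>z. z powi neg_index n)"
  have h: "h \<in> HD_minus" unfolding h_def by (intro inv.HD_minus_tr HD_minus_powi)
  define \<psi> where "\<psi> x = hd_coeff (tr (hankel_op s x h)) (int k)" for x
  have T: "hankel_op s x h \<in> HD" if "x \<in> Hneg s" for x
    using bounded_op_in_HD[OF hankel_op_bounded h] that by blast
  have \<psi>_cong: "\<psi> x = hd_coeff (tr u) (int k)" if "x \<in> Hneg s" "u \<in> HD" "hd_eq (hankel_op s x h) u" for x u
    unfolding \<psi>_def using that T by (intro hd_coeff_cong HD_tr tr_cong) auto
  have \<psi>_add: "\<psi> (\<lambda>z. x z + y z) = \<psi> x + \<psi> y" if "x \<in> Hneg s" "y \<in> Hneg s" for x y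
  proof -
    have "\<psi> (\<lambda>z. x z + y z) = hd_coeff (tr (\<lambda>z. hankel_op s x h z + hankel_op s y h z)) (int k)"
      using hankel_op_add[OF that] h T that by (intro \<psi>_cong Hneg_add HD_add) (auto simp: op_eq_def)
    then show ?thesis using T that by (simp add: tr_add hd_coeff_add \<psi>_def)
  qed
  have \<psi>_cmult: "\<psi> (\<lambda>z. c * x z) = c * \<psi> x" if "x \<in> Hneg s" for c x
  proof -
    have "\<psi> (\<lambda>z. c * x z) = hd_coeff (tr (\<lambda>z. c * hankel_op s x h z)) (int k)"
      using hankel_op_cmult[OF that] h T that by (intro \<psi>_cong Hneg_cmult HD_cmult) (auto simp: op_eq_def)
    then show ?thesis by (simp add: tr_cmult hd_coeff_cmult \<psi>_def)
  qed
  obtain C where C: "\<forall>x\<in>Hneg s. \<forall>f\<in>HD_minus. hd_norm (hankel_op s x f) \<le> C * Hneg_norm s x * hd_norm f"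
    using hankel_op_norm by blast
  have \<psi>_bound: "norm (\<psi> x) \<le> (C * hd_norm h) * Hneg_norm s x" if "x \<in> Hneg s" for x
  proof -
    have "norm (\<psi> x) \<le> hd_norm (tr (hankel_op s x h))"
      unfolding \<psi>_def using T[OF that] by (intro hd_coeff_le_norm HD_tr)
    also have "\<dots> \<le> C * Hneg_norm s x * hd_norm h"
      using C h that T[OF that] by (simp add: hd_norm_tr)
    finally show ?thesis by (simp add: mult_ac)
  qed
  define \<phi> where "\<phi> x = hankel_matrix s (pull s x) k n - \<psi> x" for x
  have "\<phi> x = 0"
  proof (rule geo_total[OF _ _ _ x])
    fix y assume y: "y \<in> Hneg s"
    have "(\<lambda>m. taylor y m * taylor (pull s (\<lambda>z. z ^ m)) (k + n + s + 1) * of_real (hankel_weight s k n))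
        sums hankel_matrix s (pull s y) k n"
      unfolding hankel_matrix_def by (intro sums_mult2 taylor_pull_sums Hneg_holomorphic[OF y])
    moreover have "(\<lambda>m. taylor y m * \<psi> (\<lambda>z. z ^ m)) sums \<psi> y"
      using y \<psi>_add \<psi>_cmult \<psi>_bound by (rule Hneg_functional_sums)
    ultimately show "(\<lambda>m. taylor y m * \<phi> (\<lambda>z. z ^ m)) sums \<phi> y"
      unfolding \<phi>_def right_diff_distrib by (intro sums_diff) (simp_all add: hankel_matrix_def mult.assoc)
  next
    fix \<beta> :: complex assume \<beta>: "norm \<beta> < 1"
    let ?c = "inverse (denom \<beta>) ^ (2 * s + 2)"
    have hol: "geo s \<beta>' holomorphic_on ball 0 1" if "norm \<beta>' < 1" for \<beta>' using Hneg_holomorphic[OF geo_Hneg[OF that]] .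
    have K: "kernel_op s \<beta>' f \<in> HD" if "norm \<beta>' < 1" "f \<in> HD_minus" for \<beta>' f
      using kernel_op_image[OF that] HD_plus_subset by (auto simp: mat_image_def)
    have "hankel_matrix s (pull s (geo s \<beta>)) = hankel_matrix s (\<lambda>z. ?c * geo s (move \<beta>) z)"
      by (rule hankel_matrix_class_eq[OF _ _ pull_geo[OF \<beta>]])
         (intro pull_holomorphic holomorphic_intros hol \<beta> norm_move)+
    then have "hankel_matrix s (pull s (geo s \<beta>)) k n = ?c * hankel_matrix s (geo s (move \<beta>)) k n"
      by (simp add: hankel_matrix_cmult hol norm_move \<beta>)
    moreover have "\<psi> (geo s \<beta>) = ?c * hankel_matrix s (geo s (move \<beta>)) k n"
    proof -
      have "\<psi> (geo s \<beta>) = hd_coeff (tr (kernel_op s \<beta> h)) (int k)"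
        by (intro \<psi>_cong geo_Hneg K hankel_op_geo \<beta> h)
      also have "\<dots> = hd_coeff (\<lambda>z. ?c * kernel_op s (move \<beta>) (\<lambda>z. z powi neg_index n) z) (int k)"
      proof (rule hd_coeff_cong)
        show "hd_eq (tr (kernel_op s \<beta> h)) (\<lambda>z. ?c * kernel_op s (move \<beta>) (\<lambda>z. z powi neg_index n) z)"
          unfolding h_def by (rule hd_eq_circle) (rule tr_kernel_op[OF \<beta> HD_powi])
      qed (intro HD_tr HD_cmult K \<beta> h norm_move HD_minus_powi)+
      also have "\<dots> = ?c * hankel_matrix s (geo s (move \<beta>)) k n"
        unfolding hd_coeff_cmult mat_image_basis[OF kernel_op_image[OF norm_move[OF \<beta>] HD_minus_powi]] ..
      finally show ?thesis .
    qed
    ultimately show "\<phi> (geo s \<beta>) = 0" by (simp add: \<phi>_def)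
  next
    fix m assume m: "m \<le> 2 * s"
    have hm0: "hankel_matrix s (\<lambda>z. 0) = (\<lambda>k n. 0)"
      using hankel_matrix_cmult[of "\<lambda>z. 0" s 0] by (simp add: fun_eq_iff holomorphic_intros)
    have "hankel_matrix s (pull s (\<lambda>z. z ^ m)) = hankel_matrix s (\<lambda>z. 0)"
      by (rule hankel_matrix_class_eq[OF _ _ pull_power_class[OF m]])
         (intro pull_holomorphic holomorphic_intros)+
    moreover have "\<psi> (\<lambda>z. z ^ m) = 0"
    proof -
      have "Hneg_class_eq s (\<lambda>z. z ^ m) (\<lambda>z. 0)"
        unfolding Hneg_class_eq_def
        by (rule exI[of _ "monom 1 m"]) (use m in \<open>auto simp: poly_monom degree_monom_eq\<close>)
      then have "hankel_matrix s (\<lambda>z. z ^ m) = (\<lambda>k n. 0)"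
        using hankel_matrix_class_eq[of "\<lambda>z. z ^ m" "\<lambda>z. 0" s] by (simp add: hm0 holomorphic_intros)
      then have "mat_image (\<lambda>k n. 0) h (hankel_op s (\<lambda>z. z ^ m) h)"
        using hankel_op_image[OF Hneg_power h] by metis
      moreover have "mat_image (\<lambda>k n. 0) h (\<lambda>z. 0)" by (simp add: mat_image_def HD_plus_def)
      ultimately have "hd_eq (hankel_op s (\<lambda>z. z ^ m) h) (\<lambda>z. 0)" by (rule mat_image_unique)
      then have "\<psi> (\<lambda>z. z ^ m) = hd_coeff (tr (\<lambda>z. 0)) (int k)" by (intro \<psi>_cong Hneg_power HD_zero)
      also have "tr (\<lambda>z. 0) = (\<lambda>z. 0)" by (simp add: tr_def fun_eq_iff)
      finally show ?thesis by simp
    qed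
    ultimately show "\<phi> (\<lambda>z. z ^ m) = 0" by (simp add: \<phi>_def hm0)
  qed
  then show ?thesis by (simp add: \<phi>_def \<psi>_def h_def)
qed

text \<open>The conjugated operator is bounded and has the entries just computed, which identifies
  it with the operator of the matrix of \<open>pull s x\<close>.\<close>

lemma hankel_op_equivariant:
  assumes x: "x \<in> Hneg s"
  shows "op_eq (hankel_op s (pull s x)) (\<lambda>f. tr (hankel_op s x (su11.tr (cnj a) (- b) f)))"
  unfolding hankel_op_def[of s "pull s x"]
  by (rule mat_op_eq_bounded_op[OF bounded_op_conj[OF hankel_op_bounded[OF x]] pull_coeff_eq[OF x]])

end

section \<open>Translation between matrices in SU(1,1) and the parameters a, b\<close>

lemma SU11_su11: "g \<in> SU11 \<Longrightarrow> su11 (g $ 1 $ 1) (g $ 1 $ 2)"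
  by (simp add: SU11_def su11_def)

lemma act_one: "g \<in> SU11 \<Longrightarrow> act 1 g f = su11.tr (g $ 1 $ 1) (g $ 1 $ 2) f"
proof -
  assume "g \<in> SU11"
  then interpret su11 "g $ 1 $ 1" "g $ 1 $ 2" by (rule SU11_su11)
  show ?thesis
    by (simp add: act_def Let_def fun_eq_iff tr_def mob_def jac_def power_int_minus)
qed

lemma act_neg: "g \<in> SU11 \<Longrightarrow> act (- 2 * int s) g x = su11.pull (g $ 1 $ 1) (g $ 1 $ 2) s x"
proof -
  assume "g \<in> SU11"
  then interpret su11 "g $ 1 $ 1" "g $ 1 $ 2" by (rule SU11_su11)
  have "z powi - (- 2 * int s) = z ^ (2 * s)" for z :: complex
    using power_int_of_nat[of z "2 * s"] by simp
  then show ?thesis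
    by (simp add: act_def Let_def fun_eq_iff pull_def mob_def jac_def)
qed

lemma matrix_inv_SU11:
  assumes g: "g \<in> SU11"
  shows "matrix_inv g \<in> SU11" "matrix_inv g $ 1 $ 1 = cnj (g $ 1 $ 1)" "matrix_inv g $ 1 $ 2 = - (g $ 1 $ 2)"
proof -
  interpret su11 "g $ 1 $ 1" "g $ 1 $ 2" using g by (rule SU11_su11)
  define h :: "complex^2^2" where
    "h = (\<chi> i j. if i = 1 then (if j = 1 then cnj (g $ 1 $ 1) else - (g $ 1 $ 2))
                 else (if j = 1 then - cnj (g $ 1 $ 2) else g $ 1 $ 1))"
  have gh: "g $ 2 $ 1 = cnj (g $ 1 $ 2)" "g $ 2 $ 2 = cnj (g $ 1 $ 1)" using g by (auto simp: SU11_def)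
  have "g ** h = mat 1" "h ** g = mat 1"
    using det_complex gh
    by (auto simp: vec_eq_iff forall_2 matrix_matrix_mult_def mat_def h_def sum_2 algebra_simps)
  \<comment> \<open>\<open>matrix_inv\<close> is defined by choice, so uniqueness of a two-sided
    inverse is what identifies it.\<close>
  then have "matrix_inv g = h"
    unfolding matrix_inv_def
    by (intro some_equality) (auto, metis matrix_mul_assoc matrix_mul_lid matrix_mul_rid)
  then show "matrix_inv g \<in> SU11" "matrix_inv g $ 1 $ 1 = cnj (g $ 1 $ 1)" "matrix_inv g $ 1 $ 2 = - (g $ 1 $ 2)"
    using det by (auto simp: SU11_def h_def)
qed

lemma conj_act_tr:
  assumes "g \<in> SU11"
  shows "conj_act g T = (\<lambda>f. su11.tr (g $ 1 $ 1) (g $ 1 $ 2) (T (su11.tr (cnj (g $ 1 $ 1)) (- (g $ 1 $ 2)) f)))"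
  unfolding conj_act_def using act_one[OF assms] act_one[OF matrix_inv_SU11(1)[OF assms]]
  by (simp add: matrix_inv_SU11[OF assms])

lemma hankel_op_intertwining: "intertwining s (hankel_op s)"
  unfolding intertwining_def
proof (intro conjI ballI allI impI)
  obtain C where C: "C \<ge> 0" "\<forall>x\<in>Hneg s. hs_bound (hankel_matrix s x) (C * (Hneg_norm s x)\<^sup>2)"
    using hankel_matrix_hs_bound[of s] by blast
  show "HS_op (hankel_op s x)" if "x \<in> Hneg s" for x
    unfolding hankel_op_def using C that mat_op_HS(1) by blast
  show "\<exists>C. \<forall>x\<in>Hneg s. HS_norm (hankel_op s x) \<le> C * Hneg_norm s x"
  proof (intro exI ballI)
    fix x assume "x \<in> Hneg s"
    then have "HS_norm (hankel_op s x) \<le> sqrt (C * (Hneg_norm s x)\<^sup>2)"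
      unfolding hankel_op_def using C mat_op_HS(2) by blast
    then show "HS_norm (hankel_op s x) \<le> sqrt C * Hneg_norm s x"
      by (simp add: real_sqrt_mult Hneg_norm_nonneg)
  qed
  show "op_eq (hankel_op s x) (hankel_op s y)" if "x \<in> Hneg s" "y \<in> Hneg s" "Hneg_class_eq s x y" for x y
    using hankel_op_class_eq[OF that] by (simp add: op_eq_def)
  show "op_eq (hankel_op s (act (- 2 * int s) g x)) (conj_act g (hankel_op s x))" if "g \<in> SU11" "x \<in> Hneg s" for g x
    unfolding act_neg[OF that(1)] conj_act_tr[OF that(1)]
    by (rule su11.hankel_op_equivariant[OF SU11_su11[OF that(1)] that(2)])
qed (fact hankel_op_add hankel_op_cmult)+

lemma hankel_op_hankel_map: "hankel_map s (hankel_op s)"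
  unfolding hankel_map_def op_eq_def
proof (intro conjI hankel_op_intertwining ballI)
  fix f assume f: "f \<in> HD_minus"
  show "hd_eq (hankel_op s (\<lambda>z. z ^ (2 * s + 1)) f) (l_op s f)"
    using hankel_op_geo[of 0 f s] f unfolding geo_0 l_op_eq_kernel_op[OF HD_minus_subset[OF f]] by simp
qed

section \<open>Uniqueness of the normalized intertwining map\<close>

lemma SU11_transitive:
  assumes "norm \<beta> < 1"
  obtains g :: "complex^2^2" where "g \<in> SU11" "su11.move (g $ 1 $ 1) (g $ 1 $ 2) 0 = \<beta>"
proof -
  \<comment> \<open>For real a and b = \<beta> a one gets move 0 = b / a = \<beta>, and |a|^2 -
    |b|^2 = 1 then fixes |a|.\<close>
  define a :: complex where "a = of_real (1 / sqrt (1 - (norm \<beta>)\<^sup>2))"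
  have pos: "1 - (norm \<beta>)\<^sup>2 > 0" using assms by (simp add: power_less_one_iff)
  have a: "cnj a = a" "a \<noteq> 0" "(norm a)\<^sup>2 = 1 / (1 - (norm \<beta>)\<^sup>2)"
    using pos by (auto simp: a_def power_divide norm_divide)
  define g :: "complex^2^2" where
    "g = (\<chi> i j. if i = 1 then (if j = 1 then a else \<beta> * a) else (if j = 1 then cnj (\<beta> * a) else cnj a))"
  have e: "g $ 1 $ 1 = a" "g $ 1 $ 2 = \<beta> * a" by (simp_all add: g_def)
  have "(norm a)\<^sup>2 - (norm (\<beta> * a))\<^sup>2 = (norm a)\<^sup>2 * (1 - (norm \<beta>)\<^sup>2)"
    by (simp add: norm_mult power_mult_distrib algebra_simps)
  also have "\<dots> = 1" using pos by (simp add: a(3))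
  finally have g: "g \<in> SU11" by (simp add: SU11_def g_def)
  interpret su11 a "\<beta> * a" using SU11_su11[OF g] unfolding e .
  have "move 0 = \<beta>" using a by (simp add: move_def denom_def)
  then show ?thesis using g that[of g] by (simp add: e)
qed

lemma intertwining_bounded: "intertwining s B \<Longrightarrow> x \<in> Hneg s \<Longrightarrow> bounded_op (B x)"
  by (simp add: intertwining_def HS_op_def)

lemma intertwining_class_eq:
  "intertwining s B \<Longrightarrow> x \<in> Hneg s \<Longrightarrow> y \<in> Hneg s \<Longrightarrow> Hneg_class_eq s x y \<Longrightarrow> op_eq (B x) (B y)"
  by (simp add: intertwining_def)

lemma intertwining_add:
  "intertwining s B \<Longrightarrow> x \<in> Hneg s \<Longrightarrow> y \<in> Hneg s \<Longrightarrow>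
    op_eq (B (\<lambda>z. x z + y z)) (\<lambda>f z. B x f z + B y f z)"
  by (simp add: intertwining_def)

lemma intertwining_cmult:
  "intertwining s B \<Longrightarrow> x \<in> Hneg s \<Longrightarrow> op_eq (B (\<lambda>z. c * x z)) (\<lambda>f z. c * B x f z)"
  by (simp add: intertwining_def)

lemma HS_norm_ge:
  assumes "HS_op T"
  shows "hd_norm (T (\<lambda>z. z powi neg_index n)) \<le> HS_norm T"
proof -
  have "(hd_norm (T (\<lambda>z. z powi neg_index n)))\<^sup>2 \<le> (\<Sum>n. (hd_norm (T (\<lambda>z. z powi neg_index n)))\<^sup>2)"
    using assms sum_le_suminf[of "\<lambda>n. (hd_norm (T (\<lambda>z. z powi neg_index n)))\<^sup>2" "{n}"]
    by (simp add: HS_op_def del: of_nat_Suc)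
  then show ?thesis unfolding HS_norm_def by (rule real_le_rsqrt)
qed

text \<open>The transform of z^(2 s + 1) is a multiple of an orbit symbol modulo polynomials of
  degree at most 2 s, so class invariance, homogeneity and equivariance express the map at that
  symbol through its value at \<open>geo s 0\<close>.\<close>

lemma intertwining_geo:
  fixes g :: "complex^2^2"
  assumes B: "intertwining s B" and g: "g \<in> SU11"
  defines "a \<equiv> g $ 1 $ 1" and "b \<equiv> g $ 1 $ 2"
  assumes e: "e \<in> HD_minus"
  shows "inverse (su11.denom a b 0) ^ (2 * s + 2) * hd_coeff (B (geo s (su11.move a b 0)) e) j
    = hd_coeff (su11.tr a b (B (geo s 0) (su11.tr (cnj a) (- b) e))) j"
proof -
  interpret su11 a b unfolding a_def b_def by (rule SU11_su11[OF g])
  interpret inv: su11 "cnj a" "- b" by (rule su11_inverse)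
  let ?c = "inverse (denom 0) ^ (2 * s + 2)" and ?y = "geo s (move 0)"
  have y: "?y \<in> Hneg s" by (intro geo_Hneg norm_move) simp
  have y0: "geo s 0 \<in> Hneg s" by (intro geo_Hneg) simp
  have cl: "Hneg_class_eq s (pull s (geo s 0)) (\<lambda>z. ?c * ?y z)" by (rule pull_geo) simp
  have p: "pull s (geo s 0) \<in> Hneg s"
    by (rule Hneg_class_eq_in_Hneg[OF pull_holomorphic[OF Hneg_holomorphic[OF y0]] Hneg_cmult[OF y] cl])
  note bd = intertwining_bounded[OF B]
  have "op_eq (B (pull s (geo s 0))) (B (\<lambda>z. ?c * ?y z))"
    by (rule intertwining_class_eq[OF B p Hneg_cmult[OF y] cl])
  then have 1: "hd_eq (B (pull s (geo s 0)) e) (B (\<lambda>z. ?c * ?y z) e)" using e by (simp add: op_eq_def)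
  have "op_eq (B (\<lambda>z. ?c * ?y z)) (\<lambda>f z. ?c * B ?y f z)"
    by (rule intertwining_cmult[OF B y])
  then have 2: "hd_eq (B (\<lambda>z. ?c * ?y z) e) (\<lambda>z. ?c * B ?y e z)" using e by (simp add: op_eq_def)
  have "op_eq (B (act (- 2 * int s) g (geo s 0))) (conj_act g (B (geo s 0)))"
    using B g y0 unfolding intertwining_def by blast
  then have 3: "hd_eq (B (pull s (geo s 0)) e) (tr (B (geo s 0) (inv.tr e)))"
    unfolding act_neg[OF g] conj_act_tr[OF g] a_def[symmetric] b_def[symmetric] using e by (simp add: op_eq_def)
  have "hd_eq (\<lambda>z. ?c * B ?y e z) (tr (B (geo s 0) (inv.tr e)))"
    using hd_eq_trans[OF hd_eq_sym[OF hd_eq_trans[OF 1 2]] 3] .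
  then have "hd_coeff (\<lambda>z. ?c * B ?y e z) j = hd_coeff (tr (B (geo s 0) (inv.tr e))) j"
    by (rule hd_coeff_cong[OF HD_cmult[OF bounded_op_in_HD[OF bd[OF y] e]]
        HD_tr[OF bounded_op_in_HD[OF bd[OF y0] inv.HD_minus_tr[OF e]]]])
  then show ?thesis by (simp add: hd_coeff_cmult)
qed

text \<open>Each Fourier coefficient of the image of a basis function is a bounded functional of the
  symbol, because a single column is dominated by the Hilbert-Schmidt norm.
  \<open>SU11_transitive\<close> and \<open>intertwining_geo\<close> then settle all orbit
  symbols.\<close>

lemma intertwining_unique:
  assumes B: "intertwining s B" and B': "intertwining s B'"
    and eq: "op_eq (B (geo s 0)) (B' (geo s 0))" and x: "x \<in> Hneg s"
  shows "hd_coeff (B x (\<lambda>z. z powi neg_index n)) j = hd_coeff (B' x (\<lambda>z. z powi neg_index n)) j"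
proof -
  let ?e = "\<lambda>z :: complex. z powi neg_index n"
  have e: "?e \<in> HD_minus" by (rule HD_minus_powi)
  have sums: "(\<lambda>m. taylor x m * hd_coeff (D (\<lambda>z. z ^ m) ?e) j) sums hd_coeff (D x ?e) j"
    if D: "intertwining s D" and x: "x \<in> Hneg s" for D x
  proof -
    note bd = bounded_op_in_HD[OF intertwining_bounded[OF D] e]
    obtain C where C: "\<forall>x\<in>Hneg s. HS_norm (D x) \<le> C * Hneg_norm s x"
      using D unfolding intertwining_def by blast
    show ?thesis
    proof (rule Hneg_functional_sums[OF x])
      fix x y assume "x \<in> Hneg s" "y \<in> Hneg s"
      moreover from this have "op_eq (D (\<lambda>z. x z + y z)) (\<lambda>f z. D x f z + D y f z)"
        by (rule intertwining_add[OF D])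
      then have "hd_eq (D (\<lambda>z. x z + y z) ?e) (\<lambda>z. D x ?e z + D y ?e z)" using e unfolding op_eq_def by blast
      ultimately have "hd_coeff (D (\<lambda>z. x z + y z) ?e) j = hd_coeff (\<lambda>z. D x ?e z + D y ?e z) j"
        by (intro hd_coeff_cong HD_add bd Hneg_add)
      then show "hd_coeff (D (\<lambda>z. x z + y z) ?e) j = hd_coeff (D x ?e) j + hd_coeff (D y ?e) j"
        using \<open>x \<in> Hneg s\<close> \<open>y \<in> Hneg s\<close> by (simp only: hd_coeff_add bd)
    next
      fix c x assume "x \<in> Hneg s"
      moreover from this have "op_eq (D (\<lambda>z. c * x z)) (\<lambda>f z. c * D x f z)"
        by (rule intertwining_cmult[OF D])
      then have "hd_eq (D (\<lambda>z. c * x z) ?e) (\<lambda>z. c * D x ?e z)" using e unfolding op_eq_def by blast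
      ultimately have "hd_coeff (D (\<lambda>z. c * x z) ?e) j = hd_coeff (\<lambda>z. c * D x ?e z) j"
        by (intro hd_coeff_cong HD_cmult bd Hneg_cmult)
      then show "hd_coeff (D (\<lambda>z. c * x z) ?e) j = c * hd_coeff (D x ?e) j"
        by (simp only: hd_coeff_cmult)
    next
      fix x assume x: "x \<in> Hneg s"
      then have "HS_op (D x)" using D unfolding intertwining_def by blast
      then have "hd_norm (D x ?e) \<le> HS_norm (D x)" by (rule HS_norm_ge)
      then show "norm (hd_coeff (D x ?e) j) \<le> C * Hneg_norm s x"
        using hd_coeff_le_norm[OF bd[OF x], of j] C x by (meson order_trans)
    qed
  qed
  define \<phi> where "\<phi> x = hd_coeff (B x ?e) j - hd_coeff (B' x ?e) j" for x
  have "\<phi> x = 0"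
  proof (rule geo_total[OF _ _ _ x])
    fix x assume x: "x \<in> Hneg s"
    show "(\<lambda>m. taylor x m * \<phi> (\<lambda>z. z ^ m)) sums \<phi> x"
      unfolding \<phi>_def right_diff_distrib by (intro sums_diff sums B B' x)
  next
    fix \<beta> :: complex assume "norm \<beta> < 1"
    then obtain g :: "complex^2^2" where g: "g \<in> SU11" "su11.move (g $ 1 $ 1) (g $ 1 $ 2) 0 = \<beta>" by (rule SU11_transitive)
    interpret su11 "g $ 1 $ 1" "g $ 1 $ 2" by (rule SU11_su11[OF g(1)])
    interpret inv: su11 "cnj (g $ 1 $ 1)" "- (g $ 1 $ 2)" by (rule su11_inverse)
    have y0: "geo s 0 \<in> Hneg s" by (intro geo_Hneg) simp
    have h: "inv.tr ?e \<in> HD_minus" by (rule inv.HD_minus_tr[OF e])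
    have 1: "B (geo s 0) (inv.tr ?e) \<in> HD" by (rule bounded_op_in_HD[OF intertwining_bounded[OF B y0] h])
    have 2: "B' (geo s 0) (inv.tr ?e) \<in> HD" by (rule bounded_op_in_HD[OF intertwining_bounded[OF B' y0] h])
    have "hd_eq (B (geo s 0) (inv.tr ?e)) (B' (geo s 0) (inv.tr ?e))" using eq h by (simp add: op_eq_def)
    then have "hd_coeff (tr (B (geo s 0) (inv.tr ?e))) j = hd_coeff (tr (B' (geo s 0) (inv.tr ?e))) j"
      by (rule hd_coeff_cong[OF HD_tr[OF 1] HD_tr[OF 2] tr_cong[OF 1 2]])
    then have "inverse (denom 0) ^ (2 * s + 2) * hd_coeff (B (geo s \<beta>) ?e) j = inverse (denom 0) ^ (2 * s + 2) * hd_coeff (B' (geo s \<beta>) ?e) j"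
      using intertwining_geo[OF B g(1) e, of j] intertwining_geo[OF B' g(1) e, of j] unfolding g(2) by simp
    then show "\<phi> (geo s \<beta>) = 0" using denom_nz[of 0] by (simp add: \<phi>_def)
  next
    fix m assume m: "m \<le> 2 * s"
    have z: "hd_coeff (D (\<lambda>z. z ^ m) ?e) j = 0" if D: "intertwining s D" for D
    proof -
      have zero: "(\<lambda>z. 0 * z ^ m) \<in> Hneg s" by (intro Hneg_cmult Hneg_power)
      have "Hneg_class_eq s (\<lambda>z. z ^ m) (\<lambda>z. 0 * z ^ m)"
        unfolding Hneg_class_eq_def
        by (rule exI[of _ "monom 1 m"]) (use m in \<open>auto simp: poly_monom degree_monom_eq\<close>)
      then have "op_eq (D (\<lambda>z. z ^ m)) (D (\<lambda>z. 0 * z ^ m))"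
        by (rule intertwining_class_eq[OF D Hneg_power zero])
      moreover have "op_eq (D (\<lambda>z. 0 * z ^ m)) (\<lambda>f z. 0 * D (\<lambda>z. z ^ m) f z)"
        by (rule intertwining_cmult[OF D Hneg_power])
      ultimately have "hd_eq (D (\<lambda>z. z ^ m) ?e) (\<lambda>z. 0 * D (\<lambda>z. z ^ m) ?e z)"
        using e unfolding op_eq_def by (blast intro: hd_eq_trans)
      then have "hd_coeff (D (\<lambda>z. z ^ m) ?e) j = hd_coeff (\<lambda>z. 0 * D (\<lambda>z. z ^ m) ?e z) j"
        by (intro hd_coeff_cong HD_cmult bounded_op_in_HD[OF intertwining_bounded[OF D] e] Hneg_power)
      then show ?thesis by simp
    qed
    show "\<phi> (\<lambda>z. z ^ m) = 0" using z[OF B] z[OF B'] by (simp only: \<phi>_def) simp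
  qed
  then show ?thesis by (simp add: \<phi>_def)
qed

theorem theorem1p1:
  fixes s :: nat and x :: "complex \<Rightarrow> complex" and xc :: "nat \<Rightarrow> complex"
  assumes "x \<in> Hneg s"
    and "\<And>z. z \<in> ball 0 1 \<Longrightarrow> (\<lambda>i. xc (s + 1 + i) * z ^ (s + (s + 1 + i))) sums x z"
  shows "(\<exists>B. hankel_map s B) \<and>
         (\<forall>B. hankel_map s B \<longrightarrow> is_Pplus_L_Pminus s x (B x))"
proof (intro conjI allI impI)
  show "\<exists>B. hankel_map s B" using hankel_op_hankel_map by blast
next
  fix B assume B: "hankel_map s B"
  \<comment> \<open>The normalization is a condition at \<open>geo s 0\<close>, which is z^(2 s +
    1); it removes the scalar ambiguity.\<close>
  have "op_eq (B (geo s 0)) (hankel_op s (geo s 0))"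
    using B hankel_op_hankel_map[of s] unfolding hankel_map_def geo_0 op_eq_def
    by (blast intro: hd_eq_trans hd_eq_sym)
  moreover have Bi: "intertwining s B" using B by (simp add: hankel_map_def)
  ultimately have "hd_coeff (B x (\<lambda>z. z powi neg_index n)) (int k) = hankel_matrix s x k n" for k n
    unfolding mat_image_basis[OF hankel_op_image[OF assms(1) HD_minus_powi], symmetric]
    by (rule intertwining_unique[OF _ hankel_op_intertwining _ assms(1), rotated])
  then show "is_Pplus_L_Pminus s x (B x)"
    by (rule is_Pplus_L_PminusI[OF intertwining_bounded[OF Bi assms(1)]])
qed

end
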